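(* Let $T=\int_Z^\oplus T(\zeta)\,d\omega(\zeta)$ be a closed, (possibly unbounded), self-adjoint, decomposable operator on the direct integral Hilbert space $\mathcal{H}=\int_Z^\oplus\mathcal{H}(\zeta)\,d\omega(\zeta)$. For every Borel subset $B\subset\mathbb{R}$, we have $$E_T(B)=\int_Z^\oplus E_{T(\zeta)}(B)\,d\omega(\zeta).$$ Moreover, for every (possibly unbounded) Borel measurable function $f:\mathbb{R}\to\mathbb{R}$, we have $$f(T)=\int_Z^\oplus f(T(\zeta))\,d\omega(\zeta).$$
   Context: Direct integrals. $Z$ is a standard Borel space (a Polish space with its Borel $\sigma$-algebra) and $\omega$ is a $\sigma$-finite positive measure on it. A measurable field of Hilbert spaces is a map $\zeta\mapsto\mathcal{H}(\zeta)$, each $\mathcal{H}(\zeta)$ a Hilbert space, with a set $S$ of vector fields $\zeta\mapsto x(\zeta)\in\mathcal{H}(\zeta)$ (called measurable) such that (i) $\zeta\mapsto\langle x(\zeta),y(\zeta)\rangle$ is measurable for all $x,y\in S$; (ii) if $v$ is a vector field with $\zeta\mapsto\langle x(\zeta),v(\zeta)\rangle$ measurable for every $x\in S$, then $v\in S$; (iii) there is a sequence $(x_n)$ in $S$ such that $\{x_n(\zeta)\}_n$ has dense linear span in $\mathcal{H}(\zeta)$ for every $\zeta$. The direct integral $\mathcal{H}=\int_Z^\oplus\mathcal{H}(\zeta)\,d\omega(\zeta)$ is the Hilbert space of all $x\in S$ (modulo a.e. equality) with $\int_Z\|x(\zeta)\|^2d\omega<\infty$ and inner product $\int_Z\langle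 x(\zeta),y(\zeta)\rangle\,d\omega(\zeta)$. Decomposable operators. A field of bounded operators $T(\zeta)\in B(\mathcal{H}(\zeta))$ is measurable if $\zeta\mapsto T(\zeta)x(\zeta)$ is in $S$ for all $x\in S$. If moreover $\zeta\mapsto\|T(\zeta)\|$ is essentially bounded, it defines a bounded decomposable operator $T=\int_Z^\oplus T(\zeta)\,d\omega(\zeta)$ by $(Tx)(\zeta)=T(\zeta)x(\zeta)$. A field of closed operators $T(\zeta)$ on $\mathcal{H}(\zeta)$ is measurable if the four entries of the projection in $M_2(B(\mathcal{H}(\zeta)))$ onto the graph of $T(\zeta)$ are measurable fields of bounded operators. The associated closed operator $T=\int_Z^\oplus T(\zeta)\,d\omega(\zeta)$ has domain the set of $x\in\mathcal{H}$ represented by square integrable fields with $x(\zeta)\in\mathrm{dom}(T(\zeta))$ for all $\zeta$ and $\zeta\mapsto T(\zeta)x(\zeta)$ square integrable, and $(Tx)(\zeta)=T(\zeta)x(\zeta)$. Closed operators of this form are called decomposable. Fields are identified when they agree almost everywhere. A decomposable closed $T$ is self-adjoint if and only if $T(\zeta)$ is self-adjoint for almost every $\zeta$. An equality $R=\int_Z^\oplus R(\zeta)\,d\omega(\zeta)$ asserts that the (a.e. defined) field $R(\zeta)$ is measurable and that $R$ is the associated decomposable operator. $E_T(B)$ denotes the spectral projection of the self-adjoint operator $T$ for the Borel set $B$, and $f(T)$ is the Borel functional calculus. *)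

theory Defs
  imports "HOL-Analysis.Analysis"
begin

section \<open>Complex Hilbert spaces on carrier sets\<close>

text \<open>The fibres of a measurable field are pairwise different spaces and the direct integral is a
  space of classes of vector fields, so Hilbert spaces are structures on carrier sets, not types.
  Inner products are linear in the first argument.\<close>

record 'v hspace =
  hcarrier :: "'v set"
  hzero :: 'v
  hadd :: "'v \<Rightarrow> 'v \<Rightarrow> 'v"
  hscale :: "complex \<Rightarrow> 'v \<Rightarrow> 'v"
  hinner :: "'v \<Rightarrow> 'v \<Rightarrow> complex"

definition hnorm :: "'v hspace \<Rightarrow> 'v \<Rightarrow> real" where
  "hnorm H x = sqrt (Re (hinner H x x))"

text \<open>The locale \<^locale>\<open>Metric_space\<close> asks for symmetry and nonnegativity of the distance also
  outside the carrier; hence the value 0 there.\<close>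

definition hdist :: "'v hspace \<Rightarrow> 'v \<Rightarrow> 'v \<Rightarrow> real" where
  "hdist H x y =
    (if x \<in> hcarrier H \<and> y \<in> hcarrier H then hnorm H (hadd H x (hscale H (- 1) y)) else 0)"

definition htopology :: "'v hspace \<Rightarrow> 'v topology" where
  "htopology H = Metric_space.mtopology (hcarrier H) (hdist H)"

locale hilbert_space =
  fixes H :: "'v hspace"
  assumes zero_closed: "hzero H \<in> hcarrier H"
    and add_closed: "\<And>x y. x \<in> hcarrier H \<Longrightarrow> y \<in> hcarrier H \<Longrightarrow> hadd H x y \<in> hcarrier H"
    and scale_closed: "\<And>c x. x \<in> hcarrier H \<Longrightarrow> hscale H c x \<in> hcarrier H"
    and add_assoc: "\<And>x y z. x \<in> hcarrier H \<Longrightarrow> y \<in> hcarrier H \<Longrightarrow> z \<in> hcarrier H \<Longrightarrow>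
        hadd H (hadd H x y) z = hadd H x (hadd H y z)"
    and add_commute: "\<And>x y. x \<in> hcarrier H \<Longrightarrow> y \<in> hcarrier H \<Longrightarrow> hadd H x y = hadd H y x"
    and add_zero: "\<And>x. x \<in> hcarrier H \<Longrightarrow> hadd H x (hzero H) = x"
    and add_inverse: "\<And>x. x \<in> hcarrier H \<Longrightarrow> hadd H x (hscale H (- 1) x) = hzero H"
    and scale_add_right: "\<And>c x y. x \<in> hcarrier H \<Longrightarrow> y \<in> hcarrier H \<Longrightarrow>
        hscale H c (hadd H x y) = hadd H (hscale H c x) (hscale H c y)"
    and scale_add_left: "\<And>c d x. x \<in> hcarrier H \<Longrightarrow>
        hscale H (c + d) x = hadd H (hscale H c x) (hscale H d x)"
    and scale_scale: "\<And>c d x. x \<in> hcarrier H \<Longrightarrow> hscale H c (hscale H d x) = hscale H (c * d) x"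
    and scale_one: "\<And>x. x \<in> hcarrier H \<Longrightarrow> hscale H 1 x = x"
    and inner_commute: "\<And>x y. x \<in> hcarrier H \<Longrightarrow> y \<in> hcarrier H \<Longrightarrow>
        hinner H x y = cnj (hinner H y x)"
    and inner_add_left: "\<And>x y z. x \<in> hcarrier H \<Longrightarrow> y \<in> hcarrier H \<Longrightarrow> z \<in> hcarrier H \<Longrightarrow>
        hinner H (hadd H x y) z = hinner H x z + hinner H y z"
    and inner_scale_left: "\<And>c x y. x \<in> hcarrier H \<Longrightarrow> y \<in> hcarrier H \<Longrightarrow>
        hinner H (hscale H c x) y = c * hinner H x y"
    and inner_nonneg: "\<And>x. x \<in> hcarrier H \<Longrightarrow> 0 \<le> Re (hinner H x x)"
    and inner_definite: "\<And>x. x \<in> hcarrier H \<Longrightarrow> hinner H x x = 0 \<Longrightarrow> x = hzero H"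
    and complete: "Metric_space.mcomplete (hcarrier H) (hdist H)"

definition hsubspace :: "'v hspace \<Rightarrow> 'v set \<Rightarrow> bool" where
  "hsubspace H U \<longleftrightarrow> U \<subseteq> hcarrier H \<and> hzero H \<in> U \<and>
    (\<forall>x\<in>U. \<forall>y\<in>U. hadd H x y \<in> U) \<and> (\<forall>c. \<forall>x\<in>U. hscale H c x \<in> U)"

definition hdense :: "'v hspace \<Rightarrow> 'v set \<Rightarrow> bool" where
  "hdense H A \<longleftrightarrow> htopology H closure_of A = hcarrier H"

definition hsum :: "'v hspace \<Rightarrow> 'w hspace \<Rightarrow> ('v \<times> 'w) hspace" where
  "hsum H K =
    \<lparr> hcarrier = hcarrier H \<times> hcarrier K,
      hzero = (hzero H, hzero K),
      hadd = (\<lambda>p q. (hadd H (fst p) (fst q), hadd K (snd p) (snd q))),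
      hscale = (\<lambda>c p. (hscale H c (fst p), hscale K c (snd p))),
      hinner = (\<lambda>p q. hinner H (fst p) (fst q) + hinner K (snd p) (snd q)) \<rparr>"

text \<open>The orthogonal projection of \<open>x\<close> onto \<open>G\<close>: the point \<open>p\<close> of \<open>G\<close> with \<open>x - p\<close> orthogonal to \<open>G\<close>.\<close>

definition hproj :: "'v hspace \<Rightarrow> 'v set \<Rightarrow> 'v \<Rightarrow> 'v" where
  "hproj H G x = (THE p. p \<in> G \<and> (\<forall>g\<in>G. hinner H x g = hinner H p g))"


section \<open>Operators\<close>

text \<open>Bounded operators are functions, \<open>undefined\<close> off the carrier; possibly unbounded operators are
  identified with their graphs. In both cases HOL equality is equality of operators.\<close>

definition bounded_operators :: "'v hspace \<Rightarrow> ('v \<Rightarrow> 'v) set" where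
  "bounded_operators H = {A \<in> hcarrier H \<rightarrow>\<^sub>E hcarrier H.
    (\<forall>x\<in>hcarrier H. \<forall>y\<in>hcarrier H. A (hadd H x y) = hadd H (A x) (A y)) \<and>
    (\<forall>c. \<forall>x\<in>hcarrier H. A (hscale H c x) = hscale H c (A x)) \<and>
    (\<exists>C. \<forall>x\<in>hcarrier H. hnorm H (A x) \<le> C * hnorm H x)}"

definition hopnorm :: "'v hspace \<Rightarrow> ('v \<Rightarrow> 'v) \<Rightarrow> real" where
  "hopnorm H A = (SUP x\<in>{x \<in> hcarrier H. hnorm H x \<le> 1}. hnorm H (A x))"

definition projection :: "'v hspace \<Rightarrow> ('v \<Rightarrow> 'v) \<Rightarrow> bool" where
  "projection H P \<longleftrightarrow> P \<in> bounded_operators H \<and>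
    (\<forall>x\<in>hcarrier H. P (P x) = P x) \<and>
    (\<forall>x\<in>hcarrier H. \<forall>y\<in>hcarrier H. hinner H (P x) y = hinner H x (P y))"

type_synonym 'v operator = "('v \<times> 'v) set"

definition linear_operator :: "'v hspace \<Rightarrow> 'v operator \<Rightarrow> bool" where
  "linear_operator H T \<longleftrightarrow> hsubspace (hsum H H) T \<and> single_valued T"

definition closed_operator :: "'v hspace \<Rightarrow> 'v operator \<Rightarrow> bool" where
  "closed_operator H T \<longleftrightarrow> linear_operator H T \<and> closedin (htopology (hsum H H)) T"

definition hadjoint :: "'v hspace \<Rightarrow> 'v operator \<Rightarrow> 'v operator" where
  "hadjoint H T = {(y, w). y \<in> hcarrier H \<and> w \<in> hcarrier H \<and>
    (\<forall>(x, u)\<in>T. hinner H u y = hinner H x w)}"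

definition self_adjoint :: "'v hspace \<Rightarrow> 'v operator \<Rightarrow> bool" where
  "self_adjoint H T \<longleftrightarrow> linear_operator H T \<and> hdense H (Domain T) \<and> hadjoint H T = T"


section \<open>Spectral measures and Borel functional calculus\<close>

text \<open>Countable additivity is that of all the set functions \<open>B \<mapsto> \<langle>E(B) x, y\<rangle>\<close>.
  The value of \<open>E\<close> at non-Borel sets is \<open>undefined\<close>, so that a spectral measure is unique as a
  HOL function.\<close>

definition projection_valued_measure :: "'v hspace \<Rightarrow> (real set \<Rightarrow> 'v \<Rightarrow> 'v) \<Rightarrow> bool" where
  "projection_valued_measure H E \<longleftrightarrow>
    E \<in> sets borel \<rightarrow>\<^sub>E Collect (projection H) \<and>
    (\<forall>x\<in>hcarrier H. E UNIV x = x) \<and>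
    (\<forall>A\<in>sets borel. \<forall>B\<in>sets borel. \<forall>x\<in>hcarrier H. E (A \<inter> B) x = E A (E B x)) \<and>
    (\<forall>A. range A \<subseteq> sets borel \<longrightarrow> disjoint_family A \<longrightarrow>
      (\<forall>x\<in>hcarrier H. \<forall>y\<in>hcarrier H.
        (\<lambda>n. hinner H (E (A n) x) y) sums hinner H (E (\<Union>n. A n) x) y))"

definition scalar_measure :: "'v hspace \<Rightarrow> (real set \<Rightarrow> 'v \<Rightarrow> 'v) \<Rightarrow> 'v \<Rightarrow> real measure" where
  "scalar_measure H E x = measure_of UNIV (sets borel) (\<lambda>B. ennreal (Re (hinner H (E B x) x)))"

definition spectral_domain ::
    "'v hspace \<Rightarrow> (real set \<Rightarrow> 'v \<Rightarrow> 'v) \<Rightarrow> (real \<Rightarrow> real) \<Rightarrow> 'v set" where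
  "spectral_domain H E f = {x \<in> hcarrier H. integrable (scalar_measure H E x) (\<lambda>t. (f t)\<^sup>2)}"

text \<open>The integral of \<open>f\<close> against the complex measure \<open>B \<mapsto> \<langle>E(B) x, z\<rangle>\<close>, which by polarization is
  \<open>(1/4) \<Sum>\<^sub>k \<i>\<^sup>k \<mu>\<^sub>k\<close> with \<open>\<mu>\<^sub>k\<close> the scalar measure of \<open>x + \<i>\<^sup>k z\<close>.\<close>

definition sesq_integral ::
    "'v hspace \<Rightarrow> (real set \<Rightarrow> 'v \<Rightarrow> 'v) \<Rightarrow> (real \<Rightarrow> real) \<Rightarrow> 'v \<Rightarrow> 'v \<Rightarrow> complex" where
  "sesq_integral H E f x z = (1 / 4) * (\<Sum>k<4. \<i> ^ k *
    complex_of_real (LINT t|scalar_measure H E (hadd H x (hscale H (\<i> ^ k) z)). f t))"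

text \<open>\<open>\<integral> f dE\<close>, the operator \<open>A\<close> with domain \<open>D = {x. \<integral> f\<^sup>2 d\<langle>E x, x\<rangle> < \<infinity>}\<close> and
  \<open>\<langle>A x, z\<rangle> = \<integral> f d\<langle>E x, z\<rangle>\<close>. Testing with \<open>z\<close> in the dense subspace \<open>D\<close> determines \<open>A x\<close>
  and makes all integrals converge.\<close>

definition spectral_integral ::
    "'v hspace \<Rightarrow> (real set \<Rightarrow> 'v \<Rightarrow> 'v) \<Rightarrow> (real \<Rightarrow> real) \<Rightarrow> 'v operator" where
  "spectral_integral H E f = {(x, y). x \<in> spectral_domain H E f \<and> y \<in> hcarrier H \<and>
    (\<forall>z\<in>spectral_domain H E f. hinner H y z = sesq_integral H E f x z)}"

definition spectral_measure :: "'v hspace \<Rightarrow> 'v operator \<Rightarrow> real set \<Rightarrow> 'v \<Rightarrow> 'v" where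
  "spectral_measure H T =
    (THE E. projection_valued_measure H E \<and> spectral_integral H E (\<lambda>t. t) = T)"

definition borel_calculus :: "'v hspace \<Rightarrow> 'v operator \<Rightarrow> (real \<Rightarrow> real) \<Rightarrow> 'v operator" where
  "borel_calculus H T f = spectral_integral H (spectral_measure H T) f"


section \<open>Measurable fields and direct integrals\<close>

locale measurable_field =
  fixes \<omega> :: "'z measure" and H :: "'z \<Rightarrow> 'h hspace" and S :: "('z \<Rightarrow> 'h) set"
  assumes fibre: "\<And>\<zeta>. \<zeta> \<in> space \<omega> \<Longrightarrow> hilbert_space (H \<zeta>)"
    and vector_fields: "S \<subseteq> (\<Pi> \<zeta>\<in>space \<omega>. hcarrier (H \<zeta>))"
    and inner_measurable: "\<And>x y. x \<in> S \<Longrightarrow> y \<in> S \<Longrightarrow>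
        (\<lambda>\<zeta>. hinner (H \<zeta>) (x \<zeta>) (y \<zeta>)) \<in> borel_measurable \<omega>"
    and maximal: "\<And>v. v \<in> (\<Pi> \<zeta>\<in>space \<omega>. hcarrier (H \<zeta>)) \<Longrightarrow>
        (\<And>x. x \<in> S \<Longrightarrow> (\<lambda>\<zeta>. hinner (H \<zeta>) (x \<zeta>) (v \<zeta>)) \<in> borel_measurable \<omega>) \<Longrightarrow> v \<in> S"
    and fundamental_sequence: "\<exists>x :: nat \<Rightarrow> 'z \<Rightarrow> 'h. range x \<subseteq> S \<and>
        (\<forall>\<zeta>\<in>space \<omega>. hdense (H \<zeta>) (hsubspace (H \<zeta>) hull range (\<lambda>n. x n \<zeta>)))"

definition square_integrable_fields ::
    "'z measure \<Rightarrow> ('z \<Rightarrow> 'h hspace) \<Rightarrow> ('z \<Rightarrow> 'h) set \<Rightarrow> ('z \<Rightarrow> 'h) set" where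
  "square_integrable_fields \<omega> H S = {x \<in> S. integrable \<omega> (\<lambda>\<zeta>. (hnorm (H \<zeta>) (x \<zeta>))\<^sup>2)}"

definition field_class ::
    "'z measure \<Rightarrow> ('z \<Rightarrow> 'h hspace) \<Rightarrow> ('z \<Rightarrow> 'h) set \<Rightarrow> ('z \<Rightarrow> 'h) \<Rightarrow> ('z \<Rightarrow> 'h) set" where
  "field_class \<omega> H S x = {y \<in> square_integrable_fields \<omega> H S. AE \<zeta> in \<omega>. y \<zeta> = x \<zeta>}"

definition field_rep :: "('z \<Rightarrow> 'h) set \<Rightarrow> 'z \<Rightarrow> 'h" where
  "field_rep X = (SOME x. x \<in> X)"

definition direct_integral ::
    "'z measure \<Rightarrow> ('z \<Rightarrow> 'h hspace) \<Rightarrow> ('z \<Rightarrow> 'h) set \<Rightarrow> ('z \<Rightarrow> 'h) set hspace" where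
  "direct_integral \<omega> H S =
    \<lparr> hcarrier = field_class \<omega> H S ` square_integrable_fields \<omega> H S,
      hzero = field_class \<omega> H S (\<lambda>\<zeta>. hzero (H \<zeta>)),
      hadd = (\<lambda>X Y. field_class \<omega> H S (\<lambda>\<zeta>. hadd (H \<zeta>) (field_rep X \<zeta>) (field_rep Y \<zeta>))),
      hscale = (\<lambda>c X. field_class \<omega> H S (\<lambda>\<zeta>. hscale (H \<zeta>) c (field_rep X \<zeta>))),
      hinner = (\<lambda>X Y. LINT \<zeta>|\<omega>. hinner (H \<zeta>) (field_rep X \<zeta>) (field_rep Y \<zeta>)) \<rparr>"

definition measurable_bounded_field ::
    "'z measure \<Rightarrow> ('z \<Rightarrow> 'h hspace) \<Rightarrow> ('z \<Rightarrow> 'h) set \<Rightarrow> ('z \<Rightarrow> 'h \<Rightarrow> 'h) \<Rightarrow> bool" where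
  "measurable_bounded_field \<omega> H S A \<longleftrightarrow>
    (\<forall>\<zeta>\<in>space \<omega>. A \<zeta> \<in> bounded_operators (H \<zeta>)) \<and> (\<forall>x\<in>S. (\<lambda>\<zeta>. A \<zeta> (x \<zeta>)) \<in> S)"

definition bounded_integral_operator ::
    "'z measure \<Rightarrow> ('z \<Rightarrow> 'h hspace) \<Rightarrow> ('z \<Rightarrow> 'h) set \<Rightarrow> ('z \<Rightarrow> 'h \<Rightarrow> 'h) \<Rightarrow>
      ('z \<Rightarrow> 'h) set \<Rightarrow> ('z \<Rightarrow> 'h) set" where
  "bounded_integral_operator \<omega> H S A =
    (\<lambda>X\<in>hcarrier (direct_integral \<omega> H S). field_class \<omega> H S (\<lambda>\<zeta>. A \<zeta> (field_rep X \<zeta>)))"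

text \<open>\<open>R = \<integral>\<^sup>\<oplus> A(\<zeta>) d\<omega>(\<zeta>)\<close> for an almost everywhere defined field of bounded operators: \<open>A\<close> agrees
  almost everywhere with an everywhere defined measurable field inducing \<open>R\<close>.\<close>

definition is_bounded_integral ::
    "'z measure \<Rightarrow> ('z \<Rightarrow> 'h hspace) \<Rightarrow> ('z \<Rightarrow> 'h) set \<Rightarrow>
      (('z \<Rightarrow> 'h) set \<Rightarrow> ('z \<Rightarrow> 'h) set) \<Rightarrow> ('z \<Rightarrow> 'h \<Rightarrow> 'h) \<Rightarrow> bool" where
  "is_bounded_integral \<omega> H S R A \<longleftrightarrow> (\<exists>A'.
    measurable_bounded_field \<omega> H S A' \<and>
    (\<exists>C. AE \<zeta> in \<omega>. hopnorm (H \<zeta>) (A' \<zeta>) \<le> C) \<and>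
    (AE \<zeta> in \<omega>. A' \<zeta> = A \<zeta>) \<and>
    R = bounded_integral_operator \<omega> H S A')"

definition graph_projection :: "'v hspace \<Rightarrow> 'v operator \<Rightarrow> 'v \<times> 'v \<Rightarrow> 'v \<times> 'v" where
  "graph_projection H T = hproj (hsum H H) T"

text \<open>The conjuncts below after the first are the entries \<open>p\<^sub>1\<^sub>1, p\<^sub>1\<^sub>2, p\<^sub>2\<^sub>1, p\<^sub>2\<^sub>2\<close> of the matrix of
  the graph projection.\<close>

definition measurable_closed_field ::
    "'z measure \<Rightarrow> ('z \<Rightarrow> 'h hspace) \<Rightarrow> ('z \<Rightarrow> 'h) set \<Rightarrow> ('z \<Rightarrow> 'h operator) \<Rightarrow> bool" where
  "measurable_closed_field \<omega> H S T \<longleftrightarrow>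
    (\<forall>\<zeta>\<in>space \<omega>. closed_operator (H \<zeta>) (T \<zeta>)) \<and>
    measurable_bounded_field \<omega> H S
      (\<lambda>\<zeta>. \<lambda>x\<in>hcarrier (H \<zeta>). fst (graph_projection (H \<zeta>) (T \<zeta>) (x, hzero (H \<zeta>)))) \<and>
    measurable_bounded_field \<omega> H S
      (\<lambda>\<zeta>. \<lambda>x\<in>hcarrier (H \<zeta>). fst (graph_projection (H \<zeta>) (T \<zeta>) (hzero (H \<zeta>), x))) \<and>
    measurable_bounded_field \<omega> H S
      (\<lambda>\<zeta>. \<lambda>x\<in>hcarrier (H \<zeta>). snd (graph_projection (H \<zeta>) (T \<zeta>) (x, hzero (H \<zeta>)))) \<and>
    measurable_bounded_field \<omega> H S
      (\<lambda>\<zeta>. \<lambda>x\<in>hcarrier (H \<zeta>). snd (graph_projection (H \<zeta>) (T \<zeta>) (hzero (H \<zeta>), x)))"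

definition closed_integral_operator ::
    "'z measure \<Rightarrow> ('z \<Rightarrow> 'h hspace) \<Rightarrow> ('z \<Rightarrow> 'h) set \<Rightarrow> ('z \<Rightarrow> 'h operator) \<Rightarrow>
      ('z \<Rightarrow> 'h) set operator" where
  "closed_integral_operator \<omega> H S T = {(field_class \<omega> H S x, field_class \<omega> H S y) | x y.
    x \<in> square_integrable_fields \<omega> H S \<and> y \<in> square_integrable_fields \<omega> H S \<and>
    (\<forall>\<zeta>\<in>space \<omega>. (x \<zeta>, y \<zeta>) \<in> T \<zeta>)}"

text \<open>\<open>R = \<integral>\<^sup>\<oplus> T(\<zeta>) d\<omega>(\<zeta>)\<close> for an almost everywhere defined field of closed operators.\<close>

definition is_closed_integral ::
    "'z measure \<Rightarrow> ('z \<Rightarrow> 'h hspace) \<Rightarrow> ('z \<Rightarrow> 'h) set \<Rightarrow>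
      ('z \<Rightarrow> 'h) set operator \<Rightarrow> ('z \<Rightarrow> 'h operator) \<Rightarrow> bool" where
  "is_closed_integral \<omega> H S R T \<longleftrightarrow> (\<exists>T'.
    measurable_closed_field \<omega> H S T' \<and>
    (AE \<zeta> in \<omega>. T' \<zeta> = T \<zeta>) \<and>
    R = closed_integral_operator \<omega> H S T')"

end

theory Submission
  imports Defs "HOL-Probability.Probability"
begin


text \<open>
A self-adjoint operator \<open>T\<close> is governed by the two bounded operators \<open>C = 1 / (1 + T\<^sup>2)\<close> and
\<open>S = T / (1 + T\<^sup>2)\<close>, which form the first column of the projection onto its graph: \<open>(x, y)\<close> belongs to
\<open>T\<close> if and only if \<open>C y = S x\<close>. For a measurable field of closed operators these columns are measurable
fields of bounded operators. The functions \<open>1 / (1 + t\<^sup>2)\<close> and \<open>t / (1 + t\<^sup>2)\<close> separate the points of the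
line, so every bounded Borel function arises from the constant 1 by multiplication with these two, linear
combinations and bounded pointwise limits (\<open>bounded_borel_resolvent_induct\<close>). By this principle the
spectral measure of \<open>T\<close> is unique (\<open>spectral_measure_unique\<close>), and \<open>\<zeta> \<mapsto> \<langle>E\<^sub>\<zeta>(B) x(\<zeta>), z(\<zeta>)\<rangle>\<close> is
measurable for measurable fields \<open>x\<close> and \<open>z\<close>, where \<open>E\<^sub>\<zeta>\<close> is the spectral measure of \<open>T(\<zeta>)\<close>.

Hence the projections \<open>E\<^sub>\<zeta>(B)\<close> have direct integrals. By dominated convergence these form a
projection-valued measure \<open>E\<close>, whose integrals of bounded functions are computed fibrewise
(\<open>sesq_integral_integral_pvm\<close>). Unbounded functions are reduced to bounded ones by a description of the
graph of \<open>\<integral> f dE\<close>: it consists of the pairs with \<open>u(E) y = v(E) x\<close>, where \<open>u = 1 / (1 + f\<^sup>2)\<close> and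
\<open>v = f / (1 + f\<^sup>2)\<close> (\<open>spectral_integral_iff\<close>). This equation can be tested fibrewise, so \<open>\<integral> f dE\<close> is the
direct integral of the operators \<open>\<integral> f dE\<^sub>\<zeta>\<close> (\<open>spectral_integral_integral_pvm\<close>). For \<open>f t = t\<close> the
latter are the operators \<open>T(\<zeta>)\<close>, and uniqueness makes \<open>E\<close> the spectral measure of \<open>T\<close>; for general \<open>f\<close>
this is the second half of the claim.

Two facts about the fibres enter. First, almost every \<open>T(\<zeta>)\<close> is self-adjoint
(\<open>AE_resolvent_operator\<close>): self-adjointness of a closed operator amounts to relations between the
entries of its graph projection that are linear and closed in the vector to which they are applied, so
they can be tested on a fundamental sequence, and for one vector field they follow almost everywhere from
the self-adjointness of \<open>T\<close>. Second, a self-adjoint operator on a Hilbert space has a spectral measure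
(\<open>spectral_theorem\<close>). Its scalar measures come from the moments \<open>\<langle>U\<^sup>n x, x\<rangle>\<close> of the Cayley transform
\<open>U\<close> by the theorem of Herglotz, a mean ergodic argument showing that the point 1 of the circle, which
corresponds to infinity, has no mass.
\<close>

section \<open>Inner product spaces on carrier sets\<close>

abbreviation hdiff :: "'v hspace \<Rightarrow> 'v \<Rightarrow> 'v \<Rightarrow> 'v" where
  "hdiff H x y \<equiv> hadd H x (hscale H (- 1) y)"

text \<open>Uniqueness of the spectral measure and the calculus of a projection-valued measure rest on the inner
product alone and are developed at this level, so that they apply to the direct integral.
Constructions by completeness take place in the fibres, which are Hilbert spaces.\<close>

locale inner_space =
  fixes H :: "'v hspace"
  assumes zero_mem [simp]: "hzero H \<in> hcarrier H"
    and add_mem [simp]: "\<And>x y. x \<in> hcarrier H \<Longrightarrow> y \<in> hcarrier H \<Longrightarrow> hadd H x y \<in> hcarrier H"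
    and scale_mem [simp]: "\<And>c x. x \<in> hcarrier H \<Longrightarrow> hscale H c x \<in> hcarrier H"
    and vec_assoc: "\<And>x y z. x \<in> hcarrier H \<Longrightarrow> y \<in> hcarrier H \<Longrightarrow> z \<in> hcarrier H \<Longrightarrow>
        hadd H (hadd H x y) z = hadd H x (hadd H y z)"
    and vec_commute: "\<And>x y. x \<in> hcarrier H \<Longrightarrow> y \<in> hcarrier H \<Longrightarrow> hadd H x y = hadd H y x"
    and vec_zero: "\<And>x. x \<in> hcarrier H \<Longrightarrow> hadd H x (hzero H) = x"
    and vec_inverse: "\<And>x. x \<in> hcarrier H \<Longrightarrow> hadd H x (hscale H (- 1) x) = hzero H"
    and inner_sym: "\<And>x y. x \<in> hcarrier H \<Longrightarrow> y \<in> hcarrier H \<Longrightarrow>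
        hinner H x y = cnj (hinner H y x)"
    and inner_addl [simp]: "\<And>x y z. x \<in> hcarrier H \<Longrightarrow> y \<in> hcarrier H \<Longrightarrow> z \<in> hcarrier H \<Longrightarrow>
        hinner H (hadd H x y) z = hinner H x z + hinner H y z"
    and inner_scalel [simp]: "\<And>c x y. x \<in> hcarrier H \<Longrightarrow> y \<in> hcarrier H \<Longrightarrow>
        hinner H (hscale H c x) y = c * hinner H x y"
    and inner_pos: "\<And>x. x \<in> hcarrier H \<Longrightarrow> 0 \<le> Re (hinner H x x)"
    and inner_def0: "\<And>x. x \<in> hcarrier H \<Longrightarrow> hinner H x x = 0 \<Longrightarrow> x = hzero H"
begin

abbreviation V where "V \<equiv> hcarrier H"

lemma inner_addr [simp]:
  "x \<in> V \<Longrightarrow> y \<in> V \<Longrightarrow> z \<in> V \<Longrightarrow> hinner H z (hadd H x y) = hinner H z x + hinner H z y"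
  by (metis add_mem complex_cnj_add inner_addl inner_sym)

lemma inner_scaler [simp]:
  "x \<in> V \<Longrightarrow> y \<in> V \<Longrightarrow> hinner H x (hscale H c y) = cnj c * hinner H x y"
  by (metis scale_mem complex_cnj_mult inner_scalel inner_sym)

lemma inner_zerol [simp]: "x \<in> V \<Longrightarrow> hinner H (hzero H) x = 0"
  using inner_addl[of "hzero H" "hzero H" x] vec_zero[of "hzero H"] by simp

lemma inner_zeror [simp]: "x \<in> V \<Longrightarrow> hinner H x (hzero H) = 0"
  using inner_sym[of x "hzero H"] by simp

lemma vec_eqI_diff:
  assumes "x \<in> V" "y \<in> V" "hdiff H x y = hzero H" shows "x = y"
proof -
  have "x = hadd H x (hadd H (hscale H (-1) y) y)"
    using assms vec_zero[of x] vec_inverse[of y] vec_commute[of y "hscale H (-1) y"]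
    by (metis scale_mem)
  also have "\<dots> = hadd H (hzero H) y" using assms vec_assoc[of x "hscale H (-1) y" y] by simp
  also have "\<dots> = y" using assms vec_zero[of y] vec_commute[of y "hzero H"] by simp
  finally show ?thesis .
qed

text \<open>The standard way of proving a vector identity below: tested against a vector \<open>z\<close>, both sides become
complex numbers, and the simplifier does the algebra there.\<close>

lemma vec_eqI:
  assumes "x \<in> V" "y \<in> V" "\<And>z. z \<in> V \<Longrightarrow> hinner H x z = hinner H y z" shows "x = y"
  by (rule vec_eqI_diff[OF assms(1,2)], rule inner_def0) (use assms in simp_all)

lemma vec_eqI_diff_self:
  assumes "x \<in> V" "y \<in> V" "hinner H (hdiff H x y) (hdiff H x y) = 0" shows "x = y"
  by (rule vec_eqI_diff[OF assms(1,2)], rule inner_def0) (use assms in simp_all)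

lemma inner_self_real: "x \<in> V \<Longrightarrow> Im (hinner H x x) = 0"
  using arg_cong[OF inner_sym[of x x], of Im] by simp

lemma hnorm_nonneg [simp]: "x \<in> V \<Longrightarrow> 0 \<le> hnorm H x"
  by (simp add: hnorm_def inner_pos)

lemma hnorm_sq: "x \<in> V \<Longrightarrow> (hnorm H x)\<^sup>2 = Re (hinner H x x)"
  by (simp add: hnorm_def inner_pos)

lemma inner_self: "x \<in> V \<Longrightarrow> hinner H x x = complex_of_real ((hnorm H x)\<^sup>2)"
  using inner_self_real by (simp add: hnorm_sq complex_eq_iff)

lemma hnorm_zero [simp]: "hnorm H (hzero H) = 0"
  by (simp add: hnorm_def)

lemma hnorm_eq_0: "x \<in> V \<Longrightarrow> hnorm H x = 0 \<longleftrightarrow> x = hzero H"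
  using inner_def0 inner_self by fastforce

lemma cauchy_schwarz:
  assumes x: "x \<in> V" and y: "y \<in> V"
  shows "cmod (hinner H x y) \<le> hnorm H x * hnorm H y"
proof (cases "y = hzero H")
  case True then show ?thesis using x by simp
next
  case False
  define n where "n = (hnorm H y)\<^sup>2"
  define a where "a = hinner H x y"
  have n: "n > 0" using False y hnorm_eq_0 unfolding n_def by auto
  define b where "b = a / of_real n"
  define z where "z = hadd H x (hscale H (- b) y)"
  have N: "hinner H y y = of_real n" by (simp add: inner_self[OF y] n_def)
  have "hinner H z z = hinner H x x - cnj b * a - b * cnj a + b * cnj b * of_real n"
    using x y inner_sym[of y x] unfolding z_def a_def by (simp add: N algebra_simps)
  also have "\<dots> = hinner H x x - a * cnj a / of_real n"
    using n unfolding b_def by (simp add: field_simps)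
  also have "\<dots> = of_real ((hnorm H x)\<^sup>2 - (cmod a)\<^sup>2 / n)"
    unfolding inner_self[OF x] complex_norm_square[symmetric] by simp
  finally have "0 \<le> (hnorm H x)\<^sup>2 - (cmod a)\<^sup>2 / n"
    using inner_pos[of z] x y unfolding z_def by simp
  then have "(cmod a)\<^sup>2 \<le> (hnorm H x * hnorm H y)\<^sup>2"
    using n by (simp add: field_simps n_def power_mult_distrib)
  then show ?thesis unfolding a_def using x y by (metis hnorm_nonneg mult_nonneg_nonneg power2_le_imp_le)
qed

lemma symmetric_idempotent_norm:
  assumes "P x \<in> V" "x \<in> V" "hinner H (P (P x)) x = hinner H (P x) (P x)" "P (P x) = P x"
  shows "hnorm H (P x) \<le> hnorm H x"
proof (cases "hnorm H (P x) = 0")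
  case False
  have "(hnorm H (P x))\<^sup>2 \<le> hnorm H (P x) * hnorm H x"
    using cauchy_schwarz[of "P x" x] assms inner_self[of "P x"] by (simp add: norm_power)
  then show ?thesis using False assms by (simp add: power2_eq_square less_le)
qed (use assms in simp)

lemma hnorm_scale: "x \<in> V \<Longrightarrow> hnorm H (hscale H c x) = cmod c * hnorm H x"
proof -
  assume x: "x \<in> V"
  have "(hnorm H (hscale H c x))\<^sup>2 = (cmod c * hnorm H x)\<^sup>2"
    using x inner_self_real[OF x]
    by (simp add: hnorm_sq power_mult_distrib cmod_power2) (simp add: power2_eq_square algebra_simps)
  then show ?thesis using x by simp
qed

lemma hnorm_sq_add:
  "x \<in> V \<Longrightarrow> y \<in> V \<Longrightarrow> (hnorm H (hadd H x y))\<^sup>2 = (hnorm H x)\<^sup>2 + 2 * Re (hinner H x y) + (hnorm H y)\<^sup>2"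
  using inner_sym[of y x] by (simp add: hnorm_sq)

lemma hnorm_sq_diff:
  "x \<in> V \<Longrightarrow> y \<in> V \<Longrightarrow> (hnorm H (hdiff H x y))\<^sup>2 = (hnorm H x)\<^sup>2 - 2 * Re (hinner H x y) + (hnorm H y)\<^sup>2"
  using inner_sym[of y x] by (simp add: hnorm_sq)

lemma hnorm_triangle:
  assumes "x \<in> V" "y \<in> V" shows "hnorm H (hadd H x y) \<le> hnorm H x + hnorm H y"
proof (rule power2_le_imp_le)
  have "Re (hinner H x y) \<le> hnorm H x * hnorm H y"
    using cauchy_schwarz[OF assms] complex_Re_le_cmod order_trans by blast
  then show "(hnorm H (hadd H x y))\<^sup>2 \<le> (hnorm H x + hnorm H y)\<^sup>2"
    using assms by (simp add: hnorm_sq_add power2_sum)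
qed (use assms in simp)

lemma hdist_eq: "x \<in> V \<Longrightarrow> y \<in> V \<Longrightarrow> hdist H x y = hnorm H (hdiff H x y)"
  by (simp add: hdist_def)

lemma hdist_sq: "x \<in> V \<Longrightarrow> y \<in> V \<Longrightarrow>
   (hdist H x y)\<^sup>2 = (hnorm H x)\<^sup>2 - 2 * Re (hinner H x y) + (hnorm H y)\<^sup>2"
  by (simp add: hdist_eq hnorm_sq_diff)

lemma metric: "Metric_space V (hdist H)"
proof
  show "0 \<le> hdist H x y" for x y by (simp add: hdist_def)
  have "hdist H x y = hdist H y x" if "x \<in> V" "y \<in> V" for x y
  proof -
    have "(hdist H x y)\<^sup>2 = (hdist H y x)\<^sup>2" using that inner_sym[of x y] by (simp add: hdist_sq)
    then show ?thesis using that by (simp add: hdist_eq)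
  qed
  then show "hdist H x y = hdist H y x" for x y by (auto simp: hdist_def)
  show "(hdist H x y = 0) = (x = y)" if "x \<in> V" "y \<in> V" for x y
    using that vec_eqI_diff[of x y] vec_inverse[of x] by (auto simp: hdist_eq hnorm_eq_0)
  show "hdist H x z \<le> hdist H x y + hdist H y z" if xyz: "x \<in> V" "y \<in> V" "z \<in> V" for x y z
  proof -
    have "hdiff H x z = hadd H (hdiff H x y) (hdiff H y z)"
      by (rule vec_eqI) (use xyz in simp_all)
    then show ?thesis using xyz hnorm_triangle[of "hdiff H x y" "hdiff H y z"] by (simp add: hdist_eq)
  qed
qed

sublocale M: Metric_space V "hdist H" by (rule metric)

lemma htopology_eq: "htopology H = M.mtopology" by (simp add: htopology_def)

lemma closedin_iff_seq: "closedin (htopology H) A \<longleftrightarrow> A \<subseteq> V \<and>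
   (\<forall>s x. range s \<subseteq> A \<and> x \<in> V \<and> (\<lambda>n. hdist H (s n) x) \<longlonglongrightarrow> 0 \<longrightarrow> x \<in> A)"
proof -
  have "range s \<subseteq> A \<and> limitin M.mtopology s x sequentially \<longleftrightarrow>
      range s \<subseteq> A \<and> x \<in> V \<and> (\<lambda>n. hdist H (s n) x) \<longlonglongrightarrow> 0" if "A \<subseteq> V" for s x
    using that unfolding M.limitin_metric_dist_null by (auto intro!: always_eventually)
  then show ?thesis
    unfolding htopology_eq M.metric_closedin_iff_sequentially_closed by blast
qed

lemma hdense_iff: "hdense H A \<longleftrightarrow> (\<forall>x\<in>V. \<forall>e>0. \<exists>y\<in>A. y \<in> V \<and> hdist H x y < e)"
  unfolding hdense_def htopology_eq M.metric_closure_of M.mball_def by (simp add: set_eq_iff) blast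

lemma inner_tendsto:
  assumes "\<And>n. s n \<in> V" "x \<in> V" "z \<in> V" "(\<lambda>n. hdist H (s n) x) \<longlonglongrightarrow> 0"
  shows "(\<lambda>n. hinner H (s n) z) \<longlonglongrightarrow> hinner H x z"
proof -
  have *: "cmod (hinner H (s n) z - hinner H x z) \<le> hdist H (s n) x * hnorm H z" for n
    using cauchy_schwarz[of "hdiff H (s n) x" z] assms(1)[of n] assms(2,3) by (simp add: hdist_eq)
  have "(\<lambda>n. hinner H (s n) z - hinner H x z) \<longlonglongrightarrow> 0"
    by (rule Lim_null_comparison[OF _ tendsto_mult_left_zero[OF assms(4)]]) (rule always_eventually, rule allI, rule *)
  then show ?thesis by (simp add: LIM_zero_iff)
qed

end

sublocale hilbert_space \<subseteq> inner_space H
  by unfold_locales (fact zero_closed add_closed scale_closed add_assoc add_commute add_zero add_inverse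
      inner_commute inner_add_left inner_scale_left inner_nonneg inner_definite)+

section \<open>Projections, the Riesz representation and direct sums\<close>

lemma (in inner_space) hsub_zero: "hsubspace H U \<Longrightarrow> hzero H \<in> U"
  and hsub_add: "hsubspace H U \<Longrightarrow> x \<in> U \<Longrightarrow> y \<in> U \<Longrightarrow> hadd H x y \<in> U"
  and hsub_scale: "hsubspace H U \<Longrightarrow> x \<in> U \<Longrightarrow> hscale H c x \<in> U"
  and hsub_mem: "hsubspace H U \<Longrightarrow> x \<in> U \<Longrightarrow> x \<in> V"
  unfolding hsubspace_def by auto

lemma (in inner_space) hproj_eqI:
  assumes U: "hsubspace H U" and p: "p \<in> U" and eq: "\<And>g. g \<in> U \<Longrightarrow> hinner H x g = hinner H p g"
  shows "hproj H U x = p"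
  unfolding hproj_def
proof (rule the_equality)
  show "p \<in> U \<and> (\<forall>g\<in>U. hinner H x g = hinner H p g)" using p eq by blast
  fix r assume r: "r \<in> U \<and> (\<forall>g\<in>U. hinner H x g = hinner H r g)"
  have d: "hdiff H r p \<in> U" by (intro hsub_add[OF U] hsub_scale[OF U]) (use r p in auto)
  have "hinner H r (hdiff H r p) = hinner H p (hdiff H r p)" using r d eq by metis
  then have "hinner H (hdiff H r p) (hdiff H r p) = 0"
    using r p hsub_mem[OF U] by (simp del: inner_addr)
  then show "r = p" using vec_eqI_diff_self r p hsub_mem[OF U] by blast
qed

lemma (in inner_space) parallelogram:
  assumes "x \<in> V" "y \<in> V"
  shows "(hnorm H (hadd H x y))\<^sup>2 + (hnorm H (hdiff H x y))\<^sup>2 = 2 * (hnorm H x)\<^sup>2 + 2 * (hnorm H y)\<^sup>2"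
  using assms by (simp add: hnorm_sq_add hnorm_scale)

text \<open>A minimizing sequence for the distance from \<open>x\<close> to \<open>U\<close> is Cauchy by the parallelogram law, and
\<open>x - p\<close> is orthogonal to \<open>U\<close> for its limit \<open>p\<close>. As \<open>p\<close> is only required to be a limit of points of
\<open>U\<close>, this yields both the projection onto closed subspaces and the criterion for dense ones.\<close>

lemma (in hilbert_space) approximate_projection:
  assumes U: "hsubspace H U" and x: "x \<in> V"
  obtains p s where "p \<in> V" "range s \<subseteq> U" "(\<lambda>n. hdist H (s n) p) \<longlonglongrightarrow> 0"
    "\<And>g. g \<in> U \<Longrightarrow> hinner H x g = hinner H p g"
proof -
  define D where "D = (\<lambda>g. (hdist H x g)\<^sup>2) ` U"
  define d where "d = Inf D"
  note mem = hsub_mem[OF U]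
  have bdd: "bdd_below D" unfolding D_def by (rule bdd_belowI[of _ 0]) auto
  have ne: "D \<noteq> {}" using hsub_zero[OF U] unfolding D_def by auto
  have dle: "d \<le> (hdist H x g)\<^sup>2" if "g \<in> U" for g
    unfolding d_def using that by (intro cInf_lower bdd) (auto simp: D_def)
  have "\<exists>g\<in>U. (hdist H x g)\<^sup>2 < d + 1 / real (Suc n)" for n
  proof -
    have "Inf D < d + 1 / real (Suc n)" unfolding d_def by simp
    then show ?thesis using cInf_lessD[OF ne] unfolding D_def by fastforce
  qed
  then obtain s where s: "\<And>n. s n \<in> U" "\<And>n. (hdist H x (s n))\<^sup>2 < d + 1 / real (Suc n)"
    by metis
  have sV: "s n \<in> V" for n using s mem by blast
  have close: "(hdist H (s n) (s m))\<^sup>2 \<le> 2 / real (Suc n) + 2 / real (Suc m)" for n m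
  proof -
    define a where "a = hdiff H x (s n)"
    define b where "b = hdiff H x (s m)"
    define g where "g = hscale H (1/2) (hadd H (s n) (s m))"
    have ab: "a \<in> V" "b \<in> V" and g: "g \<in> V" "g \<in> U"
      using x sV s U unfolding a_def b_def g_def by (auto intro: hsub_scale hsub_add)
    have "hadd H a b = hscale H 2 (hdiff H x g)"
      by (rule vec_eqI) (use x sV in \<open>simp_all add: a_def b_def g_def algebra_simps\<close>)
    then have "(hnorm H (hadd H a b))\<^sup>2 = 4 * (hdist H x g)\<^sup>2"
      using x g by (simp add: hnorm_scale hdist_eq power_mult_distrib)
    moreover have "hdiff H a b = hdiff H (s m) (s n)"
      by (rule vec_eqI) (use x sV in \<open>simp_all add: a_def b_def algebra_simps\<close>)
    then have "hnorm H (hdiff H a b) = hdist H (s n) (s m)"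
      using sV M.commute by (simp add: hdist_eq)
    ultimately have "(hdist H (s n) (s m))\<^sup>2 =
        2 * (hdist H x (s n))\<^sup>2 + 2 * (hdist H x (s m))\<^sup>2 - 4 * (hdist H x g)\<^sup>2"
      using parallelogram[OF ab] x sV by (simp add: hdist_eq a_def b_def)
    moreover have "2 / real (Suc k) = 2 * (1 / real (Suc k))" for k by simp
    ultimately show ?thesis using s(2)[of n] s(2)[of m] dle[OF g(2)] by linarith
  qed
  have "M.MCauchy s" unfolding M.MCauchy_def
  proof (intro conjI allI impI)
    show "range s \<subseteq> V" using sV by auto
    fix e :: real assume e: "e > 0"
    obtain N where N: "4 / e\<^sup>2 < real N" using reals_Archimedean2 by blast
    have "hdist H (s n) (s m) < e" if "N \<le> n" "N \<le> m" for n m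
    proof -
      have N0: "0 < real N" using N e by (meson divide_nonneg_nonneg le_less_trans not_less zero_le_numeral zero_le_power2)
      have "2 / real (Suc n) \<le> 2 / real N" "2 / real (Suc m) \<le> 2 / real N"
        using that N0 by (auto intro!: divide_left_mono)
      then have "(hdist H (s n) (s m))\<^sup>2 \<le> 4 / real N" using close[of n m] by simp
      also have "\<dots> < e\<^sup>2" using N e N0 by (simp add: field_simps)
      finally show ?thesis using e by (simp add: power2_less_imp_less)
    qed
    then show "\<exists>N. \<forall>n n'. N \<le> n \<longrightarrow> N \<le> n' \<longrightarrow> hdist H (s n) (s n') < e" by blast
  qed
  then obtain p where "limitin M.mtopology s p sequentially"
    using complete unfolding M.mcomplete_def by blast
  then have p: "p \<in> V" "(\<lambda>n. hdist H (s n) p) \<longlonglongrightarrow> 0"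
    unfolding M.limitin_metric_dist_null by auto
  have dxp: "(hdist H x p)\<^sup>2 \<le> d"
  proof (rule LIMSEQ_le_const2)
    have "(\<lambda>n. hdist H x (s n)) \<longlonglongrightarrow> hdist H x p"
    proof (rule LIM_zero_cancel, rule Lim_null_comparison[OF _ p(2)], intro always_eventually allI)
      show "norm (hdist H x (s n) - hdist H x p) \<le> hdist H (s n) p" for n
        using M.mdist_reverse_triangle[of "s n" x p] M.mdist_reverse_triangle[of x "s n" p]
          M.mdist_reverse_triangle[of "s n" p x]
        x p sV M.commute[of "s n" x] M.commute[of p x] M.triangle[of x "s n" p] M.triangle[of x p "s n"]
        M.commute[of p "s n"] by fastforce
    qed
    from tendsto_diff[OF tendsto_power[OF this, of 2] LIMSEQ_inverse_real_of_nat]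
    show "(\<lambda>n. (hdist H x (s n))\<^sup>2 - inverse (real (Suc n))) \<longlonglongrightarrow> (hdist H x p)\<^sup>2" by simp
    show "\<exists>N. \<forall>n\<ge>N. (hdist H x (s n))\<^sup>2 - inverse (real (Suc n)) \<le> d"
      using s(2) by (auto simp: inverse_eq_divide less_imp_le intro!: exI[of _ 0] simp: field_simps)
  qed
  have orth: "hinner H x g = hinner H p g" if g: "g \<in> U" for g
  proof -
    have gV: "g \<in> V" using g mem by blast
    define r where "r = hdiff H x p"
    define a where "a = hinner H r g"
    \<comment> \<open>Moving from \<open>p\<close> by \<open>t a g\<close> changes the squared distance to \<open>x\<close> by
      \<open>- t \<bar>a\<bar>\<^sup>2 (2 - t \<parallel>g\<parallel>\<^sup>2)\<close>, which is negative unless \<open>a = 0\<close>, since \<open>t \<parallel>g\<parallel>\<^sup>2 < 1\<close>.\<close>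
    define t where "t = 1 / ((hnorm H g)\<^sup>2 + 1)"
    have r: "r \<in> V" using x p by (simp add: r_def)
    have gp: "(hnorm H g)\<^sup>2 + 1 > 0" by (smt (verit) zero_le_power2)
    have t: "t > 0" using gp by (simp add: t_def)
    define h where "h = hscale H (of_real t * a) g"
    have hU: "h \<in> U" "h \<in> V" using g gV U by (auto simp: h_def intro: hsub_scale)
    have lim: "(\<lambda>n. hdist H (hadd H (s n) h) (hadd H p h)) \<longlonglongrightarrow> 0"
    proof -
      have "hdist H (hadd H (s n) h) (hadd H p h) = hdist H (s n) p" for n
      proof -
        have "hdiff H (hadd H (s n) h) (hadd H p h) = hdiff H (s n) p"
          by (rule vec_eqI) (use sV p hU in \<open>simp_all add: algebra_simps\<close>)
        then show ?thesis using sV p hU by (simp add: hdist_eq)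
      qed
      then show ?thesis using p by simp
    qed
    have "d \<le> (hdist H x (hadd H p h))\<^sup>2"
    proof (rule LIMSEQ_le_const)
      have "(\<lambda>n. hdist H x (hadd H (s n) h)) \<longlonglongrightarrow> hdist H x (hadd H p h)"
      proof (rule LIM_zero_cancel, rule Lim_null_comparison[OF _ lim], intro always_eventually allI)
        show "norm (hdist H x (hadd H (s n) h) - hdist H x (hadd H p h)) \<le> hdist H (hadd H (s n) h) (hadd H p h)" for n
          using x p sV[of n] hU M.triangle[of x "hadd H (s n) h" "hadd H p h"] M.triangle[of x "hadd H p h" "hadd H (s n) h"]
          M.commute[of "hadd H p h" "hadd H (s n) h"] by (simp add: abs_le_iff)
      qed
      from tendsto_power[OF this]
      show "(\<lambda>n. (hdist H x (hadd H (s n) h))\<^sup>2) \<longlonglongrightarrow> (hdist H x (hadd H p h))\<^sup>2" .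
      show "\<exists>N. \<forall>n\<ge>N. d \<le> (hdist H x (hadd H (s n) h))\<^sup>2"
        using s(1) hU dle hsub_add[OF U] by blast
    qed
    also have "(hdist H x (hadd H p h))\<^sup>2 = (hnorm H (hdiff H r h))\<^sup>2"
    proof -
      have "hdiff H x (hadd H p h) = hdiff H r h"
        by (rule vec_eqI) (use x p hU in \<open>simp_all add: r_def algebra_simps\<close>)
      then show ?thesis using x p hU by (simp add: hdist_eq)
    qed
    also have "\<dots> = (hnorm H r)\<^sup>2 - 2 * t * (cmod a)\<^sup>2 + t\<^sup>2 * (cmod a)\<^sup>2 * (hnorm H g)\<^sup>2"
    proof -
      have "hinner H r h = of_real (t * (cmod a)\<^sup>2)"
        using r gV by (simp add: h_def a_def[symmetric] complex_norm_square[of a, unfolded of_real_power] mult.commute)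
      moreover have "hnorm H h = t * cmod a * hnorm H g"
        using gV t by (simp add: h_def hnorm_scale norm_mult)
      ultimately show ?thesis using r hU by (simp add: hnorm_sq_diff power_mult_distrib)
    qed
    finally have "d \<le> (hnorm H r)\<^sup>2 - 2 * t * (cmod a)\<^sup>2 + t\<^sup>2 * (cmod a)\<^sup>2 * (hnorm H g)\<^sup>2" .
    moreover have "(hnorm H r)\<^sup>2 \<le> d" using dxp x p by (simp add: r_def hdist_eq)
    ultimately have "t * (cmod a)\<^sup>2 * (2 - t * (hnorm H g)\<^sup>2) \<le> 0"
      by (simp add: algebra_simps power2_eq_square)
    moreover have "t * (hnorm H g)\<^sup>2 < 1" using gp by (simp add: t_def field_simps)
    ultimately have "(cmod a)\<^sup>2 \<le> 0" using t
      by (smt (verit) mult_pos_pos zero_le_power2)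
    then have "a = 0" by simp
    then show ?thesis using x p gV by (simp add: a_def r_def)
  qed
  show ?thesis by (rule that[of p s]) (use p s orth in auto)
qed

lemma (in hilbert_space) projection_exists:
  assumes "hsubspace H U" "closedin (htopology H) U" "x \<in> V"
  shows "\<exists>p\<in>U. \<forall>g\<in>U. hinner H x g = hinner H p g"
  using approximate_projection[OF assms(1,3)] assms(2) unfolding closedin_iff_seq by metis

lemma (in hilbert_space) dense_if_trivial_complement:
  assumes U: "hsubspace H U" and triv: "\<And>y. y \<in> V \<Longrightarrow> (\<And>u. u \<in> U \<Longrightarrow> hinner H y u = 0) \<Longrightarrow> y = hzero H"
    and x: "x \<in> V" and e: "e > 0"
  shows "\<exists>y\<in>U. hdist H x y < e"
proof -
  obtain p s where p: "p \<in> V" "range s \<subseteq> U" "(\<lambda>n. hdist H (s n) p) \<longlonglongrightarrow> 0"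
    "\<And>g. g \<in> U \<Longrightarrow> hinner H x g = hinner H p g"
    using approximate_projection[OF U x] by metis
  have "hdiff H x p = hzero H"
    by (rule triv) (use p x hsub_mem[OF U] in auto)
  then have "x = p" using vec_eqI_diff x p by blast
  moreover obtain n where "hdist H (s n) p < e"
    using p(3) e by (metis (no_types, lifting) LIMSEQ_D diff_zero le_refl real_norm_def abs_less_iff)
  ultimately show ?thesis using p(2) M.commute by (metis range_subsetD)
qed

text \<open>A nonzero \<open>\<phi>\<close> is represented by a multiple of a vector \<open>w\<close> orthogonal to its kernel, because \<open>x\<close>
and the multiple of \<open>w\<close> with the same value of \<open>\<phi>\<close> differ by an element of the kernel.\<close>

lemma (in hilbert_space) riesz:
  assumes add: "\<And>x y. x \<in> V \<Longrightarrow> y \<in> V \<Longrightarrow> \<phi> (hadd H x y) = \<phi> x + \<phi> y"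
    and scale: "\<And>c x. x \<in> V \<Longrightarrow> \<phi> (hscale H c x) = c * \<phi> x"
    and bounded: "\<And>x. x \<in> V \<Longrightarrow> cmod (\<phi> x) \<le> K * hnorm H x"
  shows "\<exists>y\<in>V. \<forall>x\<in>V. \<phi> x = hinner H x y"
proof (cases "\<forall>x\<in>V. \<phi> x = 0")
  case True then show ?thesis by (intro bexI[of _ "hzero H"]) auto
next
  case False
  then obtain x0 where x0: "x0 \<in> V" "\<phi> x0 \<noteq> 0" by auto
  define N where "N = {x\<in>V. \<phi> x = 0}"
  have phi0: "\<phi> (hzero H) = 0" using bounded[of "hzero H"] by simp
  have sub: "hsubspace H N" unfolding hsubspace_def N_def using phi0 by (auto simp: add scale)
  have cl: "closedin (htopology H) N" unfolding closedin_iff_seq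
  proof (intro conjI allI impI)
    show "N \<subseteq> V" by (auto simp: N_def)
    fix s x assume *: "range s \<subseteq> N \<and> x \<in> V \<and> (\<lambda>n. hdist H (s n) x) \<longlonglongrightarrow> 0"
    then have s: "s n \<in> V" "\<phi> (s n) = 0" for n by (auto simp: N_def)
    have "cmod (\<phi> x) \<le> K * hdist H (s n) x" for n
      using bounded[of "hdiff H (s n) x"] s[of n] * by (simp add: add scale hdist_eq)
    then have "cmod (\<phi> x) \<le> K * 0"
      using * by (intro LIMSEQ_le_const[OF tendsto_mult_left]) auto
    then show "x \<in> N" using * by (simp add: N_def)
  qed
  obtain p where p: "p \<in> N" "\<And>g. g \<in> N \<Longrightarrow> hinner H x0 g = hinner H p g"
    using projection_exists[OF sub cl x0(1)] by auto
  define w where "w = hdiff H x0 p"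
  have w: "w \<in> V" "\<phi> w \<noteq> 0" "\<And>g. g \<in> N \<Longrightarrow> hinner H w g = 0"
    using p x0 by (auto simp: w_def N_def add scale)
  have ww: "hinner H w w \<noteq> 0" using w inner_def0[of w] phi0 by auto
  show ?thesis
  proof (intro bexI ballI)
    let ?y = "hscale H (cnj (\<phi> w / hinner H w w)) w"
    show "?y \<in> V" using w by simp
    fix x assume x: "x \<in> V"
    have "hadd H x (hscale H (- (\<phi> x / \<phi> w)) w) \<in> N" using x w by (simp add: N_def add scale)
    from w(3)[OF this] have "hinner H w x = cnj (\<phi> x / \<phi> w) * hinner H w w" using x w by simp
    then have "hinner H x w = \<phi> x / \<phi> w * hinner H w w"
      using inner_sym[of x w] inner_sym[of w w] x w by simp
    then show "\<phi> x = hinner H x ?y" using x w ww by simp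
  qed
qed

lemma hsum_simps [simp]:
  "hcarrier (hsum H K) = hcarrier H \<times> hcarrier K"
  "hzero (hsum H K) = (hzero H, hzero K)"
  "hadd (hsum H K) p q = (hadd H (fst p) (fst q), hadd K (snd p) (snd q))"
  "hscale (hsum H K) c p = (hscale H c (fst p), hscale K c (snd p))"
  "hinner (hsum H K) p q = hinner H (fst p) (fst q) + hinner K (snd p) (snd q)"
  by (simp_all add: hsum_def)

lemma inner_space_hsum:
  assumes "inner_space H" "inner_space K" shows "inner_space (hsum H K)"
proof -
  interpret H: inner_space H by fact
  interpret K: inner_space K by fact
  show ?thesis
  proof
    show "p = hzero (hsum H K)" if "p \<in> hcarrier (hsum H K)" "hinner (hsum H K) p p = 0" for p
      using that by (auto simp: H.inner_self K.inner_self complex_eq_iff sum_power2_eq_zero_iff H.hnorm_eq_0 K.hnorm_eq_0)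
    show "hinner (hsum H K) p q = cnj (hinner (hsum H K) q p)"
      if "p \<in> hcarrier (hsum H K)" "q \<in> hcarrier (hsum H K)" for p q
      using that H.inner_sym[of "fst p" "fst q"] K.inner_sym[of "snd p" "snd q"] by auto
  qed (auto simp: distrib_left H.vec_assoc K.vec_assoc H.vec_zero K.vec_zero H.vec_inverse K.vec_inverse
       H.inner_pos K.inner_pos intro: H.vec_commute K.vec_commute)
qed

lemma hsum_dist_sq:
  assumes "inner_space H" "inner_space K" "p \<in> hcarrier H \<times> hcarrier K" "q \<in> hcarrier H \<times> hcarrier K"
  shows "(hdist (hsum H K) p q)\<^sup>2 = (hdist H (fst p) (fst q))\<^sup>2 + (hdist K (snd p) (snd q))\<^sup>2"
proof -
  interpret H: inner_space H by fact
  interpret K: inner_space K by fact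
  interpret S: inner_space "hsum H K" by (rule inner_space_hsum) fact+
  show ?thesis using assms(3,4) by (auto simp: S.hdist_sq H.hdist_sq K.hdist_sq S.hnorm_sq H.hnorm_sq K.hnorm_sq)
qed

lemma (in inner_space) linear_operator_facts:
  assumes T: "linear_operator H T"
  shows linear_operator_zero: "(hzero H, hzero H) \<in> T"
    and linear_operator_mem: "(x, y) \<in> T \<Longrightarrow> x \<in> V" "(x, y) \<in> T \<Longrightarrow> y \<in> V"
    and linear_operator_add: "(x, y) \<in> T \<Longrightarrow> (x', y') \<in> T \<Longrightarrow> (hadd H x x', hadd H y y') \<in> T"
    and linear_operator_scale: "(x, y) \<in> T \<Longrightarrow> (hscale H c x, hscale H c y) \<in> T"
    and linear_operator_unique: "(x, y) \<in> T \<Longrightarrow> (x, z) \<in> T \<Longrightarrow> y = z"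
proof -
  have add: "\<forall>p\<in>T. \<forall>q\<in>T. hadd (hsum H H) p q \<in> T" and scale: "\<forall>c. \<forall>p\<in>T. hscale (hsum H H) c p \<in> T"
    and mem: "T \<subseteq> V \<times> V" and zero: "(hzero H, hzero H) \<in> T" and sv: "single_valued T"
    using T unfolding linear_operator_def hsubspace_def by auto
  show "(hzero H, hzero H) \<in> T" by (rule zero)
  show "(x, y) \<in> T \<Longrightarrow> x \<in> V" "(x, y) \<in> T \<Longrightarrow> y \<in> V" using mem by auto
  show "(x, y) \<in> T \<Longrightarrow> (x', y') \<in> T \<Longrightarrow> (hadd H x x', hadd H y y') \<in> T"
    using add[rule_format, of "(x, y)" "(x', y')"] by simp
  show "(x, y) \<in> T \<Longrightarrow> (hscale H c x, hscale H c y) \<in> T"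
    using scale[rule_format, of "(x, y)" c] by simp
  show "(x, y) \<in> T \<Longrightarrow> (x, z) \<in> T \<Longrightarrow> y = z" using sv by (rule single_valuedD)
qed

lemma hilbert_space_hsum:
  assumes "hilbert_space H" "hilbert_space K" shows "hilbert_space (hsum H K)"
proof -
  interpret H: hilbert_space H by fact
  interpret K: hilbert_space K by fact
  interpret S: inner_space "hsum H K"
    by (rule inner_space_hsum) unfold_locales
  have d: "(hdist (hsum H K) p q)\<^sup>2 = (hdist H (fst p) (fst q))\<^sup>2 + (hdist K (snd p) (snd q))\<^sup>2"
    if "p \<in> hcarrier H \<times> hcarrier K" "q \<in> hcarrier H \<times> hcarrier K" for p q
    by (rule hsum_dist_sq[OF H.inner_space_axioms K.inner_space_axioms that])
  have le: "hdist H (fst p) (fst q) \<le> hdist (hsum H K) p q" "hdist K (snd p) (snd q) \<le> hdist (hsum H K) p q"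
    if "p \<in> hcarrier H \<times> hcarrier K" "q \<in> hcarrier H \<times> hcarrier K" for p q
    using d[OF that] by (auto intro!: power2_le_imp_le[OF _ S.M.nonneg])
  have complete: "S.M.mcomplete" unfolding S.M.mcomplete_def
  proof (intro allI impI)
    fix s assume s: "S.M.MCauchy s"
    then have sV: "s n \<in> hcarrier H \<times> hcarrier K" for n unfolding S.M.MCauchy_def by (metis hsum_simps(1) range_subsetD)
    have "H.M.MCauchy (\<lambda>n. fst (s n))" "K.M.MCauchy (\<lambda>n. snd (s n))"
      using s sV le[OF sV sV] unfolding S.M.MCauchy_def H.M.MCauchy_def K.M.MCauchy_def
      by (auto simp: mem_Times_iff) (meson le_less_trans)+
    then obtain a b where ab: "limitin H.M.mtopology (\<lambda>n. fst (s n)) a sequentially"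
       "limitin K.M.mtopology (\<lambda>n. snd (s n)) b sequentially"
      using H.complete K.complete unfolding H.M.mcomplete_def K.M.mcomplete_def by meson
    then have ab: "a \<in> hcarrier H" "b \<in> hcarrier K" "(\<lambda>n. hdist H (fst (s n)) a) \<longlonglongrightarrow> 0" "(\<lambda>n. hdist K (snd (s n)) b) \<longlonglongrightarrow> 0"
      unfolding H.M.limitin_metric_dist_null K.M.limitin_metric_dist_null by auto
    have "(\<lambda>n. sqrt ((hdist H (fst (s n)) a)\<^sup>2 + (hdist K (snd (s n)) b)\<^sup>2)) \<longlonglongrightarrow> sqrt (0\<^sup>2 + 0\<^sup>2)"
      by (intro tendsto_intros ab)
    moreover have "sqrt ((hdist H (fst (s n)) a)\<^sup>2 + (hdist K (snd (s n)) b)\<^sup>2) = hdist (hsum H K) (s n) (a, b)" for n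
      using d[OF sV[of n], of "(a,b)"] ab by (simp add: real_sqrt_unique)
    ultimately have "limitin S.M.mtopology s (a, b) sequentially"
      unfolding S.M.limitin_metric_dist_null using ab sV by (auto intro!: always_eventually)
    then show "\<exists>x. limitin S.M.mtopology s x sequentially" by blast
  qed
  show ?thesis
  proof (unfold_locales, fact S.zero_mem, fact S.add_mem, fact S.scale_mem, fact S.vec_assoc,
      fact S.vec_commute, fact S.vec_zero, fact S.vec_inverse)
    show "Metric_space.mcomplete (hcarrier (hsum H K)) (hdist (hsum H K))" by (fact complete)
    show "hscale (hsum H K) c (hadd (hsum H K) x y) = hadd (hsum H K) (hscale (hsum H K) c x) (hscale (hsum H K) c y)"
      if "x \<in> hcarrier (hsum H K)" "y \<in> hcarrier (hsum H K)" for c x y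
      using that by (auto simp: H.scale_add_right K.scale_add_right)
    show "hscale (hsum H K) (c + d) x = hadd (hsum H K) (hscale (hsum H K) c x) (hscale (hsum H K) d x)"
      "hscale (hsum H K) c (hscale (hsum H K) d x) = hscale (hsum H K) (c * d) x"
      "hscale (hsum H K) 1 x = x"
      if "x \<in> hcarrier (hsum H K)" for c d x
      using that by (auto simp: H.scale_add_left K.scale_add_left H.scale_scale K.scale_scale H.scale_one K.scale_one)
  qed (fact S.inner_sym S.inner_addl S.inner_scalel S.inner_pos S.inner_def0)+
qed

section \<open>Induction over bounded Borel functions\<close>

definition bounded_borel :: "(real \<Rightarrow> real) \<Rightarrow> bool" where
  "bounded_borel f \<longleftrightarrow> f \<in> borel_measurable borel \<and> (\<exists>K. \<forall>t. \<bar>f t\<bar> \<le> K)"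

lemma bounded_borelI: "f \<in> borel_measurable borel \<Longrightarrow> (\<And>t. \<bar>f t\<bar> \<le> K) \<Longrightarrow> bounded_borel f"
  unfolding bounded_borel_def by blast

lemma bounded_borelE:
  assumes "bounded_borel f" obtains K where "K > 0" "\<And>t. \<bar>f t\<bar> \<le> K"
proof -
  obtain K where "\<forall>t. \<bar>f t\<bar> \<le> K" using assms unfolding bounded_borel_def by blast
  then have "\<bar>f t\<bar> \<le> max K 1" for t by (simp add: le_max_iff_disj)
  then show ?thesis using that[of "max K 1"] by simp
qed

lemma bounded_borel_measurable [measurable_dest]: "bounded_borel f \<Longrightarrow> f \<in> borel_measurable borel"
  by (simp add: bounded_borel_def)

lemma bounded_borel_indicator [simp]: "B \<in> sets borel \<Longrightarrow> bounded_borel (indicator B)"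
  by (rule bounded_borelI[of _ 1]) (auto simp: indicator_def)

lemma bounded_borel_const [simp]: "bounded_borel (\<lambda>_. c)"
  by (rule bounded_borelI[of _ "\<bar>c\<bar>"]) auto

lemma bounded_borel_add [simp]:
  assumes "bounded_borel f" "bounded_borel g" shows "bounded_borel (\<lambda>t. f t + g t)"
proof -
  obtain K where K: "\<And>t. \<bar>f t\<bar> \<le> K" by (rule bounded_borelE[OF assms(1)]) blast
  obtain L where L: "\<And>t. \<bar>g t\<bar> \<le> L" by (rule bounded_borelE[OF assms(2)]) blast
  have "\<bar>f t + g t\<bar> \<le> K + L" for t using K[of t] L[of t] by linarith
  then show ?thesis using assms by (intro bounded_borelI[of _ "K + L"]) (auto simp: bounded_borel_def)
qed

lemma bounded_borel_mult [simp]: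
  assumes "bounded_borel f" "bounded_borel g" shows "bounded_borel (\<lambda>t. f t * g t)"
proof -
  obtain K where K: "K > 0" "\<And>t. \<bar>f t\<bar> \<le> K" by (rule bounded_borelE[OF assms(1)]) blast
  obtain L where L: "\<And>t. \<bar>g t\<bar> \<le> L" by (rule bounded_borelE[OF assms(2)]) blast
  have "\<bar>f t * g t\<bar> \<le> K * L" for t
    unfolding abs_mult using K L by (intro mult_mono) auto
  then show ?thesis using assms by (intro bounded_borelI[of _ "K * L"]) (auto simp: bounded_borel_def)
qed

lemma bounded_borel_minus [simp]:
  assumes "bounded_borel f" "bounded_borel g" shows "bounded_borel (\<lambda>t. f t - g t)"
  using bounded_borel_add[OF assms(1) bounded_borel_mult[OF bounded_borel_const[of "-1"] assms(2)]] by simp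

lemma bounded_borel_uminus [simp]: "bounded_borel f \<Longrightarrow> bounded_borel (\<lambda>t. - f t)"
  using bounded_borel_minus[OF bounded_borel_const[of 0]] by simp

lemma bounded_borel_divide [simp]: "bounded_borel f \<Longrightarrow> bounded_borel (\<lambda>t. f t / c)"
  using bounded_borel_mult[OF bounded_borel_const[of "1 / c"]] by simp

text \<open>The induction principle for nonnegative Borel functions, kept inside the bounded functions: a summand
or a monotone approximant of a bounded nonnegative function is bounded, and adding a constant makes
any bounded function nonnegative.\<close>

lemma bounded_borel_induct [consumes 1, case_names ind add scale lim]:
  assumes f: "bounded_borel f"
    and ind: "\<And>B. B \<in> sets borel \<Longrightarrow> P (indicator B)"
    and add: "\<And>f g. bounded_borel f \<Longrightarrow> bounded_borel g \<Longrightarrow> P f \<Longrightarrow> P g \<Longrightarrow> P (\<lambda>t. f t + g t)"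
    and scale: "\<And>c f. bounded_borel f \<Longrightarrow> P f \<Longrightarrow> P (\<lambda>t. c * f t)"
    and lim: "\<And>F f K. (\<And>n. bounded_borel (F n)) \<Longrightarrow> bounded_borel f \<Longrightarrow> (\<And>n t. \<bar>F n t\<bar> \<le> K) \<Longrightarrow>
        (\<And>t. (\<lambda>n. F n t) \<longlonglongrightarrow> f t) \<Longrightarrow> (\<And>n. P (F n)) \<Longrightarrow> P f"
  shows "P f"
proof -
  have pos: "bounded_borel g \<longrightarrow> P g" if "g \<in> borel_measurable borel" "\<And>t. 0 \<le> g t" for g
    using that
  proof (induction rule: borel_measurable_induct_real)
    case (set A) then show ?case using ind by blast
  next
    case (mult g c)
    show ?case
    proof (cases "c = 0")
      case True
      then show ?thesis using scale[OF bounded_borel_indicator ind, of UNIV 0] by simp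
    next
      case False
      show ?thesis
      proof
        assume "bounded_borel (\<lambda>x. c * g x)"
        from bounded_borel_mult[OF bounded_borel_const this, of "1/c"]
        have "bounded_borel g" using False by simp
        then show "P (\<lambda>x. c * g x)" using mult scale by blast
      qed
    qed
  next
    case (add g h)
    show ?case
    proof
      assume *: "bounded_borel (\<lambda>x. h x + g x)"
      then obtain K where K: "\<And>t. \<bar>h t + g t\<bar> \<le> K" using bounded_borelE by blast
      have "\<bar>g t\<bar> \<le> K" "\<bar>h t\<bar> \<le> K" for t using K[of t] add(2)[of t] add(4)[of t] by auto
      then have "bounded_borel g" "bounded_borel h"
        using bounded_borelI[OF add(1), of K] bounded_borelI[OF add(3), of K] by simp_all
      then show "P (\<lambda>x. h x + g x)" using add assms(3) by blast
    qed
  next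
    case (seq U)
    show ?case
    proof
      assume *: "bounded_borel g"
      then obtain K where K: "\<And>t. \<bar>g t\<bar> \<le> K" using bounded_borelE by blast
      have "U n t \<le> g t" for n t
        using seq(3,4) by (intro incseq_le) (auto simp: incseq_def le_fun_def)
      then have UK: "\<bar>U n t\<bar> \<le> K" for n t using K[of t] seq(2)[of n t] by (smt (verit))
      then have bb: "bounded_borel (U n)" for n using seq(1) by (auto intro: bounded_borelI)
      show "P g" by (rule lim[OF bb * UK]) (use seq bb in auto)
    qed
  qed
  obtain K where K: "\<And>t. \<bar>f t\<bar> \<le> K" using f bounded_borelE by blast
  have "0 \<le> f t + K" for t using K[of t] by linarith
  then have 1: "P (\<lambda>t. f t + K)"
    using pos[of "\<lambda>t. f t + K"] f bounded_borel_measurable[OF f] by simp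
  have 2: "P (\<lambda>t. (- K) * indicator UNIV t)" by (intro scale ind) auto
  have "P (\<lambda>t. (f t + K) + (- K) * indicator UNIV t)"
    by (rule add[OF _ _ 1 2]) (use f in auto)
  then show ?thesis by simp
qed

text \<open>For a self-adjoint \<open>T\<close> the bounded operators \<open>res0(T) = 1 / (1 + T\<^sup>2)\<close> and
\<open>res1(T) = T / (1 + T\<^sup>2)\<close> form the first column of the projection onto the graph of \<open>T\<close>.\<close>

definition res0 :: "real \<Rightarrow> real" where "res0 t = 1 / (1 + t\<^sup>2)"
definition res1 :: "real \<Rightarrow> real" where "res1 t = t / (1 + t\<^sup>2)"

lemma one_plus_sq_pos [simp]: "0 < 1 + (t::real)\<^sup>2" "1 + (t::real)\<^sup>2 \<noteq> 0"
  by (smt (verit) zero_le_power2)+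

lemma res_bounds: "0 < res0 t" "\<bar>res0 t\<bar> \<le> 1" "\<bar>res1 t\<bar> \<le> 1"
proof -
  show "0 < res0 t" "\<bar>res0 t\<bar> \<le> 1" by (simp_all add: res0_def)
  have "0 \<le> (\<bar>t\<bar> - 1)\<^sup>2" by simp
  then have "\<bar>t\<bar> \<le> 1 + t\<^sup>2" unfolding power2_diff power2_abs using abs_ge_zero[of t] by simp
  then show "\<bar>res1 t\<bar> \<le> 1" by (simp add: res1_def abs_divide)
qed

lemma bounded_borel_res [simp]: shows "bounded_borel res0" and "bounded_borel res1"
proof -
  have "res0 \<in> borel_measurable borel" "res1 \<in> borel_measurable borel"
    unfolding res0_def[abs_def] res1_def[abs_def] by measurable
  then show "bounded_borel res0" "bounded_borel res1"
    using res_bounds by (auto intro: bounded_borelI[of _ 1])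
qed

text \<open>The point \<open>(res0 t, res1 t)\<close> determines \<open>t\<close>, so multiplication by these two functions, linear
combinations and bounded limits lead from the constant 1 to every bounded Borel function. Polynomials in
the two functions come first, continuous functions of the point \<open>(res0 t, res1 t)\<close> follow by
Stone-Weierstrass, indicators of closed sets as limits of continuous functions, indicators of Borel
sets by Dynkin's lemma. What is known about the operators \<open>1 / (1 + T\<^sup>2)\<close> and \<open>T / (1 + T\<^sup>2)\<close> is
passed on to the spectral projections of \<open>T\<close> in this way.\<close>

theorem bounded_borel_resolvent_induct [consumes 1, case_names one add scale lim res0 res1]:
  assumes f: "bounded_borel f"
    and one: "P (\<lambda>_. 1)"
    and add: "\<And>f g. bounded_borel f \<Longrightarrow> bounded_borel g \<Longrightarrow> P f \<Longrightarrow> P g \<Longrightarrow> P (\<lambda>t. f t + g t)"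
    and scale: "\<And>c f. bounded_borel f \<Longrightarrow> P f \<Longrightarrow> P (\<lambda>t. c * f t)"
    and lim: "\<And>F f K. (\<And>n. bounded_borel (F n)) \<Longrightarrow> bounded_borel f \<Longrightarrow> (\<And>n t. \<bar>F n t\<bar> \<le> K) \<Longrightarrow>
        (\<And>t. (\<lambda>n. F n t) \<longlonglongrightarrow> f t) \<Longrightarrow> (\<And>n. P (F n)) \<Longrightarrow> P f"
    and res0: "\<And>f. bounded_borel f \<Longrightarrow> P f \<Longrightarrow> P (\<lambda>t. res0 t * f t)"
    and res1: "\<And>f. bounded_borel f \<Longrightarrow> P f \<Longrightarrow> P (\<lambda>t. res1 t * f t)"
  shows "P f"
proof -
  define z where "z t = Complex (res0 t) (res1 t)" for t
  have z_meas [measurable]: "z \<in> borel_measurable borel"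
    unfolding z_def[abs_def] Complex_eq
    using bounded_borel_res[THEN bounded_borel_measurable] by measurable
  have z_bd: "z t \<in> cball 0 2" for t
    using cmod_le[of "z t"] res_bounds[of t] by (simp add: z_def)
  have const: "P (\<lambda>_. c)" for c using scale[OF _ one, of c] by simp
  have comp_bb: "bounded_borel (\<lambda>t. h (z t))" if h: "continuous_on UNIV h" for h :: "complex \<Rightarrow> real"
  proof -
    have "compact (h ` cball 0 2)"
      using h by (intro compact_continuous_image) (auto intro: continuous_on_subset)
    then obtain K where "\<forall>y\<in>h ` cball 0 2. norm y \<le> K" using compact_imp_bounded bounded_iff by metis
    then have "\<bar>h (z t)\<bar> \<le> K" for t using z_bd[of t] by auto
    moreover have "h \<in> borel_measurable borel" using h by (rule borel_measurable_continuous_onI)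
    ultimately show ?thesis by (auto intro!: bounded_borelI)
  qed
  have pbb: "bounded_borel (\<lambda>t. p (z t))" if "real_polynomial_function p" for p :: "complex \<Rightarrow> real"
    by (rule comp_bb, rule continuous_on_polymonial_function) (use that real_polynomial_function_eq in blast)
  \<comment> \<open>The statement for products with an arbitrary \<open>f\<close> carries the induction through \<open>p * q\<close>.\<close>
  have poly: "\<forall>f. bounded_borel f \<longrightarrow> P f \<longrightarrow> P (\<lambda>t. p (z t) * f t)"
    if "real_polynomial_function p" for p :: "complex \<Rightarrow> real"
    using that
  proof induction
    case (linear p)
    have p: "p (z t) = p 1 * res0 t + p \<i> * res1 t" for t
    proof -
      have "z t = res0 t *\<^sub>R 1 + res1 t *\<^sub>R \<i>" by (simp add: z_def complex_eq_iff)
      then show ?thesis by (simp add: linear_add linear_scale bounded_linear.linear[OF linear])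
    qed
    show ?case
    proof (intro allI impI)
      fix f assume f: "bounded_borel f" "P f"
      have "P (\<lambda>t. p 1 * (res0 t * f t) + p \<i> * (res1 t * f t))"
        by (intro add scale res0 res1) (use f in auto)
      then show "P (\<lambda>t. p (z t) * f t)" by (simp add: p algebra_simps)
    qed
  next
    case (const c) then show ?case using scale by blast
  next
    case (add p q)
    show ?case
    proof (intro allI impI)
      fix f assume f: "bounded_borel f" "P f"
      have "P (\<lambda>t. p (z t) * f t + q (z t) * f t)"
        by (rule assms(3)) (use f add pbb in auto)
      then show "P (\<lambda>t. (p (z t) + q (z t)) * f t)" by (simp add: algebra_simps)
    qed
  next
    case (mult p q)
    show ?case
    proof (intro allI impI)
      fix f assume f: "bounded_borel f" "P f"
      have "bounded_borel (\<lambda>t. q (z t) * f t)"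
        using f mult pbb by auto
      then have "P (\<lambda>t. p (z t) * (q (z t) * f t))" using f mult by blast
      then show "P (\<lambda>t. p (z t) * q (z t) * f t)" by (simp add: mult.assoc)
    qed
  qed
  have cont: "P (\<lambda>t. h (z t))" if h: "continuous_on UNIV h" for h :: "complex \<Rightarrow> real"
  proof -
    have "\<exists>p. real_polynomial_function p \<and> (\<forall>w\<in>cball 0 2. \<bar>h w - p w\<bar> < inverse (real (Suc n)))" for n
      using Stone_Weierstrass_real_polynomial_function[of "cball 0 2" h "inverse (real (Suc n))"]
        continuous_on_subset[OF h] by (metis compact_cball inverse_positive_iff_positive of_nat_0_less_iff subset_UNIV zero_less_Suc)
    then obtain p where p: "\<And>n. real_polynomial_function (p n)"
      "\<And>n w. w \<in> cball 0 2 \<Longrightarrow> \<bar>h w - p n w\<bar> < inverse (real (Suc n))" by metis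
    obtain K where K: "\<And>t. \<bar>h (z t)\<bar> \<le> K" using comp_bb[OF h] bounded_borelE by blast
    have pc: "continuous_on UNIV (p n)" for n
      using p(1) continuous_on_polymonial_function real_polynomial_function_eq by auto
    show ?thesis
    proof (rule lim[of "\<lambda>n t. p n (z t)" _ "K + 1"])
      show "bounded_borel (\<lambda>t. p n (z t))" for n by (rule comp_bb[OF pc])
      show "bounded_borel (\<lambda>t. h (z t))" by (rule comp_bb[OF h])
      show "\<bar>p n (z t)\<bar> \<le> K + 1" for n t
      proof -
        have "inverse (real (Suc n)) \<le> 1" by (simp add: inverse_eq_divide)
        then show ?thesis using p(2)[OF z_bd, of t n] K[of t] by linarith
      qed
      show "(\<lambda>n. p n (z t)) \<longlonglongrightarrow> h (z t)" for t
      proof (rule LIM_zero_cancel, rule Lim_null_comparison[OF _ LIMSEQ_inverse_real_of_nat], intro always_eventually allI)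
        show "norm (p n (z t) - h (z t)) \<le> inverse (real (Suc n))" for n
          using p(2)[OF z_bd, of t n] by simp
      qed
      show "P (\<lambda>t. p n (z t))" for n using poly[OF p(1)] one by (metis (no_types, lifting) bounded_borel_const mult.right_neutral ext)
    qed
  qed
  have ibb: "bounded_borel (\<lambda>t. indicat_real A (z t))" if A: "A \<in> sets borel" for A
  proof (rule bounded_borelI[of _ 1])
    have [measurable]: "A \<in> sets borel" by fact
    show "(\<lambda>t. indicat_real A (z t)) \<in> borel_measurable borel" by measurable
  qed (simp add: indicator_def)
  have closed: "P (\<lambda>t. indicator A (z t))" if A: "closed A" for A
  proof (cases "A = {}")
    case True then show ?thesis using const[of 0] by simp
  next
    case False
    show ?thesis
    proof (rule lim[of "\<lambda>n t. max 0 (1 - real n * infdist (z t) A)" _ 1])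
      \<comment> \<open>The tents \<open>max 0 (1 - n d)\<close> over the distance \<open>d\<close> to a closed set decrease to its indicator.\<close>
      show "bounded_borel (\<lambda>t. max 0 (1 - real n * infdist (z t) A))" for n
        by (rule comp_bb) (intro continuous_intros)
      show "bounded_borel (\<lambda>t. indicat_real A (z t))"
        using A by (intro ibb borel_closed)
      show "\<bar>max 0 (1 - real n * infdist (z t) A)\<bar> \<le> 1" for n t by (simp add: infdist_nonneg)
      show "P (\<lambda>t. max 0 (1 - real n * infdist (z t) A))" for n
        by (rule cont) (intro continuous_intros)
      show "(\<lambda>n. max 0 (1 - real n * infdist (z t) A)) \<longlonglongrightarrow> indicat_real A (z t)" for t
      proof (cases "z t \<in> A")
        case True then show ?thesis by simp
      next
        case False2: False
        then have "infdist (z t) A > 0" using A False by (metis in_closed_iff_infdist_zero infdist_nonneg less_le)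
        then obtain N where N: "1 < real N * infdist (z t) A" using reals_Archimedean3 by blast
        have "max 0 (1 - real n * infdist (z t) A) = 0" if "n \<ge> N" for n
        proof -
          have "real N * infdist (z t) A \<le> real n * infdist (z t) A"
            using that by (intro mult_right_mono) (auto simp: infdist_nonneg)
          then show ?thesis using N by linarith
        qed
        then show ?thesis using False2 by (intro tendsto_eventually) (auto simp: eventually_sequentially)
      qed
    qed
  qed
  have borel_closed: "sets (borel :: complex measure) = sigma_sets UNIV (Collect closed)"
    by (simp add: borel_eq_closed)
  have borel: "P (\<lambda>t. indicator A (z t))" if A: "A \<in> sets borel" for A
  proof -
    have "Int_stable (Collect (closed :: complex set \<Rightarrow> bool))"
      "Collect (closed :: complex set \<Rightarrow> bool) \<subseteq> Pow UNIV"
      "A \<in> sigma_sets UNIV (Collect closed)" using A borel_closed by (auto simp: Int_stable_def)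
    then show ?thesis
    proof (induction rule: sigma_sets_induct_disjoint)
      case (basic A) then show ?case using closed by simp
    next
      case empty then show ?case using const[of 0] by simp
    next
      case (compl A)
      then have "A \<in> sets borel" by (simp add: borel_closed)
      then have "P (\<lambda>t. 1 + (-1) * indicator A (z t))"
        using ibb by (intro assms(3) scale one compl) auto
      moreover have "(\<lambda>t. 1 + (-1) * indicator A (z t)) = (\<lambda>t. indicat_real (UNIV - A) (z t))"
        by (auto simp: indicator_def)
      ultimately show ?case by simp
    next
      case (union A)
      have Ab: "A n \<in> sets borel" for n using union(2) by (auto simp: borel_closed)
      have eq: "(\<Sum>i<n. indicat_real (A i) w) = indicator (\<Union>i<n. A i) w" for n w
        using union(1) by (subst indicator_UN_disjoint) (auto simp: disjoint_family_on_def)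
      show ?case
      proof (rule lim[of "\<lambda>n t. \<Sum>i<n. indicator (A i) (z t)" _ 1])
        show bbn: "bounded_borel (\<lambda>t. \<Sum>i<n. indicat_real (A i) (z t))" for n
          unfolding eq using Ab by (intro ibb) auto
        show "bounded_borel (\<lambda>t. indicat_real (\<Union> (range A)) (z t))" using Ab by (intro ibb) auto
        show "\<bar>\<Sum>i<n. indicat_real (A i) (z t)\<bar> \<le> 1" for n t unfolding eq by (simp add: indicator_def)
        show "P (\<lambda>t. \<Sum>i<n. indicat_real (A i) (z t))" for n
        proof (induction n)
          case 0 then show ?case using const[of 0] by simp
        next
          case (Suc n)
          have "P (\<lambda>t. (\<Sum>i<n. indicat_real (A i) (z t)) + indicator (A n) (z t))"
            by (rule assms(3)[OF bbn ibb[OF Ab] Suc union(3)])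
          then show ?case by simp
        qed
        show "(\<lambda>n. \<Sum>i<n. indicat_real (A i) (z t)) \<longlonglongrightarrow> indicat_real (\<Union> (range A)) (z t)" for t
          unfolding eq using LIMSEQ_indicator_UN[of A "z t"] by simp
      qed
    qed
  qed
  show ?thesis using f
  proof (induction rule: bounded_borel_induct)
    case (ind B)
    \<comment> \<open>Since \<open>t = res1 t / res0 t\<close>, a Borel set of the line is the trace of a Borel set of the plane.\<close>
    define A where "A = {w. Re w \<noteq> 0 \<and> Im w / Re w \<in> B}"
    have "A = {w \<in> space borel. Re w \<noteq> 0 \<and> Im w / Re w \<in> B}" by (simp add: A_def)
    also have "\<dots> \<in> sets borel" using ind by measurable
    finally have "P (\<lambda>t. indicator A (z t))" by (rule borel)
    moreover have "indicator A (z t) = indicat_real B t" for t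
    proof -
      have "res1 t / res0 t = t" by (simp add: res1_def res0_def)
      then show ?thesis using res_bounds(1)[of t] by (simp add: A_def z_def indicator_def)
    qed
    ultimately show ?case by simp
  qed (use add scale lim in blast)+
qed

definition cayley :: "real \<Rightarrow> complex" where
  "cayley t = (of_real t - \<i>) / (of_real t + \<i>)"

lemma cayley_eq: "cayley t = Complex (1 - 2 * res0 t) (- 2 * res1 t)"
proof -
  have "Complex (1 - 2 * res0 t) (- 2 * res1 t) * (of_real t + \<i>) = of_real t - \<i>"
  proof -
    define q where "q = 1 + t\<^sup>2"
    have q: "q \<noteq> 0" by (simp add: q_def)
    have t: "t * t = q - 1" by (simp add: q_def power2_eq_square)
    show ?thesis unfolding complex_eq_iff res0_def res1_def q_def[symmetric]
      using q by (simp add: field_simps power2_eq_square; use t in algebra)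
  qed
  moreover have "of_real t + \<i> \<noteq> 0" by (simp add: complex_eq_iff)
  ultimately show ?thesis unfolding cayley_def by (simp add: field_simps)
qed

lemma norm_cayley: "cmod (cayley t) = 1"
proof -
  have "of_real t + \<i> \<noteq> 0" by (simp add: complex_eq_iff)
  moreover have "cmod (of_real t - \<i>) = cmod (of_real t + \<i>)" by (simp add: cmod_def)
  ultimately show ?thesis by (simp add: cayley_def norm_divide)
qed

lemma cayley_nz [simp]: "cayley t \<noteq> 0" using norm_cayley[of t] by auto

lemma cnj_cayley: "cnj (cayley t) = inverse (cayley t)"
  using norm_cayley[of t] by (metis complex_norm_square inverse_unique of_real_1 one_power2)

lemma cayley_measurable [measurable]: "cayley \<in> borel_measurable borel"
  unfolding cayley_def[abs_def] by measurable

text \<open>The real trigonometric polynomials, transported from the circle to the line by the Cayley map.\<close>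

definition trig :: "complex \<Rightarrow> int \<Rightarrow> real \<Rightarrow> real" where
  "trig a n t = Re (a * cayley t powi n)"

lemma trig_bounded_borel [simp]: "bounded_borel (trig a n)"
proof (rule bounded_borelI)
  have "(\<lambda>t. cayley t powi n) \<in> borel_measurable borel"
    by (cases "n \<ge> 0") (auto simp: power_int_def)
  then show "trig a n \<in> borel_measurable borel" unfolding trig_def[abs_def] by measurable
  show "\<bar>trig a n t\<bar> \<le> cmod a" for t
    unfolding trig_def by (rule order_trans[OF abs_Re_le_cmod]) (simp add: norm_mult norm_power_int norm_cayley)
qed

lemma trig_mult: "Re (b * cayley t) * trig a n t = (trig (a * b) (n + 1) t + trig (a * cnj b) (n - 1) t) / 2"
proof -
  have *: "Re x * Re y = (Re (y * x) + Re (y * cnj x)) / 2" for x y by simp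
  show ?thesis unfolding trig_def *
    by (simp add: cnj_cayley power_int_add power_int_diff field_simps)
qed

lemma res0_trig: "res0 t * trig a n t = 1/2 * trig a n t - 1/4 * trig a (n + 1) t - 1/4 * trig a (n - 1) t"
proof -
  have "res0 t = 1/2 - 1/2 * Re (1 * cayley t)" by (simp add: cayley_eq field_simps)
  then show ?thesis using trig_mult[of 1 t a n] by (simp add: ring_distribs)
qed

lemma res1_trig: "res1 t * trig a n t = 1/4 * trig (a * \<i>) (n + 1) t + 1/4 * trig (- (a * \<i>)) (n - 1) t"
proof -
  have "res1 t = 1/2 * Re (\<i> * cayley t)" by (simp add: cayley_eq)
  then show ?thesis using trig_mult[of \<i> t a n] by (simp add: algebra_simps)
qed

text \<open>With \<open>cayley t = 1 - 2 res0 t - 2 \<i> res1 t\<close>, products of \<open>res0\<close> and \<open>res1\<close> with trigonometric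
polynomials are trigonometric polynomials again (\<open>res0_trig\<close>, \<open>res1_trig\<close>). Hence the preceding
induction applies to the property that the product of \<open>f\<close> with every trigonometric polynomial
satisfies \<open>P\<close>.\<close>

theorem bounded_borel_trig_induct [consumes 1, case_names trig add scale lim]:
  assumes f: "bounded_borel f"
    and trig: "\<And>a n. P (trig a n)"
    and add: "\<And>f g. bounded_borel f \<Longrightarrow> bounded_borel g \<Longrightarrow> P f \<Longrightarrow> P g \<Longrightarrow> P (\<lambda>t. f t + g t)"
    and scale: "\<And>c f. bounded_borel f \<Longrightarrow> P f \<Longrightarrow> P (\<lambda>t. c * f t)"
    and lim: "\<And>F f K. (\<And>n. bounded_borel (F n)) \<Longrightarrow> bounded_borel f \<Longrightarrow> (\<And>n t. \<bar>F n t\<bar> \<le> K) \<Longrightarrow>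
        (\<And>t. (\<lambda>n. F n t) \<longlonglongrightarrow> f t) \<Longrightarrow> (\<And>n. P (F n)) \<Longrightarrow> P f"
  shows "P f"
proof -
  have "\<forall>a n. P (\<lambda>t. f t * trig a n t)" using f
  proof (induction rule: bounded_borel_resolvent_induct)
    case one then show ?case using trig by simp
  next
    case (add f g)
    show ?case
    proof (intro allI)
      fix a n
      have "P (\<lambda>t. f t * trig a n t + g t * trig a n t)" by (rule assms(3)) (use add in auto)
      then show "P (\<lambda>t. (f t + g t) * trig a n t)" by (simp add: algebra_simps)
    qed
  next
    case (scale c f)
    show ?case
    proof (intro allI)
      fix a n
      have "P (\<lambda>t. c * (f t * trig a n t))" by (rule assms(4)) (use scale in auto)
      then show "P (\<lambda>t. (c * f t) * trig a n t)" by (simp add: algebra_simps)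
    qed
  next
    case (lim F f K)
    show ?case
    proof (intro allI)
      fix a n
      obtain L where L: "\<And>t. \<bar>trig a n t\<bar> \<le> L" "L > 0" using trig_bounded_borel bounded_borelE by blast
      show "P (\<lambda>t. f t * trig a n t)"
      proof (rule assms(5)[of "\<lambda>k t. F k t * trig a n t" _ "K * L"])
        show "\<bar>F k t * trig a n t\<bar> \<le> K * L" for k t
          unfolding abs_mult using lim(3)[of k t] L by (intro mult_mono) (auto intro: order_trans[OF abs_ge_zero])
      qed (use lim in \<open>auto intro: tendsto_intros\<close>)
    qed
  next
    case (res0 f)
    show ?case
    proof (intro allI)
      fix a n
      have "P (\<lambda>t. (1/2) * (f t * trig a n t) + ((-1/4) * (f t * trig a (n + 1) t) + (-1/4) * (f t * trig a (n - 1) t)))"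
        by (intro assms(3) assms(4)) (use res0 in auto)
      moreover have "(1/2) * (f t * trig a n t) + ((-1/4) * (f t * trig a (n + 1) t) + (-1/4) * (f t * trig a (n - 1) t))
          = res0 t * f t * trig a n t" for t
        using res0_trig[of t a n] by algebra
      ultimately show "P (\<lambda>t. res0 t * f t * trig a n t)" by simp
    qed
  next
    case (res1 f)
    show ?case
    proof (intro allI)
      fix a n
      have "P (\<lambda>t. (1/4) * (f t * trig (a * \<i>) (n + 1) t) + (1/4) * (f t * trig (- (a * \<i>)) (n - 1) t))"
        by (intro assms(3) assms(4)) (use res1 in auto)
      moreover have "(1/4) * (f t * trig (a * \<i>) (n + 1) t) + (1/4) * (f t * trig (- (a * \<i>)) (n - 1) t)
          = res1 t * f t * trig a n t" for t
        using res1_trig[of t a n] by algebra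
      ultimately show "P (\<lambda>t. res1 t * f t * trig a n t)" by simp
    qed
  qed
  then have "P (\<lambda>t. f t * trig 1 0 t)" by blast
  then show ?thesis by (simp add: trig_def)
qed

section \<open>The bounded functional calculus of a projection-valued measure\<close>

lemma (in inner_space) polarization:
  assumes A: "\<And>x. x \<in> V \<Longrightarrow> A x \<in> V" "\<And>x y. x \<in> V \<Longrightarrow> y \<in> V \<Longrightarrow> A (hadd H x y) = hadd H (A x) (A y)"
      "\<And>c x. x \<in> V \<Longrightarrow> A (hscale H c x) = hscale H c (A x)"
    and x: "x \<in> V" and z: "z \<in> V"
  shows "(1 / 4) * (\<Sum>k<4. \<i> ^ k * hinner H (A (hadd H x (hscale H (\<i> ^ k) z))) (hadd H x (hscale H (\<i> ^ k) z)))
    = hinner H (A x) z"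
proof -
  have "\<i> ^ 3 = - \<i>" by (simp add: power3_eq_cube)
  then show ?thesis using A x z by (simp add: numeral_eq_Suc algebra_simps)
qed

text \<open>A finite measure \<open>m x\<close> for every vector \<open>x\<close>, to be thought of as \<open>B \<mapsto> \<langle>E(B) x, x\<rangle>\<close>. The calculus is
developed for such families, because the existence proof constructs the measures before the
projections.\<close>

locale measure_family = inner_space H for H :: "'v hspace" +
  fixes m :: "'v \<Rightarrow> real measure"
  assumes m_finite: "\<And>x. x \<in> V \<Longrightarrow> finite_measure (m x)"
    and m_sets [simp]: "\<And>x. x \<in> V \<Longrightarrow> sets (m x) = sets borel"
begin

lemma m_space [simp]: "x \<in> V \<Longrightarrow> space (m x) = UNIV"
  using sets_eq_imp_space_eq[OF m_sets] by simp

lemma m_measurable: "x \<in> V \<Longrightarrow> f \<in> borel_measurable borel \<Longrightarrow> f \<in> borel_measurable (m x)"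
  using measurable_cong_sets[OF m_sets refl] by blast

lemma m_integrable [simp]:
  assumes "x \<in> V" "bounded_borel f" shows "integrable (m x) f"
proof -
  interpret finite_measure "m x" by (rule m_finite[OF assms(1)])
  obtain K where "\<And>t. \<bar>f t\<bar> \<le> K" using assms(2) by (rule bounded_borelE) blast
  then show ?thesis using m_measurable[OF assms(1) bounded_borel_measurable[OF assms(2)]]
    by (intro integrable_const_bound[where B = K]) auto
qed

definition form :: "(real \<Rightarrow> real) \<Rightarrow> 'v \<Rightarrow> 'v \<Rightarrow> complex" where
  "form f x z = (1 / 4) * (\<Sum>k<4. \<i> ^ k * complex_of_real (LINT t|m (hadd H x (hscale H (\<i> ^ k) z)). f t))"

lemma form_add:
  "bounded_borel f \<Longrightarrow> bounded_borel g \<Longrightarrow> x \<in> V \<Longrightarrow> z \<in> V \<Longrightarrow> form (\<lambda>t. f t + g t) x z = form f x z + form g x z"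
  unfolding form_def by (simp add: sum.distrib algebra_simps)

lemma form_scale:
  "x \<in> V \<Longrightarrow> z \<in> V \<Longrightarrow> form (\<lambda>t. c * f t) x z = of_real c * form f x z"
  unfolding form_def by (simp add: sum_distrib_left algebra_simps)

lemma integral_lim:
  assumes "\<And>n. bounded_borel (F n)" "bounded_borel f" "\<And>n t. \<bar>F n t\<bar> \<le> K" "\<And>t. (\<lambda>n. F n t) \<longlonglongrightarrow> f t" "x \<in> V"
  shows "(\<lambda>n. LINT t|m x. F n t) \<longlonglongrightarrow> (LINT t|m x. f t)"
proof (rule integral_dominated_convergence[where w = "\<lambda>_. K"])
  interpret finite_measure "m x" by (rule m_finite[OF assms(5)])
  show "integrable (m x) (\<lambda>_. K)" by simp
qed (use assms in \<open>auto intro: m_measurable bounded_borel_measurable\<close>)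

lemma form_lim:
  assumes "\<And>n. bounded_borel (F n)" "bounded_borel f" "\<And>n t. \<bar>F n t\<bar> \<le> K" "\<And>t. (\<lambda>n. F n t) \<longlonglongrightarrow> f t" "x \<in> V" "z \<in> V"
  shows "(\<lambda>n. form (F n) x z) \<longlonglongrightarrow> form f x z"
  unfolding form_def
  by (intro tendsto_intros integral_lim[OF assms(1-4)]) (use assms(5,6) in auto)

text \<open>Polarizing an arbitrary family of measures does not give a sesquilinear form. The property is stated
for a single function, since it passes to sums, multiples and bounded limits of functions; it is then
enough to check it on a class of functions that generates the others.\<close>

definition hermitian_form :: "(real \<Rightarrow> real) \<Rightarrow> bool" where
  "hermitian_form f \<longleftrightarrow>
    (\<forall>x\<in>V. \<forall>y\<in>V. \<forall>z\<in>V. form f (hadd H x y) z = form f x z + form f y z) \<and>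
    (\<forall>c. \<forall>x\<in>V. \<forall>z\<in>V. form f (hscale H c x) z = c * form f x z) \<and>
    (\<forall>x\<in>V. \<forall>z\<in>V. cnj (form f x z) = form f z x) \<and>
    (\<forall>x\<in>V. form f x x = complex_of_real (LINT t|m x. f t))"

lemma hermitian_form_add:
  assumes "bounded_borel f" "bounded_borel g" "hermitian_form f" "hermitian_form g"
  shows "hermitian_form (\<lambda>t. f t + g t)"
  using assms(3,4) unfolding hermitian_form_def by (auto simp: form_add[OF assms(1,2)] assms(1,2) algebra_simps)

lemma hermitian_form_scale: "hermitian_form f \<Longrightarrow> hermitian_form (\<lambda>t. c * f t)"
  unfolding hermitian_form_def by (simp add: form_scale algebra_simps)

lemma hermitian_form_lim:
  assumes "\<And>n. bounded_borel (F n)" "bounded_borel f" "\<And>n t. \<bar>F n t\<bar> \<le> K" "\<And>t. (\<lambda>n. F n t) \<longlonglongrightarrow> f t"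
    and h: "\<And>n. hermitian_form (F n)"
  shows "hermitian_form f"
  unfolding hermitian_form_def
proof (intro conjI ballI allI)
  note L = form_lim[OF assms(1-4)]
  fix x assume x: "x \<in> V"
  show "form f x x = complex_of_real (LINT t|m x. f t)"
    by (rule LIMSEQ_unique[OF L[OF x x]])
      (use h x tendsto_of_real[OF integral_lim[OF assms(1-4) x]] in \<open>simp add: hermitian_form_def\<close>)
  fix z assume z: "z \<in> V"
  show "cnj (form f x z) = form f z x"
    by (rule LIMSEQ_unique[OF _ L[OF z x]])
      (use h x z tendsto_cnj[OF L[OF x z]] in \<open>simp add: hermitian_form_def\<close>)
  show "form f (hscale H c x) z = c * form f x z" for c
    by (rule LIMSEQ_unique[OF L])
      (use h x z tendsto_mult_left[OF L[OF x z], of c] in \<open>simp_all add: hermitian_form_def\<close>)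
next
  note L = form_lim[OF assms(1-4)]
  fix x y z assume x: "x \<in> V" and y: "y \<in> V" and z: "z \<in> V"
  show "form f (hadd H x y) z = form f x z + form f y z"
    by (rule LIMSEQ_unique[OF L])
      (use h x y z tendsto_add[OF L[OF x z] L[OF y z]] in \<open>simp_all add: hermitian_form_def\<close>)
qed

end

locale spectral_family = measure_family +
  assumes hermitian: "\<And>f. bounded_borel f \<Longrightarrow> hermitian_form f"
    and form_one: "\<And>x z. x \<in> V \<Longrightarrow> z \<in> V \<Longrightarrow> form (\<lambda>_. 1) x z = hinner H x z"
begin

context fixes f assumes f: "bounded_borel f"
begin

lemma form_addl [simp]: "x \<in> V \<Longrightarrow> y \<in> V \<Longrightarrow> z \<in> V \<Longrightarrow> form f (hadd H x y) z = form f x z + form f y z"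
  and form_scalel [simp]: "x \<in> V \<Longrightarrow> z \<in> V \<Longrightarrow> form f (hscale H c x) z = c * form f x z"
  and form_cnj: "x \<in> V \<Longrightarrow> z \<in> V \<Longrightarrow> form f z x = cnj (form f x z)"
  and form_diag: "x \<in> V \<Longrightarrow> form f x x = complex_of_real (LINT t|m x. f t)"
  using hermitian[OF f] unfolding hermitian_form_def by (blast, blast, metis, blast)

lemma form_addr [simp]: "x \<in> V \<Longrightarrow> y \<in> V \<Longrightarrow> z \<in> V \<Longrightarrow> form f z (hadd H x y) = form f z x + form f z y"
  by (metis add_mem complex_cnj_add form_addl form_cnj)

lemma form_scaler [simp]: "x \<in> V \<Longrightarrow> z \<in> V \<Longrightarrow> form f z (hscale H c x) = cnj c * form f z x"
  by (metis scale_mem complex_cnj_mult form_scalel form_cnj)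

end

lemma mass: "x \<in> V \<Longrightarrow> measure (m x) UNIV = (hnorm H x)\<^sup>2"
proof -
  assume x: "x \<in> V"
  interpret finite_measure "m x" by (rule m_finite[OF x])
  have "complex_of_real (measure (m x) UNIV) = form (\<lambda>_. 1) x x"
    using form_diag[of "\<lambda>_. 1" x] x by simp
  also have "\<dots> = complex_of_real ((hnorm H x)\<^sup>2)" using form_one[OF x x] inner_self[OF x] by simp
  finally show ?thesis using of_real_eq_iff by blast
qed

lemma form_quadratic_bound:
  assumes f: "bounded_borel f" and K: "\<And>t. \<bar>f t\<bar> \<le> K" and x: "x \<in> V"
  shows "\<bar>LINT t|m x. f t\<bar> \<le> K * (hnorm H x)\<^sup>2"
proof -
  interpret finite_measure "m x" by (rule m_finite[OF x])
  have "\<bar>LINT t|m x. f t\<bar> \<le> (LINT t|m x. \<bar>f t\<bar>)" by simp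
  also have "\<dots> \<le> (LINT t|m x. K)" using f x K by (intro integral_mono) auto
  finally show ?thesis using mass[OF x] x by (simp add: mult.commute)
qed

text \<open>Bounding the four polarization terms separately gives \<open>K (\<parallel>x\<parallel>\<^sup>2 + \<parallel>z\<parallel>\<^sup>2)\<close>; rescaling \<open>x\<close> and \<open>z\<close> to
unit vectors turns this into a bound by the product of the norms, with constant \<open>2 K\<close>.\<close>

lemma form_bound:
  assumes f: "bounded_borel f" and K: "\<And>t. \<bar>f t\<bar> \<le> K" and x: "x \<in> V" and z: "z \<in> V"
  shows "cmod (form f x z) \<le> 2 * K * hnorm H x * hnorm H z"
proof -
  have K0: "K \<ge> 0" using K[of 0] by linarith
  have *: "cmod (form f x z) \<le> K * ((hnorm H x)\<^sup>2 + (hnorm H z)\<^sup>2)" if x: "x \<in> V" and z: "z \<in> V" for x z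
  proof -
    have "cmod (form f x z) \<le> (1/4) * (\<Sum>k<4. \<bar>LINT t|m (hadd H x (hscale H (\<i> ^ k) z)). f t\<bar>)"
      unfolding form_def norm_mult
      by (intro mult_mono norm_sum[THEN order_trans] sum_mono) (auto simp: norm_mult norm_power)
    also have "\<dots> \<le> (1/4) * (\<Sum>k<4. K * (hnorm H (hadd H x (hscale H (\<i> ^ k) z)))\<^sup>2)"
      using x z by (intro mult_left_mono sum_mono form_quadratic_bound f K) auto
    also have "\<dots> = K * ((hnorm H x)\<^sup>2 + (hnorm H z)\<^sup>2)"
    proof -
      have 1: "\<i> ^ 3 = - \<i>" "{..<4::nat} = {0,1,2,3}" by (auto simp: power3_eq_cube)
      have q: "(hnorm H (hadd H x (hscale H (\<i> ^ k) z)))\<^sup>2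
          = (hnorm H x)\<^sup>2 + 2 * Re (cnj (\<i> ^ k) * hinner H x z) + (hnorm H z)\<^sup>2" for k
        using x z by (simp add: hnorm_sq_add hnorm_scale norm_power)
      have "(\<Sum>k<4. (hnorm H (hadd H x (hscale H (\<i> ^ k) z)))\<^sup>2) = 4 * ((hnorm H x)\<^sup>2 + (hnorm H z)\<^sup>2)"
        unfolding q 1(2) by (simp add: 1(1))
      then show ?thesis by (simp add: sum_distrib_left[symmetric])
    qed
    finally show ?thesis .
  qed
  show ?thesis
  proof (cases "hnorm H x = 0 \<or> hnorm H z = 0")
    case True
    then have "x = hzero H \<or> z = hzero H" using x z by (simp add: hnorm_eq_0)
    moreover have "form f (hzero H) z = 0"
      using form_addl[OF f, of "hzero H" "hzero H" z] vec_zero[of "hzero H"] z by simp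
    moreover have "form f x (hzero H) = 0"
      using form_addr[OF f, of "hzero H" "hzero H" x] vec_zero[of "hzero H"] x by simp
    ultimately show ?thesis by auto
  next
    case False
    define a where "a = hnorm H x"
    define b where "b = hnorm H z"
    have ab: "a > 0" "b > 0" using False x z unfolding a_def b_def by (auto simp: less_le)
    let ?x = "hscale H (of_real (1 / a)) x" and ?z = "hscale H (of_real (1 / b)) z"
    have "cmod (form f ?x ?z) \<le> K * ((hnorm H ?x)\<^sup>2 + (hnorm H ?z)\<^sup>2)"
      by (rule *) (use x z in auto)
    also have "\<dots> = 2 * K" using x z ab by (simp add: hnorm_scale a_def[symmetric] b_def[symmetric] norm_divide)
    finally have "cmod (form f x z) / (a * b) \<le> 2 * K"
      using x z ab by (simp add: f norm_divide norm_mult mult.commute)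
    then show ?thesis using ab by (simp add: a_def b_def field_simps)
  qed
qed

end

locale pvm = inner_space H for H :: "'v hspace" +
  fixes E :: "real set \<Rightarrow> 'v \<Rightarrow> 'v"
  assumes pvm: "projection_valued_measure H E"
begin

abbreviation \<mu> where "\<mu> \<equiv> scalar_measure H E"

lemma E_projection: "B \<in> sets borel \<Longrightarrow> projection H (E B)"
  using pvm unfolding projection_valued_measure_def by auto

lemma E_mem [simp]: "B \<in> sets borel \<Longrightarrow> x \<in> V \<Longrightarrow> E B x \<in> V"
  using E_projection[of B] unfolding projection_def bounded_operators_def by (auto dest: PiE_mem)

lemma E_add: "B \<in> sets borel \<Longrightarrow> x \<in> V \<Longrightarrow> y \<in> V \<Longrightarrow> E B (hadd H x y) = hadd H (E B x) (E B y)"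
  and E_scale: "B \<in> sets borel \<Longrightarrow> x \<in> V \<Longrightarrow> E B (hscale H c x) = hscale H c (E B x)"
  and E_extensional: "B \<in> sets borel \<Longrightarrow> x \<notin> V \<Longrightarrow> E B x = undefined"
  using E_projection[of B] unfolding projection_def bounded_operators_def by (simp, simp, auto dest: PiE_arb)

lemma E_sym: "B \<in> sets borel \<Longrightarrow> x \<in> V \<Longrightarrow> y \<in> V \<Longrightarrow> hinner H (E B x) y = hinner H x (E B y)"
  and E_idem: "B \<in> sets borel \<Longrightarrow> x \<in> V \<Longrightarrow> E B (E B x) = E B x"
  using E_projection[of B] unfolding projection_def by auto

lemma E_UNIV: "x \<in> V \<Longrightarrow> E UNIV x = x"
  and E_Int: "C \<in> sets borel \<Longrightarrow> B \<in> sets borel \<Longrightarrow> x \<in> V \<Longrightarrow> E (C \<inter> B) x = E C (E B x)"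
  and E_sums: "range A \<subseteq> sets borel \<Longrightarrow> disjoint_family A \<Longrightarrow> x \<in> V \<Longrightarrow> y \<in> V \<Longrightarrow>
        (\<lambda>n. hinner H (E (A n) x) y) sums hinner H (E (\<Union>n. A n) x) y"
  using pvm unfolding projection_valued_measure_def by (blast, blast, simp)

lemma E_quadratic: "B \<in> sets borel \<Longrightarrow> x \<in> V \<Longrightarrow> hinner H (E B x) x = complex_of_real ((hnorm H (E B x))\<^sup>2)"
  using E_sym[of B "E B x" x] inner_self[of "E B x"] by (simp add: E_idem)

lemma E_norm: "B \<in> sets borel \<Longrightarrow> x \<in> V \<Longrightarrow> hnorm H (E B x) \<le> hnorm H x"
  by (rule symmetric_idempotent_norm) (simp_all add: E_sym E_idem)

lemma emeasure_\<mu>: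
  assumes B: "B \<in> sets borel" and x: "x \<in> V"
  shows "emeasure (\<mu> x) B = ennreal (Re (hinner H (E B x) x))"
  unfolding scalar_measure_def
proof (rule emeasure_measure_of_sigma)
  show "sigma_algebra UNIV (sets (borel :: real measure))"
    using sets.sigma_algebra_axioms[of "borel :: real measure"] by simp
  have "hinner H (E {} x) x = 0"
  proof -
    have "(\<lambda>n::nat. hinner H (E {} x) x) sums hinner H (E (\<Union>n::nat. {}) x) x"
      by (rule E_sums) (use x in \<open>auto simp: disjoint_family_on_def\<close>)
    then show ?thesis using summable_LIMSEQ_zero sums_summable LIMSEQ_const_iff by metis
  qed
  then show "positive (sets borel) (\<lambda>B. ennreal (Re (hinner H (E B x) x)))"
    by (simp add: positive_def)
  show "countably_additive (sets borel) (\<lambda>B. ennreal (Re (hinner H (E B x) x)))"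
  proof (rule countably_additiveI)
    fix A :: "nat \<Rightarrow> real set" assume A: "range A \<subseteq> sets borel" "disjoint_family A"
    have "(\<lambda>n. Re (hinner H (E (A n) x) x)) sums Re (hinner H (E (\<Union>n. A n) x) x)"
      using sums_Re[OF E_sums[OF A x x]] .
    moreover have "Re (hinner H (E (A n) x) x) \<ge> 0" for n
      using E_quadratic[of "A n" x] A x by auto
    ultimately show "(\<Sum>n. ennreal (Re (hinner H (E (A n) x) x))) = ennreal (Re (hinner H (E (\<Union> (range A)) x) x))"
      by (simp add: suminf_ennreal2 sums_iff)
  qed
qed (fact B)

lemma sets_\<mu>: "sets (\<mu> x) = sets borel"
  unfolding scalar_measure_def by (simp add: sets.sigma_sets_eq[of borel, simplified])

lemma measure_\<mu>:
  assumes B: "B \<in> sets borel" and x: "x \<in> V"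
  shows "complex_of_real (measure (\<mu> x) B) = hinner H (E B x) x"
  using emeasure_\<mu>[OF assms] E_quadratic[OF assms] by (simp add: measure_def)

sublocale measure_family H \<mu>
proof (intro measure_family.intro measure_family_axioms.intro inner_space_axioms)
  
  show "finite_measure (\<mu> x)" if "x \<in> V" for x
    using emeasure_\<mu>[of UNIV x] that sets_eq_imp_space_eq[OF sets_\<mu>[of x]] by (intro finite_measureI) simp
qed (rule sets_\<mu>)

lemma sesq_integral_eq_form: "sesq_integral H E f x z = form f x z"
  by (simp add: sesq_integral_def form_def)

lemma form_indicator:
  assumes B: "B \<in> sets borel" and x: "x \<in> V" and z: "z \<in> V"
  shows "form (indicator B) x z = hinner H (E B x) z"
proof -
  have "complex_of_real (LINT t|\<mu> w. indicator B t) = hinner H (E B w) w" if "w \<in> V" for w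
    using measure_\<mu>[OF B that] that B by simp
  then show ?thesis unfolding form_def using polarization[of "E B" x z] B x z by (simp add: E_add E_scale)
qed

text \<open>For indicators, polarization recovers \<open>\<langle>E(B) x, z\<rangle>\<close>, which is a Hermitian form.\<close>

sublocale spectral_family H \<mu>
proof unfold_locales
  show "form (\<lambda>_. 1) x z = hinner H x z" if "x \<in> V" "z \<in> V" for x z
    using form_indicator[of UNIV x z] that by (simp add: E_UNIV)
  show "hermitian_form f" if "bounded_borel f" for f using that
  proof (induction rule: bounded_borel_induct)
    case (ind B)
    have "cnj (hinner H (E B x) z) = hinner H (E B z) x" if "x \<in> V" "z \<in> V" for x z
      using E_sym[OF ind that(2,1)] inner_sym[of z "E B x"] that ind by simp
    then show ?case unfolding hermitian_form_def
      using ind by (simp add: form_indicator E_add E_scale measure_\<mu>)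
  qed (use hermitian_form_add hermitian_form_scale hermitian_form_lim in blast)+
qed

lemma form_E:
  assumes B: "B \<in> sets borel" and f: "bounded_borel f" and x: "x \<in> V" and z: "z \<in> V"
  shows "form f x (E B z) = form (\<lambda>t. f t * indicator B t) x z"
  using f
proof (induction rule: bounded_borel_induct)
  case (ind A)
  have "form (\<lambda>t. indicator A t * indicator B t) x z = form (indicator (B \<inter> A)) x z"
    by (rule arg_cong[where f = "\<lambda>f. form f x z"]) (auto simp: indicator_def)
  then show ?case using ind B x z by (simp add: form_indicator E_Int E_sym)
next
  case (add f g)
  then show ?case using B x z by (simp add: form_add distrib_right)
next
  case (scale c f)
  then show ?case using B x z by (simp add: form_scale mult.assoc)
next
  case (lim F f K)
  have "(\<lambda>n. form (\<lambda>t. F n t * indicator B t) x z) \<longlonglongrightarrow> form (\<lambda>t. f t * indicator B t) x z"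
  proof (rule form_lim[of _ _ K])
    show "\<bar>F n t * indicator B t\<bar> \<le> K" for n t
      using lim(3)[of n t] order_trans[OF abs_ge_zero lim(3)] by (cases "t \<in> B") auto
  qed (use lim B x z in \<open>auto intro!: tendsto_intros\<close>)
  moreover have "(\<lambda>n. form (F n) x (E B z)) \<longlonglongrightarrow> form f x (E B z)"
    by (rule form_lim[OF lim(1-4)]) (use B x z in auto)
  ultimately show ?case unfolding lim(5) by (intro LIMSEQ_unique)
qed

text \<open>Here \<open>a\<close> is \<open>f(E) x\<close>, given by its inner products, since in an incomplete space the vector need
  not exist. For an indicator \<open>g\<close> the identity is that of \<open>form_E\<close>, with \<open>E(B)\<close> moved to the other
  argument.\<close>

lemma form_mult:
  assumes f: "bounded_borel f" and g: "bounded_borel g" and x: "x \<in> V" and z: "z \<in> V" and a: "a \<in> V"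
    and af: "\<And>z. z \<in> V \<Longrightarrow> hinner H a z = form f x z"
  shows "form g a z = form (\<lambda>t. f t * g t) x z"
  using g
proof (induction rule: bounded_borel_induct)
  case (ind B)
  then show ?case using form_E[OF ind f x z] af[of "E B z"] z a by (simp add: form_indicator E_sym)
next
  case (add g h)
  then show ?case using f a x z by (simp add: form_add distrib_left)
next
  case (scale c g)
  then show ?case using form_scale[of x z c "\<lambda>t. f t * g t"] a x z by (simp add: form_scale mult.left_commute)
next
  case (lim F g K)
  obtain L where L: "L > 0" "\<And>t. \<bar>f t\<bar> \<le> L" using f bounded_borelE by blast
  have "(\<lambda>n. form (\<lambda>t. f t * F n t) x z) \<longlonglongrightarrow> form (\<lambda>t. f t * g t) x z"
  proof (rule form_lim[of _ _ "L * K"])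
    show "\<bar>f t * F n t\<bar> \<le> L * K" for n t
      unfolding abs_mult using L lim(3) by (intro mult_mono) auto
  qed (use lim f x z in \<open>auto intro!: tendsto_intros\<close>)
  moreover have "(\<lambda>n. form (F n) a z) \<longlonglongrightarrow> form g a z"
    by (rule form_lim[OF lim(1-4) a z])
  ultimately show ?case unfolding lim(5) by (intro LIMSEQ_unique)
qed

end

section \<open>Unbounded functions of a projection-valued measure\<close>

definition level_cut :: "(real \<Rightarrow> real) \<Rightarrow> nat \<Rightarrow> real \<Rightarrow> real" where
  "level_cut f n = indicator {t. \<bar>f t\<bar> \<le> real n}"

lemma cut_idem: "level_cut f n t * level_cut f n t = level_cut f n t"
  by (simp add: level_cut_def indicator_def)

lemma cut_bounds: "0 \<le> level_cut f n t" "level_cut f n t \<le> 1"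
  by (auto simp: level_cut_def indicator_def)

lemma abs_le_1_cut: "\<bar>level_cut f n t\<bar> \<le> 1"
  by (auto simp: level_cut_def indicator_def)

lemma cut_mono: "n \<le> k \<Longrightarrow> level_cut f n t \<le> level_cut f k t"
  by (auto simp: level_cut_def indicator_def)

lemma cut_eventually: "\<forall>\<^sub>F n in sequentially. level_cut f n t = 1"
proof -
  obtain N where "\<bar>f t\<bar> \<le> real N" using real_arch_simple by blast
  then show ?thesis by (intro eventually_sequentiallyI[of N]) (simp add: level_cut_def)
qed

lemma cut_tendsto: "(\<lambda>n. g t * level_cut f n t) \<longlonglongrightarrow> g t"
  using cut_eventually[of f t] by (intro tendsto_eventually) (auto elim!: eventually_mono)

lemma abs_mult_cut: "\<bar>g t\<bar> \<le> K \<Longrightarrow> \<bar>g t * level_cut f n t\<bar> \<le> K"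
  using order_trans[OF abs_ge_zero] by (auto simp: level_cut_def indicator_def)

lemma abs_cut_mult: "\<bar>f t * level_cut f n t\<bar> \<le> real n"
  by (auto simp: level_cut_def indicator_def)

lemma res_sum: "res0 t + t * res1 t = 1"
proof -
  have "res0 t + t * res1 t = (1 + t\<^sup>2) / (1 + t\<^sup>2)"
    unfolding res0_def res1_def add_divide_distrib by (simp add: power2_eq_square)
  then show ?thesis by simp
qed

context
  fixes f :: "real \<Rightarrow> real" assumes f [measurable]: "f \<in> borel_measurable borel"
begin

lemma cut_set: "{t. \<bar>f t\<bar> \<le> real n} \<in> sets borel"
proof -
  have "{t \<in> space borel. \<bar>f t\<bar> \<le> real n} \<in> sets borel" by measurable
  then show ?thesis by simp
qed

lemma bounded_borel_cut [simp]: "bounded_borel (level_cut f n)"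
  unfolding level_cut_def by (rule bounded_borel_indicator[OF cut_set])

lemma bounded_borel_mult_cut [simp]: "bounded_borel (\<lambda>t. f t * level_cut f n t)"
  using bounded_borel_measurable[OF bounded_borel_cut[of n]]
  by (intro bounded_borelI[OF _ abs_cut_mult]) simp

lemma bounded_borel_sq_cut [simp]: "bounded_borel (\<lambda>t. (f t)\<^sup>2 * level_cut f n t)"
proof -
  have "bounded_borel (\<lambda>t. (f t * level_cut f n t) * (f t * level_cut f n t))" by (intro bounded_borel_mult bounded_borel_mult_cut)
  moreover have "(f t * level_cut f n t) * (f t * level_cut f n t) = (f t)\<^sup>2 * level_cut f n t" for t
    using cut_idem[of f n t] by (simp add: power2_eq_square algebra_simps)
  ultimately show ?thesis by simp
qed

lemma bounded_borel_res_comp [simp]: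
  shows "bounded_borel (\<lambda>t. res0 (f t))" "bounded_borel (\<lambda>t. res1 (f t))"
    "bounded_borel (\<lambda>t. f t * res0 (f t))" "bounded_borel (\<lambda>t. f t * res1 (f t))"
proof -
  have [measurable]: "res0 \<in> borel_measurable borel" "res1 \<in> borel_measurable borel"
    by (rule bounded_borel_measurable, rule bounded_borel_res)+
  show "bounded_borel (\<lambda>t. res0 (f t))" "bounded_borel (\<lambda>t. res1 (f t))"
    by (rule bounded_borelI[of _ 1], measurable, simp add: res_bounds)+
  then show "bounded_borel (\<lambda>t. f t * res0 (f t))" by (simp add: res0_def res1_def)
  have "\<bar>f t * res1 (f t)\<bar> \<le> 1" for t
    using res_sum[of "f t"] res_bounds(1)[of "f t"] res_bounds(2)[of "f t"] by linarith
  then show "bounded_borel (\<lambda>t. f t * res1 (f t))"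
    by (intro bounded_borelI[of _ 1]) auto
qed

end

lemma res1_eq: "res1 t = t * res0 t"
  by (simp add: res0_def res1_def)

context pvm
begin

text \<open>If \<open>p(E) y = q(E) x\<close>, then also \<open>(p g)(E) y = (q g)(E) x\<close>: replace the test vector \<open>z\<close> by
\<open>E(B) z\<close> to obtain the case of an indicator \<open>g\<close>.\<close>

lemma form_bounded_mult:
  assumes eq: "\<And>z. z \<in> V \<Longrightarrow> form p y z = form q x z" and p: "bounded_borel p" and q: "bounded_borel q"
    and x: "x \<in> V" and y: "y \<in> V" and g: "bounded_borel g" and z: "z \<in> V"
  shows "form (\<lambda>t. p t * g t) y z = form (\<lambda>t. q t * g t) x z"
  using g
proof (induction rule: bounded_borel_induct)
  case (ind B)
  then show ?case using form_E[OF ind p y z] form_E[OF ind q x z] eq[of "E B z"] z by simp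
next
  case (add g h)
  then show ?case using p q x y z by (simp add: form_add distrib_left)
next
  case (scale c g)
  then show ?case using form_scale[of y z c "\<lambda>t. p t * g t"] form_scale[of x z c "\<lambda>t. q t * g t"] x y z
    by (simp add: mult.left_commute)
next
  case (lim F g K)
  have L: "(\<lambda>n. form (\<lambda>t. f t * F n t) x z) \<longlonglongrightarrow> form (\<lambda>t. f t * g t) x z"
    if f: "bounded_borel f" and x: "x \<in> V" for f x
  proof -
    obtain L where L: "L > 0" "\<And>t. \<bar>f t\<bar> \<le> L" using f bounded_borelE by blast
    show ?thesis
    proof (rule form_lim[of _ _ "L * K"])
      show "\<bar>f t * F n t\<bar> \<le> L * K" for n t
        unfolding abs_mult using L lim(3) by (intro mult_mono) auto
    qed (use lim f x z in \<open>auto intro!: tendsto_intros\<close>)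
  qed
  show ?case using L[OF p y] L[OF q x] unfolding lim(5) by (intro LIMSEQ_unique)
qed

lemma form_cut_lim:
  assumes f: "f \<in> borel_measurable borel" and g: "bounded_borel g" and x: "x \<in> V" and z: "z \<in> V"
  shows "(\<lambda>n. form (\<lambda>t. g t * level_cut f n t) x z) \<longlonglongrightarrow> form g x z"
proof -
  obtain K where K: "\<And>t. \<bar>g t\<bar> \<le> K" using bounded_borelE[OF g] by blast
  have "\<bar>g t * level_cut f n t\<bar> \<le> K" for n t by (rule abs_mult_cut) (rule K)
  then show ?thesis
    by (intro form_lim[where K = K] cut_tendsto x z g bounded_borel_mult bounded_borel_cut f)
qed

context
  fixes f :: "real \<Rightarrow> real" assumes f [measurable]: "f \<in> borel_measurable borel"
begin

text \<open>By monotone convergence, square integrability is boundedness of the integrals over the sets where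
\<open>\<bar>f\<bar> \<le> n\<close>. The integrands are bounded functions, so the algebra of the bounded calculus applies to
them.\<close>

lemma spectral_domain_iff:
  "x \<in> spectral_domain H E f \<longleftrightarrow> x \<in> V \<and> (\<exists>C. \<forall>n. (LINT t|\<mu> x. (f t)\<^sup>2 * level_cut f n t) \<le> C)"
proof (cases "x \<in> V")
  case x: True
  have sq_meas: "(\<lambda>t. (f t)\<^sup>2) \<in> borel_measurable (\<mu> x)" by (rule m_measurable[OF x]) measurable
  have int: "integrable (\<mu> x) (\<lambda>t. (f t)\<^sup>2 * level_cut f n t)" for n using x f by simp
  have "integrable (\<mu> x) (\<lambda>t. (f t)\<^sup>2) \<longleftrightarrow> (\<exists>C. \<forall>n. (LINT t|\<mu> x. (f t)\<^sup>2 * level_cut f n t) \<le> C)"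
  proof
    assume i: "integrable (\<mu> x) (\<lambda>t. (f t)\<^sup>2)"
    have "(LINT t|\<mu> x. (f t)\<^sup>2 * level_cut f n t) \<le> (LINT t|\<mu> x. (f t)\<^sup>2)" for n
      using cut_bounds by (intro integral_mono int i) (simp add: mult_left_le)
    then show "\<exists>C. \<forall>n. (LINT t|\<mu> x. (f t)\<^sup>2 * level_cut f n t) \<le> C" by blast
  next
    assume "\<exists>C. \<forall>n. (LINT t|\<mu> x. (f t)\<^sup>2 * level_cut f n t) \<le> C"
    then obtain C where C: "\<And>n. (LINT t|\<mu> x. (f t)\<^sup>2 * level_cut f n t) \<le> C" by blast
    have inc: "incseq (\<lambda>n. LINT t|\<mu> x. (f t)\<^sup>2 * level_cut f n t)"
      by (auto intro!: incseq_SucI integral_mono int mult_left_mono cut_mono)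
    then obtain l where l: "(\<lambda>n. LINT t|\<mu> x. (f t)\<^sup>2 * level_cut f n t) \<longlonglongrightarrow> l"
      using incseq_convergent[OF inc, of C] C by blast
    show "integrable (\<mu> x) (\<lambda>t. (f t)\<^sup>2)"
      by (rule integrable_monotone_convergence[OF int _ _ l sq_meas])
        (auto intro!: AE_I2 monoI mult_left_mono cut_mono cut_tendsto)
  qed
  then show ?thesis using x by (simp add: spectral_domain_def)
qed (simp add: spectral_domain_def)

lemma spectral_domain_mem: "x \<in> spectral_domain H E f \<Longrightarrow> x \<in> V"
  by (simp add: spectral_domain_iff)

lemma spectral_domain_scale:
  assumes x: "x \<in> spectral_domain H E f" shows "hscale H c x \<in> spectral_domain H E f"
proof -
  obtain C where C: "x \<in> V" "\<And>n. (LINT t|\<mu> x. (f t)\<^sup>2 * level_cut f n t) \<le> C" using x spectral_domain_iff by auto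
  have "(LINT t|\<mu> (hscale H c x). (f t)\<^sup>2 * level_cut f n t) = (cmod c)\<^sup>2 * (LINT t|\<mu> x. (f t)\<^sup>2 * level_cut f n t)" for n
  proof -
    let ?g = "\<lambda>t. (f t)\<^sup>2 * level_cut f n t"
    have "complex_of_real (LINT t|\<mu> (hscale H c x). ?g t) = c * cnj c * form ?g x x"
      using C f by (simp add: form_diag[symmetric])
    also have "\<dots> = complex_of_real ((cmod c)\<^sup>2 * (LINT t|\<mu> x. ?g t))"
      using C f by (simp add: form_diag complex_norm_square[of c, unfolded of_real_power])
    finally show ?thesis using of_real_eq_iff by blast
  qed
  then have "(LINT t|\<mu> (hscale H c x). (f t)\<^sup>2 * level_cut f n t) \<le> (cmod c)\<^sup>2 * C" for n
    using C by (simp add: mult_left_mono)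
  then show ?thesis unfolding spectral_domain_iff using C by auto
qed

lemma spectral_domain_add:
  assumes x: "x \<in> spectral_domain H E f" and y: "y \<in> spectral_domain H E f"
  shows "hadd H x y \<in> spectral_domain H E f"
proof -
  obtain C where C: "x \<in> V" "\<And>n. (LINT t|\<mu> x. (f t)\<^sup>2 * level_cut f n t) \<le> C" using x spectral_domain_iff by auto
  obtain D where D: "y \<in> V" "\<And>n. (LINT t|\<mu> y. (f t)\<^sup>2 * level_cut f n t) \<le> D" using y spectral_domain_iff by auto
  have "(LINT t|\<mu> (hadd H x y). (f t)\<^sup>2 * level_cut f n t) \<le> 2 * C + 2 * D" for n
  proof -
    let ?g = "\<lambda>t. (f t)\<^sup>2 * level_cut f n t"
    \<comment> \<open>The parallelogram law for the quadratic form of \<open>f\<^sup>2\<close> cut off at level \<open>n\<close>.\<close>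
    have "complex_of_real (LINT t|\<mu> (hadd H x y). ?g t) + complex_of_real (LINT t|\<mu> (hdiff H x y). ?g t)
        = 2 * form ?g x x + 2 * form ?g y y"
      using C D f by (simp add: form_diag[symmetric])
    also have "\<dots> = complex_of_real (2 * (LINT t|\<mu> x. ?g t) + 2 * (LINT t|\<mu> y. ?g t))"
      using C D f by (simp add: form_diag)
    finally have "(LINT t|\<mu> (hadd H x y). ?g t) + (LINT t|\<mu> (hdiff H x y). ?g t)
        = 2 * (LINT t|\<mu> x. ?g t) + 2 * (LINT t|\<mu> y. ?g t)"
      by (simp only: of_real_add[symmetric] of_real_eq_iff)
    moreover have "0 \<le> (LINT t|\<mu> (hdiff H x y). ?g t)" by (simp add: cut_bounds)
    ultimately show ?thesis using C(2)[of n] D(2)[of n] by linarith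
  qed
  then show ?thesis unfolding spectral_domain_iff using C D by auto
qed

lemma spectral_domain_E:
  assumes B: "B \<in> sets borel" "\<And>t. t \<in> B \<Longrightarrow> \<bar>f t\<bar> \<le> real N" and z: "z \<in> V"
  shows "E B z \<in> spectral_domain H E f"
  unfolding spectral_domain_iff
proof (intro conjI exI allI)
  show "E B z \<in> V" using B z by simp
  fix n
  let ?g = "\<lambda>t. (f t)\<^sup>2 * level_cut f n t"
  have bb: "bounded_borel (\<lambda>t. ?g t * indicator B t)" using f B(1) by simp
  have "hinner H (E B z) w = form (indicator B) z w" if "w \<in> V" for w
    using form_indicator B(1) z that by simp
  from form_mult[OF bounded_borel_indicator[OF B(1)] bounded_borel_sq_cut[OF f] z _ _ this, of "E B z" n]
  have "form ?g (E B z) (E B z) = form (\<lambda>t. indicator B t * ?g t) z (E B z)"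
    using B z by simp
  also have "\<dots> = form (\<lambda>t. indicator B t * ?g t * indicator B t) z z"
    by (rule form_E) (use f B z in auto)
  also have "(\<lambda>t. indicator B t * ?g t * indicator B t) = (\<lambda>t. ?g t * indicator B t)"
    by (auto simp: indicator_def)
  finally have "complex_of_real (LINT t|\<mu> (E B z). ?g t) = complex_of_real (LINT t|\<mu> z. ?g t * indicator B t)"
    using form_diag[OF bb z] form_diag[OF bounded_borel_sq_cut[OF f], of "E B z" n] B z by simp
  then have "(LINT t|\<mu> (E B z). ?g t) = (LINT t|\<mu> z. ?g t * indicator B t)" using of_real_eq_iff by blast
  also have "\<dots> \<le> (real N)\<^sup>2 * (hnorm H z)\<^sup>2"
  proof -
    have "\<bar>?g t * indicator B t\<bar> \<le> (real N)\<^sup>2" for t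
    proof (cases "t \<in> B")
      case True
      have "\<bar>f t\<bar>\<^sup>2 \<le> (real N)\<^sup>2" using B(2)[OF True] by (intro power_mono) auto
      then show ?thesis using abs_mult_cut[of "\<lambda>t. (f t)\<^sup>2" t "(real N)\<^sup>2" f n] True by simp
    qed simp
    from form_quadratic_bound[OF bb this z] show ?thesis by linarith
  qed
  finally show "(LINT t|\<mu> (E B z). ?g t) \<le> (real N)\<^sup>2 * (hnorm H z)\<^sup>2" .
qed

lemma sesq_integral_lim:
  assumes x: "x \<in> spectral_domain H E f" and z: "z \<in> spectral_domain H E f"
  shows "(\<lambda>n. form (\<lambda>t. f t * level_cut f n t) x z) \<longlonglongrightarrow> sesq_integral H E f x z"
proof -
  have L: "(\<lambda>n. LINT t|\<mu> w. f t * level_cut f n t) \<longlonglongrightarrow> (LINT t|\<mu> w. f t)" if w: "w \<in> spectral_domain H E f" for w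
  proof (rule integral_dominated_convergence[where w = "\<lambda>t. 1 + (f t)\<^sup>2"])
    have wV: "w \<in> V" using w spectral_domain_mem by blast
    show "f \<in> borel_measurable (\<mu> w)" by (rule m_measurable[OF wV f])
    show "(\<lambda>t. f t * level_cut f n t) \<in> borel_measurable (\<mu> w)" for n
      by (rule m_measurable[OF wV bounded_borel_measurable]) (simp add: f)
    show "integrable (\<mu> w) (\<lambda>t. 1 + (f t)\<^sup>2)"
      using w wV m_integrable[OF wV bounded_borel_const] by (auto simp: spectral_domain_def)
    show "AE t in \<mu> w. (\<lambda>n. f t * level_cut f n t) \<longlonglongrightarrow> f t" by (simp add: cut_tendsto)
    show "AE t in \<mu> w. norm (f t * level_cut f n t) \<le> 1 + (f t)\<^sup>2" for n
    proof (rule AE_I2)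
      fix t
      have "0 \<le> (\<bar>f t\<bar> - 1)\<^sup>2" by simp
      then have "\<bar>f t\<bar> \<le> 1 + (f t)\<^sup>2" unfolding power2_diff power2_abs using abs_ge_zero[of "f t"] by simp
      then show "norm (f t * level_cut f n t) \<le> 1 + (f t)\<^sup>2" using abs_mult_cut[of f t _ f n] by simp
    qed
  qed
  show ?thesis unfolding sesq_integral_def form_def
    by (intro tendsto_intros L spectral_domain_add spectral_domain_scale x z)
qed

text \<open>The definition of \<open>\<integral> f dE\<close> allows only test vectors from its domain. Every \<open>z\<close> can be brought there
by the projection \<open>E {t. \<bar>f t\<bar> \<le> N}\<close>, which turns into the cut-off under the integrals.\<close>

lemma spectral_integral_cut:
  assumes xy: "(x, y) \<in> spectral_integral H E f" and g: "bounded_borel g" and z: "z \<in> V"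
  shows "form (\<lambda>t. g t * level_cut f N t) y z = form (\<lambda>t. f t * level_cut f N t * g t) x z"
proof -
  have x: "x \<in> spectral_domain H E f" "x \<in> V" and y: "y \<in> V"
    and eq: "\<And>z. z \<in> spectral_domain H E f \<Longrightarrow> hinner H y z = sesq_integral H E f x z"
    using xy spectral_domain_mem by (auto simp: spectral_integral_def)
  let ?B = "{t. \<bar>f t\<bar> \<le> real N}"
  have B: "?B \<in> sets borel" by (rule cut_set[OF f])
  have "form (level_cut f N) y z = form (\<lambda>t. f t * level_cut f N t) x z" if z: "z \<in> V" for z
  proof -
    have D: "E ?B z \<in> spectral_domain H E f" by (rule spectral_domain_E[OF B _ z]) simp
    have "form (\<lambda>t. f t * level_cut f n t) x (E ?B z) = form (\<lambda>t. f t * level_cut f N t) x z" if n: "n \<ge> N" for n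
    proof -
      have "form (\<lambda>t. f t * level_cut f n t) x (E ?B z) = form (\<lambda>t. f t * level_cut f n t * indicator ?B t) x z"
        by (rule form_E) (use f B x z in auto)
      also have "(\<lambda>t. f t * level_cut f n t * indicator ?B t) = (\<lambda>t. f t * level_cut f N t)"
      proof
        fix t show "f t * level_cut f n t * indicator ?B t = f t * level_cut f N t"
          using n by (auto simp: level_cut_def indicator_def)
      qed
      finally show ?thesis .
    qed
    then have "(\<lambda>n. form (\<lambda>t. f t * level_cut f n t) x (E ?B z)) \<longlonglongrightarrow> form (\<lambda>t. f t * level_cut f N t) x z"
      by (intro tendsto_eventually eventually_sequentiallyI[of N])
    then have "sesq_integral H E f x (E ?B z) = form (\<lambda>t. f t * level_cut f N t) x z"
      using sesq_integral_lim[OF x(1) D] LIMSEQ_unique by blast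
    then show ?thesis using eq[OF D] form_indicator[OF B y z] E_sym[OF B y z] by (simp add: level_cut_def)
  qed
  from form_bounded_mult[OF this _ _ x(2) y g z]
  show ?thesis by (simp add: f mult.commute)
qed

theorem spectral_integral_mult:
  assumes xy: "(x, y) \<in> spectral_integral H E f" and g: "bounded_borel g" "bounded_borel (\<lambda>t. f t * g t)"
    and z: "z \<in> V"
  shows "form g y z = form (\<lambda>t. f t * g t) x z"
proof -
  have x: "x \<in> V" and y: "y \<in> V"
    using xy spectral_domain_mem by (auto simp: spectral_integral_def)
  have 1: "(\<lambda>n. form (\<lambda>t. g t * level_cut f n t) y z) \<longlonglongrightarrow> form g y z" by (rule form_cut_lim[OF f g(1) y z])
  have 2: "(\<lambda>n. form (\<lambda>t. f t * g t * level_cut f n t) x z) \<longlonglongrightarrow> form (\<lambda>t. f t * g t) x z"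
    by (rule form_cut_lim[OF f g(2) x z])
  have "form (\<lambda>t. g t * level_cut f n t) y z = form (\<lambda>t. f t * g t * level_cut f n t) x z" for n
    using spectral_integral_cut[OF xy g(1) z, of n] by (simp add: mult.assoc mult.commute[of "g _"])
  then show ?thesis using 1 2 LIMSEQ_unique by simp
qed

text \<open>The graph of \<open>\<integral> f dE\<close> is the kernel of \<open>(x, y) \<mapsto> res0(f)(E) y - res1(f)(E) x\<close>. This mentions
bounded functions only and all vectors as test vectors, and therefore makes the unbounded operator
accessible to limits, to linear algebra and to integration over \<open>\<zeta>\<close>.\<close>

theorem spectral_integral_iff:
  "(x, y) \<in> spectral_integral H E f \<longleftrightarrow> x \<in> V \<and> y \<in> V \<and>
     (\<forall>z\<in>V. form (\<lambda>t. res0 (f t)) y z = form (\<lambda>t. res1 (f t)) x z)"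
proof safe
  assume xy: "(x, y) \<in> spectral_integral H E f"
  then show "x \<in> V" "y \<in> V" using spectral_domain_mem by (auto simp: spectral_integral_def)
  show "form (\<lambda>t. res0 (f t)) y z = form (\<lambda>t. res1 (f t)) x z" if "z \<in> V" for z
    using spectral_integral_mult[OF xy, of "\<lambda>t. res0 (f t)" z] that f by (simp add: res1_eq)
next
  assume x: "x \<in> V" and y: "y \<in> V"
    and eq: "\<forall>z\<in>V. form (\<lambda>t. res0 (f t)) y z = form (\<lambda>t. res1 (f t)) x z"
  have key: "form (\<lambda>t. h t * level_cut f n t) y z = form (\<lambda>t. f t * level_cut f n t * h t) x z"
    if h: "bounded_borel h" and z: "z \<in> V" for h n z
  proof -
    \<comment> \<open>On the set where \<open>\<bar>f\<bar> \<le> n\<close> the denominators \<open>1 + f\<^sup>2\<close> of \<open>res0(f)\<close> and \<open>res1(f)\<close> can be cleared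
      by a bounded function.\<close>
    have g: "bounded_borel (\<lambda>t. (level_cut f n t + (f t)\<^sup>2 * level_cut f n t) * h t)" using f h by simp
    have "form (\<lambda>t. res0 (f t) * ((level_cut f n t + (f t)\<^sup>2 * level_cut f n t) * h t)) y z
      = form (\<lambda>t. res1 (f t) * ((level_cut f n t + (f t)\<^sup>2 * level_cut f n t) * h t)) x z"
      by (rule form_bounded_mult[OF _ _ _ x y g z]) (use f eq in auto)
    moreover have "res0 (f t) * ((level_cut f n t + (f t)\<^sup>2 * level_cut f n t) * h t) = h t * level_cut f n t" for t
    proof -
      have "res0 (f t) * ((level_cut f n t + (f t)\<^sup>2 * level_cut f n t) * h t) = res0 (f t) * (1 + (f t)\<^sup>2) * (h t * level_cut f n t)"
        by (simp add: algebra_simps)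
      then show ?thesis by (simp add: res0_def)
    qed
    moreover have "res1 (f t) * ((level_cut f n t + (f t)\<^sup>2 * level_cut f n t) * h t) = f t * level_cut f n t * h t" for t
    proof -
      have "res1 (f t) * ((level_cut f n t + (f t)\<^sup>2 * level_cut f n t) * h t) = res1 (f t) * (1 + (f t)\<^sup>2) * (h t * level_cut f n t)"
        by (simp add: algebra_simps)
      then show ?thesis by (simp add: res1_def)
    qed
    ultimately show ?thesis by simp
  qed
  have key1: "form (level_cut f n) y z = form (\<lambda>t. f t * level_cut f n t) x z" if z: "z \<in> V" for n z
    using key[OF bounded_borel_const z, of 1 n] by simp
  \<comment> \<open>Applied twice, the cut-off identity gives \<open>\<integral> f\<^sup>2 d\<langle>E x, x\<rangle> = \<langle>E y, y\<rangle>\<close> over the set where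
    \<open>\<bar>f\<bar> \<le> n\<close>, which is at most \<open>\<parallel>y\<parallel>\<^sup>2\<close>.\<close>
  have D: "x \<in> spectral_domain H E f" unfolding spectral_domain_iff
  proof (intro conjI x exI allI)
    fix n
    have "form (\<lambda>t. f t * level_cut f n t * level_cut f n t) y x = form (\<lambda>t. f t * level_cut f n t * (f t * level_cut f n t)) x x"
      by (rule key) (simp_all add: x f)
    moreover have "(\<lambda>t. f t * level_cut f n t * level_cut f n t) = (\<lambda>t. f t * level_cut f n t)" by (simp add: mult.assoc cut_idem)
    moreover have "(\<lambda>t. f t * level_cut f n t * (f t * level_cut f n t)) = (\<lambda>t. (f t)\<^sup>2 * level_cut f n t)"
    proof
      fix t show "f t * level_cut f n t * (f t * level_cut f n t) = (f t)\<^sup>2 * level_cut f n t"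
        using cut_idem[of f n t] by (simp add: power2_eq_square algebra_simps)
    qed
    ultimately have "form (\<lambda>t. (f t)\<^sup>2 * level_cut f n t) x x = form (\<lambda>t. f t * level_cut f n t) y x" by simp
    also have "\<dots> = cnj (form (\<lambda>t. f t * level_cut f n t) x y)" by (rule form_cnj) (use f x y in auto)
    also have "\<dots> = cnj (form (level_cut f n) y y)" using key1[OF y] by simp
    finally have "complex_of_real (LINT t|\<mu> x. (f t)\<^sup>2 * level_cut f n t) = complex_of_real (LINT t|\<mu> y. level_cut f n t)"
      using f x y by (simp add: form_diag)
    then have "(LINT t|\<mu> x. (f t)\<^sup>2 * level_cut f n t) = (LINT t|\<mu> y. level_cut f n t)" using of_real_eq_iff by blast
    also have "\<dots> \<le> 1 * (hnorm H y)\<^sup>2"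
      using form_quadratic_bound[OF bounded_borel_cut[OF f] abs_le_1_cut y, of n] by linarith
    finally show "(LINT t|\<mu> x. (f t)\<^sup>2 * level_cut f n t) \<le> 1 * (hnorm H y)\<^sup>2" .
  qed
  have "hinner H y z = sesq_integral H E f x z" if z: "z \<in> spectral_domain H E f" for z
  proof -
    have zV: "z \<in> V" using z spectral_domain_mem by blast
    have "(\<lambda>n. form (\<lambda>t. 1 * level_cut f n t) y z) \<longlonglongrightarrow> form (\<lambda>t. 1) y z"
      by (rule form_cut_lim[OF f bounded_borel_const y zV])
    then have "(\<lambda>n. form (\<lambda>t. f t * level_cut f n t) x z) \<longlonglongrightarrow> hinner H y z"
      using key1[OF zV] form_one[OF y zV] by simp
    then show ?thesis using sesq_integral_lim[OF D z] LIMSEQ_unique by blast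
  qed
  then show "(x, y) \<in> spectral_integral H E f" using D y by (simp add: spectral_integral_def)
qed

lemma spectral_integral_single_valued:
  assumes "(x, y) \<in> spectral_integral H E f" "(x, y') \<in> spectral_integral H E f"
  shows "y = y'"
proof (rule vec_eqI)
  show y: "y \<in> V" "y' \<in> V" using assms by (auto simp: spectral_integral_def)
  fix z assume z: "z \<in> V"
  have "form (level_cut f n) y z = form (level_cut f n) y' z" for n
    using spectral_integral_cut[OF assms(1) bounded_borel_const z, of 1 n]
      spectral_integral_cut[OF assms(2) bounded_borel_const z, of 1 n] by simp
  then have "(\<lambda>n. form (\<lambda>t. 1 * level_cut f n t) y z) \<longlonglongrightarrow> form (\<lambda>t. 1) y' z"
    using form_cut_lim[OF f bounded_borel_const[of 1] y(2) z] by simp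
  then have "form (\<lambda>t. 1) y z = form (\<lambda>t. 1) y' z"
    using form_cut_lim[OF f bounded_borel_const[of 1] y(1) z] LIMSEQ_unique by blast
  then show "hinner H y z = hinner H y' z" using form_one y z by simp
qed

end

end

lemma (in pvm) spectral_integral_linear:
  assumes f: "f \<in> borel_measurable borel"
  shows "linear_operator H (spectral_integral H E f)"
proof -
  have z0: "form g (hzero H) z = 0" if "bounded_borel g" "z \<in> V" for g z
    using form_addl[OF that(1), of "hzero H" "hzero H" z] vec_zero[of "hzero H"] that by simp
  have sub: "hsubspace (hsum H H) (spectral_integral H E f)"
    unfolding hsubspace_def
    by (auto simp: spectral_integral_iff[OF f] f z0)
  show ?thesis unfolding linear_operator_def
    using sub spectral_integral_single_valued[OF f] by (auto intro: single_valuedI)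
qed

lemma (in pvm) form_tendsto:
  assumes f: "bounded_borel f" and s: "\<And>n. s n \<in> V" and x: "x \<in> V" and z: "z \<in> V"
    and lim: "(\<lambda>n. hdist H (s n) x) \<longlonglongrightarrow> 0"
  shows "(\<lambda>n. form f (s n) z) \<longlonglongrightarrow> form f x z"
proof -
  obtain K where K: "K > 0" "\<And>t. \<bar>f t\<bar> \<le> K" using bounded_borelE[OF f] by blast
  have *: "cmod (form f (s n) z - form f x z) \<le> hdist H (s n) x * (2 * K * hnorm H z)" for n
    using form_bound[OF f K(2), of "hdiff H (s n) x" z] s[of n] x z f by (simp add: hdist_eq mult_ac)
  show ?thesis
    by (rule LIM_zero_cancel, rule Lim_null_comparison[OF _ tendsto_mult_left_zero[OF lim]],
      rule always_eventually, rule allI, rule *)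
qed

lemma (in pvm) spectral_integral_closed:
  assumes f: "f \<in> borel_measurable borel" and H: "hilbert_space H"
  shows "closed_operator H (spectral_integral H E f)"
proof -
  interpret S: hilbert_space "hsum H H" by (rule hilbert_space_hsum[OF H H])
  have "closedin (htopology (hsum H H)) (spectral_integral H E f)"
    unfolding S.closedin_iff_seq
  proof (intro conjI allI impI)
    show "spectral_integral H E f \<subseteq> hcarrier (hsum H H)"
      using spectral_integral_iff[OF f] by auto
    fix s p assume "range s \<subseteq> spectral_integral H E f \<and> p \<in> hcarrier (hsum H H) \<and> (\<lambda>n. hdist (hsum H H) (s n) p) \<longlonglongrightarrow> 0"
    then have s: "(fst (s n), snd (s n)) \<in> spectral_integral H E f" and p: "fst p \<in> V" "snd p \<in> V"
      and lim: "(\<lambda>n. hdist (hsum H H) (s n) p) \<longlonglongrightarrow> 0" for n by auto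
    have sV: "fst (s n) \<in> V" "snd (s n) \<in> V"
      and eq: "\<And>z. z \<in> V \<Longrightarrow> form (\<lambda>t. res0 (f t)) (snd (s n)) z = form (\<lambda>t. res1 (f t)) (fst (s n)) z" for n
      using s[of n] unfolding spectral_integral_iff[OF f] by auto
    have d: "(hdist (hsum H H) (s n) p)\<^sup>2 = (hdist H (fst (s n)) (fst p))\<^sup>2 + (hdist H (snd (s n)) (snd p))\<^sup>2" for n
      using sV[of n] p by (intro hsum_dist_sq inner_space_axioms) (auto simp: mem_Times_iff)
    have "hdist H (fst (s n)) (fst p) \<le> hdist (hsum H H) (s n) p" "hdist H (snd (s n)) (snd p) \<le> hdist (hsum H H) (s n) p" for n
      using d[of n] by (auto intro!: power2_le_imp_le[OF _ S.M.nonneg])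
    then have l: "(\<lambda>n. hdist H (fst (s n)) (fst p)) \<longlonglongrightarrow> 0" "(\<lambda>n. hdist H (snd (s n)) (snd p)) \<longlonglongrightarrow> 0"
      by (auto intro!: tendsto_sandwich[OF _ _ tendsto_const lim])
    have "form (\<lambda>t. res0 (f t)) (snd p) z = form (\<lambda>t. res1 (f t)) (fst p) z" if z: "z \<in> V" for z
    proof (rule LIMSEQ_unique)
      show "(\<lambda>n. form (\<lambda>t. res0 (f t)) (snd (s n)) z) \<longlonglongrightarrow> form (\<lambda>t. res0 (f t)) (snd p) z"
        by (rule form_tendsto[OF _ sV(2) p(2) z l(2)]) (simp add: f)
      show "(\<lambda>n. form (\<lambda>t. res0 (f t)) (snd (s n)) z) \<longlonglongrightarrow> form (\<lambda>t. res1 (f t)) (fst p) z"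
        unfolding eq[OF z] by (rule form_tendsto[OF _ sV(1) p(1) z l(1)]) (simp add: f)
    qed
    then have "(fst p, snd p) \<in> spectral_integral H E f" unfolding spectral_integral_iff[OF f] using p by blast
    then show "p \<in> spectral_integral H E f" by simp
  qed
  then show ?thesis unfolding closed_operator_def using spectral_integral_linear[OF f] by simp
qed

section \<open>Resolvents, uniqueness of the spectral measure, graph projections\<close>

text \<open>A symmetric operator \<open>T\<close> with \<open>1 + T\<^sup>2\<close> onto: \<open>C = 1 / (1 + T\<^sup>2)\<close> and \<open>S = T C\<close>. For closed operators
in Hilbert space this is self-adjointness, in a form that consists of identities between vectors and
can be checked fibrewise.\<close>

locale resolvent_operator = inner_space H for H :: "'v hspace" +
  fixes T :: "'v operator" and C S :: "'v \<Rightarrow> 'v"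
  assumes linear: "linear_operator H T"
    and symmetric: "\<And>x u y w. (x, u) \<in> T \<Longrightarrow> (y, w) \<in> T \<Longrightarrow> hinner H u y = hinner H x w"
    and CS: "\<And>h. h \<in> V \<Longrightarrow> (C h, S h) \<in> T"
    and SC: "\<And>h. h \<in> V \<Longrightarrow> (S h, hdiff H h (C h)) \<in> T"
begin

lemmas T_mem = linear_operator_mem[OF linear]
  and T_add = linear_operator_add[OF linear]
  and T_scale = linear_operator_scale[OF linear]
  and T_unique = linear_operator_unique[OF linear]

lemma C_mem [simp]: "h \<in> V \<Longrightarrow> C h \<in> V" and S_mem [simp]: "h \<in> V \<Longrightarrow> S h \<in> V"
  using CS T_mem by blast+

text \<open>The equation \<open>x + T (T x) = h\<close> has at most one solution: a difference \<open>d\<close> of two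
  solutions satisfies \<open>\<parallel>T d\<parallel>\<^sup>2 = - \<parallel>d\<parallel>\<^sup>2\<close>.\<close>

lemma resolvent_unique:
  assumes h: "h \<in> V" and xy: "(x, y) \<in> T" "(y, hdiff H h x) \<in> T"
  shows "x = C h" "y = S h"
proof -
  define d where "d = hdiff H x (C h)"
  define e where "e = hdiff H y (S h)"
  have mem: "x \<in> V" "y \<in> V" using xy T_mem by auto
  have de: "(d, e) \<in> T" unfolding d_def e_def by (intro T_add T_scale xy CS h)
  have "(e, hdiff H (hdiff H h x) (hdiff H h (C h))) \<in> T" unfolding e_def by (intro T_add T_scale xy SC h)
  moreover have "hdiff H (hdiff H h x) (hdiff H h (C h)) = hscale H (-1) d"
    by (rule vec_eqI) (use mem h in \<open>simp_all add: d_def algebra_simps\<close>)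
  ultimately have ed: "(e, hscale H (-1) d) \<in> T" by simp
  have V: "d \<in> V" "e \<in> V" using de T_mem by auto
  have "hinner H e e = - hinner H d d" using symmetric[OF de ed] V by simp
  then have "complex_of_real ((hnorm H e)\<^sup>2 + (hnorm H d)\<^sup>2) = 0" using V by (simp add: inner_self)
  then have "(hnorm H e)\<^sup>2 + (hnorm H d)\<^sup>2 = 0" using of_real_eq_0_iff by blast
  then have "hnorm H e = 0" "hnorm H d = 0" by (simp_all add: sum_power2_eq_zero_iff)
  then have "d = hzero H" "e = hzero H" using V by (simp_all add: hnorm_eq_0)
  then show "x = C h" "y = S h" using vec_eqI_diff mem h by (auto simp: d_def e_def)
qed

lemma CS_add:
  assumes "h \<in> V" "k \<in> V"
  shows C_add: "C (hadd H h k) = hadd H (C h) (C k)" and S_add: "S (hadd H h k) = hadd H (S h) (S k)"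
proof -
  have 1: "(hadd H (C h) (C k), hadd H (S h) (S k)) \<in> T" by (intro T_add CS assms)
  have "(hadd H (S h) (S k), hadd H (hdiff H h (C h)) (hdiff H k (C k))) \<in> T" by (intro T_add SC assms)
  moreover have "hadd H (hdiff H h (C h)) (hdiff H k (C k)) = hdiff H (hadd H h k) (hadd H (C h) (C k))"
    by (rule vec_eqI) (use assms in \<open>simp_all add: algebra_simps\<close>)
  ultimately have 2: "(hadd H (S h) (S k), hdiff H (hadd H h k) (hadd H (C h) (C k))) \<in> T" by simp
  show "C (hadd H h k) = hadd H (C h) (C k)" "S (hadd H h k) = hadd H (S h) (S k)"
    using resolvent_unique[OF _ 1 2] assms by simp_all
qed

lemma CS_scale:
  assumes "h \<in> V"
  shows C_scale: "C (hscale H c h) = hscale H c (C h)" and S_scale: "S (hscale H c h) = hscale H c (S h)"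
proof -
  have 1: "(hscale H c (C h), hscale H c (S h)) \<in> T" by (intro T_scale CS assms)
  have "(hscale H c (S h), hscale H c (hdiff H h (C h))) \<in> T" by (intro T_scale SC assms)
  moreover have "hscale H c (hdiff H h (C h)) = hdiff H (hscale H c h) (hscale H c (C h))"
    by (rule vec_eqI) (use assms in \<open>simp_all add: algebra_simps\<close>)
  ultimately have 2: "(hscale H c (S h), hdiff H (hscale H c h) (hscale H c (C h))) \<in> T" by simp
  show "C (hscale H c h) = hscale H c (C h)" "S (hscale H c h) = hscale H c (S h)"
    using resolvent_unique[OF _ 1 2] assms by simp_all
qed

lemma CS_commute:
  assumes "h \<in> V" shows "C (S h) = S (C h)" and "S (S h) = hdiff H (C h) (C (C h))"
proof -
  have 1: "(S (C h), hdiff H (C h) (C (C h))) \<in> T" using SC[of "C h"] assms by simp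
  have 2: "(hdiff H (C h) (C (C h)), hdiff H (S h) (S (C h))) \<in> T"
    using T_add[OF CS[of h] T_scale[OF CS[of "C h"], of "-1"]] assms by simp
  show "C (S h) = S (C h)" "S (S h) = hdiff H (C h) (C (C h))"
    using resolvent_unique[OF _ 1 2] assms by simp_all
qed

lemma C_inner: "h \<in> V \<Longrightarrow> k \<in> V \<Longrightarrow> hinner H (C h) k = hinner H (C h) (C k) + hinner H (S h) (S k)"
  using symmetric[OF CS[of h] SC[of k]] by simp

lemma C_sym: "h \<in> V \<Longrightarrow> k \<in> V \<Longrightarrow> hinner H (C h) k = hinner H h (C k)"
  using C_inner[of h k] C_inner[of k h] inner_sym[of h "C k"] inner_sym[of "C h" "C k"] inner_sym[of "S h" "S k"]
  by simp

lemma S_sym: "h \<in> V \<Longrightarrow> k \<in> V \<Longrightarrow> hinner H (S h) k = hinner H h (S k)"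
  using symmetric[OF SC[of h] SC[of k]] symmetric[OF CS[of h] CS[of k]] by simp

text \<open>So \<open>T\<close> is determined by \<open>C\<close> and \<open>S\<close>. For the converse direction,
\<open>(x, y) = (C x, S x) + (S y, y - C y)\<close> is a sum of two elements of \<open>T\<close>.\<close>

theorem T_iff: "(x, y) \<in> T \<longleftrightarrow> x \<in> V \<and> y \<in> V \<and> C y = S x"
proof safe
  assume xy: "(x, y) \<in> T"
  then show mem: "x \<in> V" "y \<in> V" using T_mem by auto
  show "C y = S x"
    by (rule vec_eqI) (use mem symmetric[OF xy CS] in \<open>simp_all add: C_sym S_sym\<close>)
next
  assume x: "x \<in> V" and y: "y \<in> V" and eq: "C y = S x"
  have "S y = hdiff H x (C x)" using SC[OF x] CS[OF y] eq T_unique by metis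
  then have "hadd H (C x) (S y) = x"
    using x y by (intro vec_eqI) simp_all
  moreover have "hadd H (S x) (hdiff H y (C y)) = y"
    by (rule vec_eqI) (use x y eq in simp_all)
  ultimately show "(x, y) \<in> T" using T_add[OF CS[OF x] SC[OF y]] by simp
qed

text \<open>Applied to the elements \<open>(C h, S h)\<close> and \<open>(S h, h - C h)\<close> of \<open>T = \<integral> t dE\<close>, multiplicativity gives two
linear relations between the forms at \<open>h\<close>, \<open>C h\<close> and \<open>S h\<close>; solved with \<open>res0 t + t res1 t = 1\<close> they
say that \<open>C = res0(E)\<close> and \<open>S = res1(E)\<close>.\<close>

lemma form_resolvent:
  assumes E: "pvm H E" and T: "spectral_integral H E (\<lambda>t. t) = T"
    and g: "bounded_borel g" and h: "h \<in> V" and z: "z \<in> V"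
  shows "sesq_integral H E (\<lambda>t. res0 t * g t) h z = sesq_integral H E g (C h) z"
    and "sesq_integral H E (\<lambda>t. res1 t * g t) h z = sesq_integral H E g (S h) z"
proof -
  interpret P: pvm H E by fact
  have id: "(\<lambda>t::real. t) \<in> borel_measurable borel" by simp
  have bb: "bounded_borel (\<lambda>t. t * res1 t)" "bounded_borel (\<lambda>t. t * res0 t)"
    using bounded_borel_res_comp(3,4)[OF id] by simp_all
  have bbg: "bounded_borel (\<lambda>t. res0 t * g t)" "bounded_borel (\<lambda>t. res1 t * g t)" using g by simp_all
  have bbt: "bounded_borel (\<lambda>t. t * (res0 t * g t))" "bounded_borel (\<lambda>t. t * (res1 t * g t))"
    using bounded_borel_mult[OF bb(2) g] bounded_borel_mult[OF bb(1) g] by (simp_all add: mult.assoc)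
  have A: "P.form p (S h) z = P.form (\<lambda>t. t * p t) (C h) z"
    if "bounded_borel p" "bounded_borel (\<lambda>t. t * p t)" for p
    using P.spectral_integral_mult[OF id _ that z, of "C h" "S h"] CS[OF h] T by simp
  have B: "P.form p (hdiff H h (C h)) z = P.form (\<lambda>t. t * p t) (S h) z"
    if "bounded_borel p" "bounded_borel (\<lambda>t. t * p t)" for p
    using P.spectral_integral_mult[OF id _ that z, of "S h" "hdiff H h (C h)"] SC[OF h] T by simp
  have t: "t * (res0 t * g t) = res1 t * g t" "res0 t * g t + t * (res1 t * g t) = g t" for t
  proof -
    show "t * (res0 t * g t) = res1 t * g t" by (simp add: res1_eq)
    have "res0 t * g t + t * (res1 t * g t) = (res0 t + t * res1 t) * g t" by (simp add: algebra_simps)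
    then show "res0 t * g t + t * (res1 t * g t) = g t" by (simp add: res_sum)
  qed
  have sum: "P.form g w z = P.form (\<lambda>t. res0 t * g t) w z + P.form (\<lambda>t. t * (res1 t * g t)) w z" if "w \<in> V" for w
    using P.form_add[OF bbg(1) bbt(2) that z] by (simp add: t(2))
  have "P.form (\<lambda>t. res0 t * g t) h z = P.form (\<lambda>t. res0 t * g t) (C h) z + P.form (\<lambda>t. res1 t * g t) (S h) z"
    using B[OF bbg(1) bbt(1)] h z bbg by (simp add: t(1) diff_eq_eq add.commute)
  then show "sesq_integral H E (\<lambda>t. res0 t * g t) h z = sesq_integral H E g (C h) z"
    using A[OF bbg(2) bbt(2)] sum[of "C h"] h by (simp add: P.sesq_integral_eq_form)
  have "P.form (\<lambda>t. res1 t * g t) h z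
      = P.form (\<lambda>t. res1 t * g t) (C h) z + P.form (\<lambda>t. t * (res1 t * g t)) (S h) z"
    using B[OF bbg(2) bbt(2)] h z bbg by (simp add: diff_eq_eq add.commute)
  then show "sesq_integral H E (\<lambda>t. res1 t * g t) h z = sesq_integral H E g (S h) z"
    using A[OF bbg(1) bbt(1)] sum[of "S h"] h by (simp add: P.sesq_integral_eq_form t(1))
qed

text \<open>By \<open>form_resolvent\<close>, the forms of two spectral measures of \<open>T\<close> transform in the same way under
multiplication of the function by \<open>res0\<close> and \<open>res1\<close>, and they agree for the constant 1.\<close>

theorem spectral_measure_unique:
  assumes E: "pvm H E" "spectral_integral H E (\<lambda>t. t) = T" and F: "pvm H F" "spectral_integral H F (\<lambda>t. t) = T"
  shows "E = F"
proof -
  interpret E: pvm H E by fact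
  interpret F: pvm H F by fact
  have eq: "\<forall>h\<in>V. \<forall>z\<in>V. E.form g h z = F.form g h z" if "bounded_borel g" for g
    using that
  proof (induction rule: bounded_borel_resolvent_induct)
    case one then show ?case by (simp add: E.form_one F.form_one)
  next
    case (add f g) then show ?case by (simp add: E.form_add F.form_add)
  next
    case (scale c f) then show ?case by (simp add: E.form_scale F.form_scale)
  next
    case (lim G g K)
    show ?case
    proof (intro ballI)
      fix h z assume hz: "h \<in> V" "z \<in> V"
      have "(\<lambda>n. E.form (G n) h z) \<longlonglongrightarrow> F.form g h z"
        using F.form_lim[OF lim(1-4) hz] lim(5) hz by simp
      then show "E.form g h z = F.form g h z" using E.form_lim[OF lim(1-4) hz] LIMSEQ_unique by blast
    qed
  next
    case (res0 g)
    then show ?case using form_resolvent(1)[OF E res0(1)] form_resolvent(1)[OF F res0(1)]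
      by (simp add: E.sesq_integral_eq_form F.sesq_integral_eq_form)
  next
    case (res1 g)
    then show ?case using form_resolvent(2)[OF E res1(1)] form_resolvent(2)[OF F res1(1)]
      by (simp add: E.sesq_integral_eq_form F.sesq_integral_eq_form)
  qed
  show ?thesis
  proof (rule PiE_ext)
    show "E \<in> sets borel \<rightarrow>\<^sub>E Collect (projection H)" using E.pvm unfolding projection_valued_measure_def by simp
    show "F \<in> sets borel \<rightarrow>\<^sub>E Collect (projection H)" using F.pvm unfolding projection_valued_measure_def by simp
    fix B :: "real set" assume B: "B \<in> sets borel"
    show "E B = F B"
    proof
      fix x
      show "E B x = F B x"
      proof (cases "x \<in> V")
        case True
        show ?thesis
          by (rule vec_eqI) (use True B eq[OF bounded_borel_indicator[OF B]] in
              \<open>simp_all add: E.form_indicator[symmetric] F.form_indicator[symmetric]\<close>)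
      next
        case False then show ?thesis using B by (simp add: E.E_extensional F.E_extensional)
      qed
    qed
  qed
qed

corollary spectral_measure_eqI:
  assumes "pvm H E" "spectral_integral H E (\<lambda>t. t) = T"
  shows "spectral_measure H T = E"
  unfolding spectral_measure_def
proof (rule the_equality)
  show "projection_valued_measure H E \<and> spectral_integral H E (\<lambda>t. t) = T"
    using assms pvm.pvm by blast
  show "F = E" if "projection_valued_measure H F \<and> spectral_integral H F (\<lambda>t. t) = T" for F
    using spectral_measure_unique[of F E] that assms inner_space_axioms
    by (auto simp: pvm_def pvm_axioms_def)
qed

end

locale hilbert_spectral_family = spectral_family H m + hilbert_space H
  for H :: "'v hspace" and m :: "'v \<Rightarrow> real measure"
begin

text \<open>The bounded operator with the form of \<open>f\<close>; it is \<open>f(E)\<close> for the measures \<open>\<langle>E(B) x, x\<rangle>\<close> of a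
projection-valued measure \<open>E\<close>.\<close>

definition calc :: "(real \<Rightarrow> real) \<Rightarrow> 'v \<Rightarrow> 'v" where
  "calc f = (\<lambda>x\<in>V. SOME y. y \<in> V \<and> (\<forall>z\<in>V. hinner H y z = form f x z))"

context fixes f assumes f: "bounded_borel f"
begin

lemma calc_props:
  assumes x: "x \<in> V" shows "calc f x \<in> V \<and> (\<forall>z\<in>V. hinner H (calc f x) z = form f x z)"
proof -
  obtain K where K: "\<And>t. \<bar>f t\<bar> \<le> K" using bounded_borelE[OF f] by blast
  have "\<exists>y\<in>V. \<forall>z\<in>V. form f z x = hinner H z y"
  proof (rule riesz)
    show "cmod (form f z x) \<le> (2 * K * hnorm H x) * hnorm H z" if "z \<in> V" for z
      using form_bound[OF f K that x] by (simp add: mult_ac)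
  qed (use f x in auto)
  then obtain y where y: "y \<in> V" "\<And>z. z \<in> V \<Longrightarrow> form f z x = hinner H z y" by blast
  have "hinner H y z = form f x z" if "z \<in> V" for z
    using y(2)[OF that] inner_sym[OF y(1) that] form_cnj[OF f that x] by simp
  then have "\<exists>y. y \<in> V \<and> (\<forall>z\<in>V. hinner H y z = form f x z)" using y by blast
  from someI_ex[OF this] show ?thesis using x by (simp add: calc_def)
qed

lemma calc_mem [simp]: "x \<in> V \<Longrightarrow> calc f x \<in> V"
  and calc_inner [simp]: "x \<in> V \<Longrightarrow> z \<in> V \<Longrightarrow> hinner H (calc f x) z = form f x z"
  using calc_props by auto

lemma calc_norm:
  assumes K: "\<And>t. \<bar>f t\<bar> \<le> K" and x: "x \<in> V"
  shows "hnorm H (calc f x) \<le> (2 * K) * hnorm H x"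
proof (cases "hnorm H (calc f x) = 0")
  case True
  have "0 \<le> K" using K[of 0] by linarith
  then show ?thesis using True x by simp
next
  case False
  have "complex_of_real ((hnorm H (calc f x))\<^sup>2) = form f x (calc f x)"
    using inner_self[OF calc_mem[OF x]] x by simp
  then have "cmod (form f x (calc f x)) = (hnorm H (calc f x))\<^sup>2" by (metis abs_power2 norm_of_real)
  then have "(hnorm H (calc f x))\<^sup>2 \<le> 2 * K * hnorm H x * hnorm H (calc f x)"
    using form_bound[OF f K x calc_mem[OF x]] by simp
  then show ?thesis using False x by (simp add: power2_eq_square less_le)
qed

lemma calc_bounded: "calc f \<in> bounded_operators H"
proof -
  obtain K where K: "\<And>t. \<bar>f t\<bar> \<le> K" using bounded_borelE[OF f] by blast
  have "hnorm H (calc f x) \<le> (2 * K) * hnorm H x" if "x \<in> V" for x by (rule calc_norm[OF K that])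
  moreover have "calc f (hadd H x y) = hadd H (calc f x) (calc f y)" if "x \<in> V" "y \<in> V" for x y
    by (rule vec_eqI) (use that f in simp_all)
  moreover have "calc f (hscale H c x) = hscale H c (calc f x)" if "x \<in> V" for x c
    by (rule vec_eqI) (use that f in simp_all)
  moreover have "calc f \<in> V \<rightarrow>\<^sub>E V"
    by (rule PiE_I) (simp, simp add: calc_def)
  ultimately show ?thesis unfolding bounded_operators_def by blast
qed

end

end

locale hilbert_pvm = pvm H E + hilbert_space H
  for H :: "'v hspace" and E :: "real set \<Rightarrow> 'v \<Rightarrow> 'v"
begin

sublocale hilbert_spectral_family H \<mu> ..

lemma form_calc: "bounded_borel f \<Longrightarrow> bounded_borel g \<Longrightarrow> x \<in> V \<Longrightarrow> z \<in> V \<Longrightarrow> form g (calc f x) z = form (\<lambda>t. f t * g t) x z"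
  by (rule form_mult) auto

text \<open>With \<open>u = res0(f)\<close>, \<open>v = res1(f)\<close> and \<open>w = f v\<close>, the projection is the matrix with rows \<open>u, v\<close> and
\<open>v, w\<close>, as for a scalar \<open>f\<close>: the line spanned by \<open>(1, f)\<close> has the projection
\<open>1 / (1 + f\<^sup>2)\<close> times the matrix with rows \<open>1, f\<close> and \<open>f, f\<^sup>2\<close>.\<close>

lemma graph_projection_spectral_integral:
  assumes f: "f \<in> borel_measurable borel" and a: "a \<in> V" and b: "b \<in> V"
  shows "graph_projection H (spectral_integral H E f) (a, b) =
    (hadd H (calc (\<lambda>t. res0 (f t)) a) (calc (\<lambda>t. res1 (f t)) b),
     hadd H (calc (\<lambda>t. res1 (f t)) a) (calc (\<lambda>t. f t * res1 (f t)) b))"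
proof -
  define u where "u = (\<lambda>t. res0 (f t))"
  define v where "v = (\<lambda>t. res1 (f t))"
  define w where "w = (\<lambda>t. f t * res1 (f t))"
  have bb [simp]: "bounded_borel u" "bounded_borel v" "bounded_borel w"
    using f by (simp_all add: u_def v_def w_def)
  have fu: "f t * u t = v t" and fv: "f t * v t = w t" and uw: "u t + w t = 1" for t
    using res_sum[of "f t"] by (simp_all add: u_def v_def w_def res1_eq)
  have bb': "bounded_borel (\<lambda>t. f t * u t)" "bounded_borel (\<lambda>t. f t * v t)" unfolding fu fv by auto
  let ?p = "hadd H (calc u a) (calc v b)" and ?q = "hadd H (calc v a) (calc w b)"
  let ?G = "spectral_integral H E f"
  have in_graph: "(?p, ?q) \<in> ?G"
  proof -
    have "form u ?q z = form v ?p z" if z: "z \<in> V" for z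
    proof -
      have vu: "v t * u t = u t * v t" for t by simp
      have wu: "w t * u t = v t * v t" for t by (metis fu fv mult.assoc mult.commute)
      show ?thesis using a b z by (simp add: form_calc vu wu)
    qed
    then show ?thesis using a b unfolding spectral_integral_iff[OF f] u_def[symmetric] v_def[symmetric]
      by simp
  qed
  have orth: "hinner H a x + hinner H b y = hinner H ?p x + hinner H ?q y" if xy: "(x, y) \<in> ?G" for x y
  proof -
    have mem: "x \<in> V" "y \<in> V" using xy unfolding spectral_integral_iff[OF f] by auto
    have 1: "form v y z = form w x z" and 2: "form u y z = form v x z" if "z \<in> V" for z
      using spectral_integral_mult[OF f xy _ bb'(2) that] spectral_integral_mult[OF f xy _ bb'(1) that]
      by (simp_all add: fu fv)
    have sum: "form u c z + form w c z = hinner H c z" if "c \<in> V" "z \<in> V" for c z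
      using form_add[OF bb(1,3) that] form_one[OF that] by (simp add: uw)
    have swap: "form v c y = form w c x" "form u c y = form v c x" if c: "c \<in> V" for c
    proof -
      show "form v c y = form w c x"
        using 1[OF c] form_cnj[OF bb(2) mem(2) c] form_cnj[OF bb(3) mem(1) c] by simp
      show "form u c y = form v c x"
        using 2[OF c] form_cnj[OF bb(1) mem(2) c] form_cnj[OF bb(2) mem(1) c] by simp
    qed
    show ?thesis using a b mem swap[OF a] swap[OF b]
      by (simp add: sum[OF a mem(1), symmetric] sum[OF b mem(2), symmetric] add_ac)
  qed
  interpret HH: inner_space "hsum H H" by (rule inner_space_hsum) unfold_locales
  have "hproj (hsum H H) ?G (a, b) = (?p, ?q)"
    by (rule HH.hproj_eqI) (use spectral_integral_linear[OF f] in_graph orth in \<open>auto simp: linear_operator_def\<close>)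
  then show ?thesis by (simp add: graph_projection_def u_def v_def w_def)
qed

end

section \<open>Trigonometric moments on the circle\<close>

lemma integral_cis:
  "(LINT t|lborel. indicator {0..2*pi} t *\<^sub>R cis (of_int k * t)) = (if k = 0 then 2 * pi else 0)"
proof (cases "k = 0")
  case True
  then show ?thesis by (simp add: integral_FTC_atLeastAtMost[of 0 "2*pi" "\<lambda>t. of_real t" "\<lambda>_. 1", simplified]
        has_vector_derivative_def scaleR_conv_of_real)
next
  case False
  have "(LINT t|lborel. indicator {0..2*pi} t *\<^sub>R cis (of_int k * t))
    = cis (of_int k * (2*pi)) / (\<i> * of_int k) - cis (of_int k * 0) / (\<i> * of_int k)"
  proof (rule integral_FTC_atLeastAtMost)
    show "continuous_on {0..2*pi} (\<lambda>t. cis (of_int k * t))"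
      by (intro continuous_intros)
    fix x :: real
    show "((\<lambda>t. cis (of_int k * t) / (\<i> * of_int k)) has_vector_derivative cis (of_int k * x)) (at x within {0..2*pi})"
    proof -
      have "((\<lambda>z. exp (\<i> * of_int k * z) / (\<i> * of_int k)) has_field_derivative exp (\<i> * of_int k * of_real x)) (at (of_real x))"
        using False by (auto intro!: derivative_eq_intros)
      from has_vector_derivative_real_field[OF this] show ?thesis
        unfolding cis_conv_exp by (simp add: mult.assoc)
    qed
  qed simp
  also have "cis (of_int k * (2*pi)) = 1"
    using cis_multiple_2pi[of "of_int k"] by (simp add: mult_ac)
  finally show ?thesis using False by simp
qed

text \<open>For a sequence extended to negative indices by \<open>a (- m) = cnj (a m)\<close>, the sum of
\<open>(N - \<bar>m\<bar>) a m cis (- m t)\<close> over \<open>\<bar>m\<bar> < N\<close>, that is, \<open>N\<close> times a Fejer mean. The weight 2 collects the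
indices \<open>m\<close> and \<open>- m\<close>.\<close>

definition fejer :: "(nat \<Rightarrow> complex) \<Rightarrow> nat \<Rightarrow> real \<Rightarrow> real" where
  "fejer a N t = Re (\<Sum>m<N. of_nat ((if m = 0 then 1 else 2) * (N - m)) * a m * cis (- (of_nat m * t)))"

lemma fejer_moment:
  "(LINT t|lborel. (indicator {0..2*pi} t * fejer a N t) *\<^sub>R cis (real n * t))
    = (if n < N then complex_of_real (2 * pi * real (N - n)) * (if n = 0 then of_real (Re (a 0)) else a n) else 0)"
proof -
  define c where "c m = of_nat ((if m = 0 then 1 else 2) * (N - m)) * a m" for m
  let ?I = "\<lambda>t::real. indicator {0..2*pi} t :: real"
  define G where "G k t = ?I t *\<^sub>R cis (of_int k * t)" for k :: int and t :: real
  have e: "(?I t * fejer a N t) *\<^sub>R cis (real n * t) =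
     (\<Sum>m<N. c m / 2 * G (int n - int m) t + cnj (c m) / 2 * G (int n + int m) t)" for t
  proof -
    have r: "complex_of_real (Re z) = (z + cnj z) / 2" for z by (simp add: complex_eq_iff)
    have 1: "cis (- (real m * t)) * cis (real n * t) = cis (of_int (int n - int m) * t)" for m
      by (simp add: cis_mult algebra_simps)
    have 2: "cis (real m * t) * cis (real n * t) = cis (of_int (int n + int m) * t)" for m
      by (simp add: cis_mult algebra_simps)
    have "complex_of_real (fejer a N t) * cis (real n * t)
      = (\<Sum>m<N. (c m * cis (- (real m * t)) + cnj (c m) * cis (real m * t)) / 2 * cis (real n * t))"
      unfolding fejer_def r by (simp add: c_def cis_cnj sum.distrib[symmetric] sum_divide_distrib sum_distrib_right)
    also have "\<dots> = (\<Sum>m<N. c m / 2 * cis (of_int (int n - int m) * t) + cnj (c m) / 2 * cis (of_int (int n + int m) * t))"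
      by (intro sum.cong refl) (simp only: 1[symmetric] 2[symmetric], simp add: field_simps)
    finally have "complex_of_real (?I t) * (complex_of_real (fejer a N t) * cis (real n * t)) =
       complex_of_real (?I t) * (\<Sum>m<N. c m / 2 * cis (of_int (int n - int m) * t) + cnj (c m) / 2 * cis (of_int (int n + int m) * t))"
      by simp
    then show ?thesis by (simp add: G_def scaleR_conv_of_real sum_distrib_left algebra_simps)
  qed
  have int: "integrable lborel (G k)" "(LINT t|lborel. G k t) = (if k = 0 then 2 * pi else 0)" for k
  proof -
    show "(LINT t|lborel. G k t) = (if k = 0 then 2 * pi else 0)" unfolding G_def by (rule integral_cis)
    show "integrable lborel (G k)" unfolding G_def[abs_def] by (intro borel_integrable_compact) (auto intro!: continuous_intros)
  qed
  have "(LINT t|lborel. (?I t * fejer a N t) *\<^sub>R cis (real n * t)) =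
    (\<Sum>m<N. c m / 2 * (if int n - int m = 0 then 2 * pi else 0) + cnj (c m) / 2 * (if int n + int m = 0 then 2 * pi else 0))"
    unfolding e by (simp add: Bochner_Integration.integral_sum Bochner_Integration.integral_add int)
  also have "\<dots> = (\<Sum>m<N. if m = n then pi * (if n = 0 then c m + cnj (c m) else c m) else 0)"
    by (intro sum.cong refl) (auto simp: algebra_simps)
  also have "\<dots> = (if n < N then pi * (if n = 0 then c n + cnj (c n) else c n) else 0)"
    by (simp add: sum.delta)
  also have "\<dots> = (if n < N then complex_of_real (2 * pi * real (N - n)) * (if n = 0 then of_real (Re (a 0)) else a n) else 0)"
    by (auto simp: c_def complex_eq_iff algebra_simps)
  finally show ?thesis .
qed

text \<open>The trigonometric moment problem, solved by the theorem of Herglotz: normalized Fejer sums are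
  densities of probability measures on \<open>[0, 2 \<pi>]\<close>, whose moments \<open>(1 - n / (N + 1)) a n\<close> tend to
  \<open>a n\<close>, and by Helly's selection theorem a subsequence converges weakly. The moments are values of
  the characteristic function at integers.\<close>

theorem herglotz:
  assumes a0: "a 0 = 1" and pos: "\<And>N t. 0 \<le> fejer a N t"
  obtains M where "real_distribution M" "\<And>n. char M (real n) = a n"
proof -
  define d where "d N t = indicator {0..2*pi} t * fejer a (Suc N) t / (2 * pi * real (Suc N))" for N t
  define M where "M N = density lborel (\<lambda>t. ennreal (d N t))" for N
  have d0: "0 \<le> d N t" for N t using pos by (simp add: d_def)
  have dm [measurable]: "d N \<in> borel_measurable borel" for N
    unfolding d_def[abs_def] fejer_def cis_conv_exp by measurable
  have moment: "(LINT t|M N. cis (real n * t)) = (if n \<le> N then of_real (1 - real n / real (Suc N)) * a n else 0)" for n N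
  proof -
    have "(LINT t|M N. cis (real n * t)) = (LINT t|lborel. d N t *\<^sub>R cis (real n * t))"
      unfolding M_def by (rule integral_density) (auto simp: d0 cis_conv_exp)
    also have "\<dots> = (LINT t|lborel. (1 / (2 * pi * real (Suc N))) *\<^sub>R ((indicator {0..2*pi} t * fejer a (Suc N) t) *\<^sub>R cis (real n * t)))"
      by (simp add: d_def)
    also have "\<dots> = (1 / (2 * pi * real (Suc N))) *\<^sub>R (if n < Suc N then complex_of_real (2 * pi * real (Suc N - n)) * (if n = 0 then of_real (Re (a 0)) else a n) else 0)"
      by (simp only: integral_scaleR_right fejer_moment)
    also have "\<dots> = (if n \<le> N then of_real (1 - real n / real (Suc N)) * a n else 0)"
      by (auto simp: a0 scaleR_conv_of_real field_simps of_nat_diff simp del: of_nat_Suc)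
    finally show ?thesis .
  qed
  have dint: "integrable lborel (d N)" for N
  proof -
    have "integrable lborel (\<lambda>t. indicator {0..2*pi} t *\<^sub>R (fejer a (Suc N) t / (2 * pi * real (Suc N))))"
      unfolding fejer_def cis_conv_exp
      by (intro borel_integrable_compact) (auto intro!: continuous_intros)
    then show ?thesis by (simp add: d_def[abs_def])
  qed
  have mass: "emeasure (M N) UNIV = 1" for N
  proof -
    have "complex_of_real (LINT t|lborel. d N t) = (LINT t|M N. cis (real 0 * t))"
    proof -
      have "(LINT t|M N. cis (real 0 * t)) = (LINT t|lborel. d N t *\<^sub>R cis (real 0 * t))"
        unfolding M_def by (rule integral_density) (auto simp: d0 cis_conv_exp)
      then show ?thesis by (simp add: scaleR_conv_of_real)
    qed
    then have "(LINT t|lborel. d N t) = 1" using moment[of N 0] a0 by simp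
    moreover have "emeasure (M N) UNIV = (\<integral>\<^sup>+t. ennreal (d N t) \<partial>lborel)"
      unfolding M_def by (subst emeasure_density) auto
    ultimately show ?thesis using nn_integral_eq_integral[OF dint[of N]] d0 by simp
  qed
  have rd: "real_distribution (M N)" for N
  proof -
    interpret prob_space "M N" by (rule prob_spaceI) (use mass in \<open>simp add: M_def\<close>)
    show ?thesis by unfold_locales (simp add: M_def)
  qed
  have supp: "measure (M N) {-1<..2*pi} = 1" for N
  proof -
    have "emeasure (M N) {-1<..2*pi} = (\<integral>\<^sup>+t. ennreal (d N t) * indicator {-1<..2*pi} t \<partial>lborel)"
      unfolding M_def by (subst emeasure_density) auto
    also have "\<dots> = (\<integral>\<^sup>+t. ennreal (d N t) * indicator UNIV t \<partial>lborel)"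
      by (intro nn_integral_cong) (auto simp: d_def indicator_def)
    also have "\<dots> = emeasure (M N) UNIV" unfolding M_def by (subst emeasure_density) auto
    finally show ?thesis using mass by (simp add: measure_def)
  qed
  have "tight M" unfolding tight_def
  proof (intro conjI allI impI rd)
    fix e :: real assume "e > 0"
    show "\<exists>a b. a < b \<and> (\<forall>n. 1 - e < measure (M n) {a<..b})"
    proof (intro exI conjI allI)
      show "-1 < 2 * pi" using pi_gt_zero by linarith
      show "1 - e < measure (M n) {-1<..2 * pi}" for n using supp \<open>e > 0\<close> by simp
    qed
  qed
  then obtain r M' where r: "strict_mono (r :: nat \<Rightarrow> nat)" "real_distribution M'" "weak_conv_m (M \<circ> id \<circ> r) M'"
    using tight_imp_convergent_subsubsequence[of M id] by (auto simp: strict_mono_def)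
  have "char M' (real n) = a n" for n
  proof (rule LIMSEQ_unique)
    show "(\<lambda>k. char (M (r k)) (real n)) \<longlonglongrightarrow> char M' (real n)"
      using levy_continuity1[of "M \<circ> id \<circ> r" M' "real n"] r rd by simp
    have ch: "char (M N) (real n) = (if n \<le> N then of_real (1 - real n / real (Suc N)) * a n else 0)" for N
      using moment[of N n] by (simp add: char_def cis_conv_exp)
    have "(\<lambda>N. of_real (1 - real n / real (Suc N)) * a n) \<longlonglongrightarrow> of_real (1 - 0) * a n"
      by (intro tendsto_intros) (use LIMSEQ_Suc[OF lim_const_over_n[of "real n"]] in simp)
    moreover have "\<forall>\<^sub>F N in sequentially. of_real (1 - real n / real (Suc N)) * a n = char (M N) (real n)"
      unfolding ch by (intro eventually_sequentiallyI[of n]) simp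
    ultimately have "(\<lambda>N. char (M N) (real n)) \<longlonglongrightarrow> a n"
      by (simp add: tendsto_cong)
    then show "(\<lambda>k. char (M (r k)) (real n)) \<longlonglongrightarrow> a n"
      using LIMSEQ_subseq_LIMSEQ[OF _ r(1)] by (simp add: o_def)
  qed
  then show ?thesis using that r(2) by blast
qed

text \<open>The Cesaro means of the powers of a point of the circle tend to 1 at the point 1 and to 0
  elsewhere, being averages of a geometric sum.\<close>

lemma cesaro_atom:
  assumes M: "real_distribution M"
  shows "(\<lambda>N. (\<Sum>n<N. char M (real n)) / of_nat N) \<longlonglongrightarrow> of_real (measure M {t. cis t = 1})"
proof -
  interpret real_distribution M by fact
  have set: "{t. cis t = 1} \<in> sets borel"
  proof -
    have "closed {t. cis t = 1}" by (intro closed_Collect_eq continuous_intros)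
    then show ?thesis by simp
  qed
  have lim: "(\<lambda>N. (\<Sum>n<N. cis (real n * t)) / of_nat N) \<longlonglongrightarrow> of_real (indicator {t. cis t = 1} t)" for t
  proof (cases "cis t = 1")
    case True
    have "cis (real n * t) = 1" for n using Complex.DeMoivre[of t n] True by simp
    then have "(\<Sum>n<N. cis (real n * t)) / of_nat N = 1" if "N \<ge> 1" for N using that by simp
    then show ?thesis using True
      by (intro tendsto_eventually eventually_sequentiallyI[of 1]) simp
  next
    case False
    have geo: "(\<Sum>n<N. cis (real n * t)) = (1 - cis t ^ N) / (1 - cis t)" for N
      using sum_gp_strict[of "cis t" N] False by (simp add: Complex.DeMoivre[symmetric])
    have "(\<lambda>N. (\<Sum>n<N. cis (real n * t)) / of_nat N) \<longlonglongrightarrow> 0"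
    proof (rule Lim_null_comparison)
      show "(\<lambda>N. (2 / cmod (1 - cis t)) / cmod (of_nat N)) \<longlonglongrightarrow> 0"
        unfolding norm_of_nat by (rule lim_const_over_n)
      have "cmod (1 - cis t ^ N) \<le> 2" for N
        using norm_triangle_ineq4[of 1 "cis t ^ N"] by (simp add: norm_power)
      then show "\<forall>\<^sub>F N in sequentially. cmod ((\<Sum>n<N. cis (real n * t)) / of_nat N) \<le> (2 / cmod (1 - cis t)) / cmod (of_nat N)"
        unfolding geo norm_divide by (intro always_eventually allI divide_right_mono) auto
    qed
    then show ?thesis using False by simp
  qed
  have "(\<lambda>N. LINT t|M. (\<Sum>n<N. cis (real n * t)) / of_nat N) \<longlonglongrightarrow> (LINT t|M. of_real (indicator {t. cis t = 1} t))"
  proof (rule integral_dominated_convergence[where w = "\<lambda>_. 1"])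
    show "AE t in M. cmod ((\<Sum>n<N. cis (real n * t)) / of_nat N) \<le> 1" for N
    proof (rule AE_I2)
      fix t
      have "cmod (\<Sum>n<N. cis (real n * t)) \<le> (\<Sum>n<N. 1)" by (rule sum_norm_le) simp
      then show "cmod ((\<Sum>n<N. cis (real n * t)) / of_nat N) \<le> 1" by (simp add: norm_divide divide_le_eq)
    qed
    show "(\<lambda>t. complex_of_real (indicator {t. cis t = 1} t)) \<in> borel_measurable M"
      using set by measurable
    show "(\<lambda>t. (\<Sum>n<N. cis (real n * t)) / of_nat N) \<in> borel_measurable M" for N
      unfolding cis_conv_exp by measurable
  qed (simp_all add: lim)
  moreover have "(LINT t|M. (\<Sum>n<N. cis (real n * t)) / of_nat N) = (\<Sum>n<N. char M (real n)) / of_nat N" for N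
  proof -
    have "integrable M (\<lambda>t. cis (real n * t))" for n
      unfolding cis_conv_exp by (rule integrable_const_bound[where B = 1]) auto
    then show ?thesis by (simp add: char_def cis_conv_exp)
  qed
  moreover have "(LINT t|M. complex_of_real (indicator {t. cis t = 1} t)) = of_real (measure M {t. cis t = 1})"
    using set by simp
  ultimately show ?thesis by (simp only:)
qed

text \<open>The negative cotangent of \<open>t / 2\<close>, which inverts the Cayley map. At \<open>cis t = 1\<close>, the image of the
point at infinity, it has the default value 0.\<close>

definition circle_to_line :: "real \<Rightarrow> real" where
  "circle_to_line t = - cos (t / 2) / sin (t / 2)"

lemma cayley_circle_to_line:
  assumes "cis t \<noteq> 1" shows "cayley (circle_to_line t) = cis t"
proof -
  let ?s = "sin (t/2)" and ?c = "cos (t/2)"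
  have cis: "cis t = Complex (?c\<^sup>2 - ?s\<^sup>2) (2 * ?s * ?c)"
    using cos_double[of "t/2"] sin_double[of "t/2"] by (simp add: complex_eq_iff)
  have sc: "?s * ?s + ?c * ?c = 1" using sin_cos_squared_add[of "t/2"] by (simp add: power2_eq_square)
  have s: "?s \<noteq> 0"
  proof
    assume "?s = 0"
    then have "cis t = 1" using cis sc by (simp add: complex_eq_iff power2_eq_square)
    then show False using assms by simp
  qed
  have q: "1 + (circle_to_line t)\<^sup>2 = 1 / ?s\<^sup>2"
  proof -
    have "1 + (circle_to_line t)\<^sup>2 = (?s\<^sup>2 + ?c\<^sup>2) / ?s\<^sup>2"
      using s unfolding add_divide_distrib by (simp add: circle_to_line_def power_divide)
    then show ?thesis by simp
  qed
  have "res0 (circle_to_line t) = ?s\<^sup>2" "res1 (circle_to_line t) = - ?c * ?s"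
    using s unfolding res0_def res1_def q by (simp_all add: circle_to_line_def power2_eq_square)
  then show ?thesis unfolding cayley_eq cis using sc by (simp add: complex_eq_iff power2_eq_square)
qed

lemma circle_to_line_measurable [measurable]: "circle_to_line \<in> borel_measurable borel"
  unfolding circle_to_line_def[abs_def] by measurable

section \<open>Scalar spectral measures from the Cayley transform\<close>

locale hilbert_resolvent = resolvent_operator H T C S + hilbert_space H
  for H :: "'v hspace" and T C S
begin

text \<open>The Cayley transform \<open>U = (T - \<i>) / (T + \<i>) = 1 - 2 C - 2 \<i> S\<close> is the case \<open>s = - 1\<close>, its inverse
  and adjoint \<open>1 - 2 C + 2 \<i> S\<close> the case \<open>s = 1\<close>.\<close>

definition cayley_op :: "complex \<Rightarrow> 'v \<Rightarrow> 'v" where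
  "cayley_op s h = hadd H h (hadd H (hscale H (- 2) (C h)) (hscale H (s * (2 * \<i>)) (S h)))"

lemma cayley_op_mem [simp]: "h \<in> V \<Longrightarrow> cayley_op s h \<in> V"
  by (simp add: cayley_op_def)

lemma cayley_op_add: "h \<in> V \<Longrightarrow> k \<in> V \<Longrightarrow> cayley_op s (hadd H h k) = hadd H (cayley_op s h) (cayley_op s k)"
  by (rule vec_eqI) (simp_all add: cayley_op_def C_add S_add algebra_simps)

lemma cayley_op_scale: "h \<in> V \<Longrightarrow> cayley_op s (hscale H c h) = hscale H c (cayley_op s h)"
  by (rule vec_eqI) (simp_all add: cayley_op_def C_scale S_scale algebra_simps)

lemma cayley_op_inverse: "h \<in> V \<Longrightarrow> s * s = 1 \<Longrightarrow> cayley_op s (cayley_op (- s) h) = h"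
proof (rule vec_eqI)
  fix z assume h: "h \<in> V" and s: "s * s = 1" and z: "z \<in> V"
  have "hinner H (cayley_op s (cayley_op (- s) h)) z = hinner H h z + (4 - 4 * (s * s)) * (hinner H (C (C h)) z - hinner H (C h) z)"
    using h z by (simp add: cayley_op_def C_add S_add C_scale S_scale CS_commute algebra_simps)
  then show "hinner H (cayley_op s (cayley_op (- s) h)) z = hinner H h z" using s by simp
qed simp_all

lemma cayley_op_adjoint: "h \<in> V \<Longrightarrow> k \<in> V \<Longrightarrow> cnj s = s \<Longrightarrow> hinner H (cayley_op s h) k = hinner H h (cayley_op (- s) k)"
  by (simp add: cayley_op_def C_sym S_sym)

definition cayley_zpow :: "int \<Rightarrow> 'v \<Rightarrow> 'v" where
  "cayley_zpow n = (if n \<ge> 0 then (cayley_op (- 1)) ^^ (nat n) else (cayley_op 1) ^^ (nat (- n)))"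

lemma cayley_op_power_mem [simp]: "h \<in> V \<Longrightarrow> (cayley_op s ^^ n) h \<in> V"
  by (induction n) auto

lemma cayley_zpow_mem [simp]: "h \<in> V \<Longrightarrow> cayley_zpow n h \<in> V"
  by (simp add: cayley_zpow_def)

lemma cayley_op_power_add: "h \<in> V \<Longrightarrow> k \<in> V \<Longrightarrow> (cayley_op s ^^ n) (hadd H h k) = hadd H ((cayley_op s ^^ n) h) ((cayley_op s ^^ n) k)"
  by (induction n) (simp_all add: cayley_op_add)

lemma cayley_op_power_scale: "h \<in> V \<Longrightarrow> (cayley_op s ^^ n) (hscale H c h) = hscale H c ((cayley_op s ^^ n) h)"
  by (induction n) (simp_all add: cayley_op_scale)

lemma cayley_zpow_add: "h \<in> V \<Longrightarrow> k \<in> V \<Longrightarrow> cayley_zpow n (hadd H h k) = hadd H (cayley_zpow n h) (cayley_zpow n k)"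
  and cayley_zpow_scale: "h \<in> V \<Longrightarrow> cayley_zpow n (hscale H c h) = hscale H c (cayley_zpow n h)"
  by (simp_all add: cayley_zpow_def cayley_op_power_add cayley_op_power_scale)

lemma cayley_zpow_0 [simp]: "cayley_zpow 0 h = h"
  by (simp add: cayley_zpow_def)

lemma cayley_zpow_Suc: "h \<in> V \<Longrightarrow> cayley_zpow (n + 1) h = cayley_op (- 1) (cayley_zpow n h)"
proof (cases "n \<ge> 0")
  case True
  then have "nat (n + 1) = Suc (nat n)" by simp
  then show ?thesis using True by (simp add: cayley_zpow_def)
next
  case False
  assume h: "h \<in> V"
  obtain k where k: "nat (- n) = Suc k" using False by (cases "nat (- n)") auto
  have "cayley_op (- 1) (cayley_zpow n h) = (cayley_op 1 ^^ k) h"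
    using False k cayley_op_inverse[of "(cayley_op 1 ^^ k) h" "- 1"] h by (simp add: cayley_zpow_def)
  moreover have "cayley_zpow (n + 1) h = (cayley_op 1 ^^ k) h"
  proof (cases "n = - 1")
    case True then show ?thesis using k by (simp add: cayley_zpow_def)
  next
    case F: False
    then have "nat (- (n + 1)) = k" "\<not> n + 1 \<ge> 0" using False k by auto
    then show ?thesis by (simp add: cayley_zpow_def del: minus_add_distrib)
  qed
  ultimately show ?thesis by simp
qed

lemma cayley_zpow_pred: "h \<in> V \<Longrightarrow> cayley_zpow (n - 1) h = cayley_op 1 (cayley_zpow n h)"
  using cayley_zpow_Suc[of h "n - 1"] cayley_op_inverse[of "cayley_zpow (n - 1) h" 1] by simp

lemma cayley_op_power_adjoint:
  "h \<in> V \<Longrightarrow> k \<in> V \<Longrightarrow> cnj s = s \<Longrightarrow> hinner H ((cayley_op s ^^ n) h) k = hinner H h ((cayley_op (- s) ^^ n) k)"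
proof (induction n arbitrary: k)
  case (Suc n)
  have "hinner H ((cayley_op s ^^ Suc n) h) k = hinner H ((cayley_op s ^^ n) h) (cayley_op (- s) k)"
    using Suc.prems by (simp add: cayley_op_adjoint)
  also have "\<dots> = hinner H h ((cayley_op (- s) ^^ n) (cayley_op (- s) k))" using Suc by simp
  finally show ?case by (simp add: funpow_swap1)
qed simp

lemma cayley_zpow_adjoint: "h \<in> V \<Longrightarrow> k \<in> V \<Longrightarrow> hinner H (cayley_zpow n h) k = hinner H h (cayley_zpow (- n) k)"
  using cayley_op_power_adjoint[of h k "- 1" "nat n"] cayley_op_power_adjoint[of h k 1 "nat (- n)"]
  by (auto simp: cayley_zpow_def)

text \<open>The operator counterparts of \<open>res0_trig\<close> and \<open>res1_trig\<close>.\<close>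

lemma C_cayley_zpow: "x \<in> V \<Longrightarrow> z \<in> V \<Longrightarrow> hinner H (cayley_zpow n x) (C z) =
    (1/2) * hinner H (cayley_zpow n x) z - (1/4) * hinner H (cayley_zpow (n + 1) x) z - (1/4) * hinner H (cayley_zpow (n - 1) x) z"
  by (simp only: cayley_zpow_Suc cayley_zpow_pred) (simp add: cayley_op_def C_sym algebra_simps)

lemma S_cayley_zpow: "x \<in> V \<Longrightarrow> z \<in> V \<Longrightarrow> hinner H (cayley_zpow n x) (S z) =
    (\<i>/4) * hinner H (cayley_zpow (n + 1) x) z - (\<i>/4) * hinner H (cayley_zpow (n - 1) x) z"
  by (simp only: cayley_zpow_Suc cayley_zpow_pred) (simp add: cayley_op_def S_sym algebra_simps)

lemma cayley_op_norm: "x \<in> V \<Longrightarrow> hnorm H (cayley_op (- 1) x) = hnorm H x"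
  using cayley_op_adjoint[of x "cayley_op (- 1) x" "- 1"] cayley_op_inverse[of x 1] by (simp add: hnorm_def)

text \<open>With \<open>q = cis (- t)\<close> and \<open>v n\<close> the sum of \<open>q\<^sup>k U\<^sup>k x\<close> over \<open>k < n\<close>, the Fejer sum is \<open>\<parallel>v N\<parallel>\<^sup>2\<close>: in the
double sum for the norm the exponent \<open>m\<close> occurs \<open>N - \<bar>m\<bar>\<close> times. The proof counts by induction,
along the recursion \<open>v (n + 1) = x + q U (v n)\<close>.\<close>

lemma fejer_nonneg:
  assumes x: "x \<in> V" shows "0 \<le> fejer (\<lambda>n. hinner H (cayley_zpow (int n) x) x) N t"
proof -
  define q where "q = cis (- t)"
  define b where "b m = q ^ m * hinner H (cayley_zpow (int m) x) x" for m
  define v where "v = rec_nat (hzero H) (\<lambda>_ w. hadd H x (hscale H q (cayley_op (- 1) w)))"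
  have v0: "v 0 = hzero H" and vS: "v (Suc n) = hadd H x (hscale H q (cayley_op (- 1) (v n)))" for n
    by (simp_all add: v_def)
  have vV [simp]: "v n \<in> V" for n by (induction n) (simp_all add: v0 vS x)
  have qq: "cmod q = 1" by (simp add: q_def)
  have c1: "q ^ j * hinner H ((cayley_op (- 1) ^^ j) (v n)) x = (\<Sum>k<n. b (k + j))" for n j
  proof (induction n arbitrary: j)
    case 0
    have "(cayley_op (- 1) ^^ j) (hzero H) = hscale H 0 ((cayley_op (- 1) ^^ j) x)"
      using cayley_op_power_scale[where h = x and s = "- 1" and n = j and c = 0] x vec_eqI[of "hzero H" "hscale H 0 x"] by simp
    then show ?case using x by (simp add: v0)
  next
    case (Suc n)
    have "q ^ j * hinner H ((cayley_op (- 1) ^^ j) (v (Suc n))) x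
        = b j + q ^ Suc j * hinner H ((cayley_op (- 1) ^^ Suc j) (v n)) x"
      using x by (simp add: vS cayley_op_power_add cayley_op_power_scale b_def cayley_zpow_def funpow_swap1 algebra_simps)
    also have "\<dots> = b (0 + j) + (\<Sum>k<n. b (Suc k + j))" using Suc[of "Suc j"] by simp
    also have "\<dots> = (\<Sum>k<Suc n. b (k + j))" by (rule sum.lessThan_Suc_shift[symmetric])
    finally show ?case .
  qed
  define w :: "nat \<Rightarrow> nat" where "w m = (if m = 0 then 1 else 2)" for m
  have wS: "(\<Sum>m<Suc n. real (w m) * Re (b m)) = Re (b 0) + 2 * Re (\<Sum>k<n. b (k + 1))" for n
    by (simp only: sum.lessThan_Suc_shift) (simp add: w_def sum_distrib_left)
  have c2: "(hnorm H (v n))\<^sup>2 = (\<Sum>m<n. real (w m * (n - m)) * Re (b m))" for n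
  proof (induction n)
    case 0 then show ?case by (simp add: v0)
  next
    case (Suc n)
    have "(hnorm H (v (Suc n)))\<^sup>2 = (hnorm H x)\<^sup>2 + 2 * Re (hinner H (hscale H q (cayley_op (- 1) (v n))) x) + (hnorm H (v n))\<^sup>2"
      using x inner_sym[of x "cayley_op (- 1) (v n)"] by (simp add: vS hnorm_sq_add hnorm_scale qq cayley_op_norm)
    also have "hinner H (hscale H q (cayley_op (- 1) (v n))) x = (\<Sum>k<n. b (k + 1))"
      using c1[of 1 n] x by simp
    also have "(hnorm H x)\<^sup>2 = Re (b 0)" using x by (simp add: b_def hnorm_sq)
    finally have "(hnorm H (v (Suc n)))\<^sup>2 = (\<Sum>m<Suc n. real (w m) * Re (b m)) + (\<Sum>m<n. real (w m * (n - m)) * Re (b m))"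
      using wS[of n] Suc by simp
    also have "(\<Sum>m<n. real (w m * (n - m)) * Re (b m)) = (\<Sum>m<Suc n. real (w m * (n - m)) * Re (b m))" by simp
    also have "(\<Sum>m<Suc n. real (w m) * Re (b m)) + \<dots> = (\<Sum>m<Suc n. real (w m * (Suc n - m)) * Re (b m))"
      unfolding sum.distrib[symmetric]
    proof (intro sum.cong refl)
      fix m assume "m \<in> {..<Suc n}"
      then have "w m * (Suc n - m) = w m + w m * (n - m)" by (simp add: Suc_diff_le)
      then show "real (w m) * Re (b m) + real (w m * (n - m)) * Re (b m) = real (w m * (Suc n - m)) * Re (b m)"
        by (simp only: of_nat_add distrib_right)
    qed
    finally show ?case .
  qed
  have "fejer (\<lambda>n. hinner H (cayley_zpow (int n) x) x) N t = (\<Sum>m<N. real (w m * (N - m)) * Re (b m))"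
  proof -
    have "q ^ m = cis (- (real m * t))" for m by (simp add: q_def Complex.DeMoivre)
    then have "of_nat (w m * (N - m)) * hinner H (cayley_zpow (int m) x) x * cis (- (real m * t)) = of_nat (w m * (N - m)) * b m" for m
      by (simp add: b_def)
    then show ?thesis unfolding fejer_def w_def[symmetric] by (simp only: Re_sum) simp
  qed
  also have "\<dots> = (hnorm H (v N))\<^sup>2" using c2 by simp
  finally show ?thesis by simp
qed

text \<open>A vector \<open>y\<close> orthogonal to the range of \<open>1 - U\<close> satisfies \<open>C y = \<i> S y\<close>; as \<open>\<langle>C y, S y\<rangle>\<close> is real,
both vectors vanish, and \<open>(S y, y - C y) \<in> T\<close> forces \<open>y = 0\<close>.\<close>

lemma range_dense:
  assumes x: "x \<in> V" and e: "e > 0"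
  shows "\<exists>w\<in>V. hdist H x (hdiff H w (cayley_op (- 1) w)) < e"
proof -
  define R where "R = (\<lambda>w. hdiff H w (cayley_op (- 1) w)) ` V"
  have sub: "hsubspace H R" unfolding hsubspace_def
  proof (intro conjI ballI allI)
    show "R \<subseteq> V" by (auto simp: R_def)
    show "hzero H \<in> R" unfolding R_def
    proof (rule image_eqI)
      have "hscale H 0 (hzero H) = hzero H" by (rule vec_eqI) simp_all
      then have "cayley_op (- 1) (hzero H) = hscale H 0 (cayley_op (- 1) (hzero H))"
        using cayley_op_scale[of "hzero H" "- 1" 0] by simp
      then have "hinner H (cayley_op (- 1) (hzero H)) z = 0" if "z \<in> V" for z
        using inner_scalel[of "cayley_op (- 1) (hzero H)" z 0] that by (metis cayley_op_mem mult_zero_left zero_mem)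
      then show "hzero H = hdiff H (hzero H) (cayley_op (- 1) (hzero H))" by (intro vec_eqI) simp_all
    qed simp
    fix x y assume "x \<in> R" "y \<in> R"
    then obtain a b where ab: "a \<in> V" "b \<in> V" "x = hdiff H a (cayley_op (- 1) a)" "y = hdiff H b (cayley_op (- 1) b)"
      by (auto simp: R_def)
    have "hadd H x y = hdiff H (hadd H a b) (cayley_op (- 1) (hadd H a b))"
      by (rule vec_eqI) (use ab in \<open>simp_all add: cayley_op_add algebra_simps\<close>)
    then show "hadd H x y \<in> R" using ab by (auto simp: R_def)
  next
    fix c x assume "x \<in> R"
    then obtain a where a: "a \<in> V" "x = hdiff H a (cayley_op (- 1) a)" by (auto simp: R_def)
    have "hscale H c x = hdiff H (hscale H c a) (cayley_op (- 1) (hscale H c a))"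
      by (rule vec_eqI) (use a in \<open>simp_all add: cayley_op_scale algebra_simps\<close>)
    then show "hscale H c x \<in> R" using a by (auto simp: R_def)
  qed
  have "y = hzero H" if y: "y \<in> V" and orth: "\<And>u. u \<in> R \<Longrightarrow> hinner H y u = 0" for y
  proof -
    have "hinner H (hdiff H y (cayley_op 1 y)) w = 0" if w: "w \<in> V" for w
    proof -
      have "hdiff H w (cayley_op (- 1) w) \<in> R" using w by (auto simp: R_def)
      from orth[OF this] show ?thesis using y w cayley_op_adjoint[of y w 1] by simp
    qed
    then have eq: "hinner H (C y) w = \<i> * hinner H (S y) w" if w: "w \<in> V" for w
      using y w by (simp add: cayley_op_def)
    have "hinner H (C y) (S y) = hinner H (S y) (C y)"
      using symmetric[OF CS[OF y] CS[OF y]] by simp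
    then have "Im (hinner H (C y) (S y)) = 0"
      using inner_sym[of "C y" "S y"] y by (metis C_mem S_mem cnj.simps(2) equal_neg_zero)
    then have "hnorm H (S y) = 0" using eq[of "S y"] y by (simp add: inner_self)
    then have S0: "S y = hzero H" using y by (simp add: hnorm_eq_0)
    then have C0: "C y = hzero H"
      using eq y by (intro vec_eqI) simp_all
    have "(hzero H, hdiff H y (hzero H)) \<in> T" "(hzero H, hzero H) \<in> T"
      using SC[OF y] CS[OF y] by (simp_all add: S0 C0)
    then have "hdiff H y (hzero H) = hzero H" using T_unique by blast
    then show ?thesis using vec_eqI_diff[of y "hzero H"] y by simp
  qed
  then obtain r where "r \<in> R" "hdist H x r < e"
    using dense_if_trivial_complement[OF sub _ x e] by blast
  then show ?thesis by (auto simp: R_def)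
qed

text \<open>The mean ergodic theorem for \<open>U\<close>, which has no nonzero fixed vector: the sums telescope on the range
of \<open>1 - U\<close>, and this range is dense.\<close>

lemma cesaro_moments:
  assumes x: "x \<in> V"
  shows "(\<lambda>N. (\<Sum>n<N. hinner H (cayley_zpow (int n) x) x) / of_nat N) \<longlonglongrightarrow> 0"
proof (rule LIMSEQ_I)
  fix e :: real assume e: "e > 0"
  define d where "d = e / (2 * (hnorm H x + 1))"
  have nx: "hnorm H x + 1 > 0" using x by (simp add: add_nonneg_pos)
  have d: "d > 0" using e nx by (simp add: d_def)
  obtain w where w: "w \<in> V" "hdist H x (hdiff H w (cayley_op (- 1) w)) < d" using range_dense[OF x d] by blast
  define y where "y = hdiff H w (cayley_op (- 1) w)"
  have y: "y \<in> V" using w by (simp add: y_def)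
  have norm_u: "hnorm H (cayley_zpow (int n) h) = hnorm H h" if "h \<in> V" for n h
  proof (induction n)
    case (Suc n)
    have "cayley_zpow (int (Suc n)) h = cayley_op (- 1) (cayley_zpow (int n) h)" using cayley_zpow_Suc[of h "int n"] that by (simp add: add.commute)
    then show ?case using Suc that by (simp add: cayley_op_norm)
  qed simp
  have tele: "(\<Sum>n<N. hinner H (cayley_zpow (int n) y) x) = hinner H w x - hinner H (cayley_zpow (int N) w) x" for N
  proof (induction N)
    case (Suc N)
    have "cayley_zpow (int N) (cayley_op (- 1) w) = cayley_zpow (int (Suc N)) w"
      using w by (simp add: cayley_zpow_def funpow_swap1 nat_add_distrib)
    then have "hinner H (cayley_zpow (int N) y) x = hinner H (cayley_zpow (int N) w) x - hinner H (cayley_zpow (int (Suc N)) w) x"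
      using w x by (simp add: y_def cayley_zpow_add cayley_zpow_scale)
    then show ?case using Suc by simp
  qed simp
  have bound: "cmod (\<Sum>n<N. hinner H (cayley_zpow (int n) x) x) \<le> real N * (d * hnorm H x) + 2 * hnorm H w * hnorm H x" for N
  proof -
    have split: "hinner H (cayley_zpow (int n) x) x = hinner H (cayley_zpow (int n) (hdiff H x y)) x + hinner H (cayley_zpow (int n) y) x" for n
      using x y by (simp add: cayley_zpow_add cayley_zpow_scale)
    have "cmod (hinner H (cayley_zpow (int n) (hdiff H x y)) x) \<le> d * hnorm H x" for n
    proof -
      have "cmod (hinner H (cayley_zpow (int n) (hdiff H x y)) x) \<le> hnorm H (cayley_zpow (int n) (hdiff H x y)) * hnorm H x"
        by (rule cauchy_schwarz) (use x y in auto)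
      also have "\<dots> \<le> d * hnorm H x"
        using w(2) x y by (intro mult_right_mono) (simp_all add: norm_u hdist_eq y_def)
      finally show ?thesis .
    qed
    then have "cmod (\<Sum>n<N. hinner H (cayley_zpow (int n) (hdiff H x y)) x) \<le> (\<Sum>n<N. d * hnorm H x)"
      by (intro sum_norm_le)
    moreover have "cmod (hinner H w x - hinner H (cayley_zpow (int N) w) x) \<le> 2 * hnorm H w * hnorm H x"
      using norm_triangle_ineq4[of "hinner H w x" "hinner H (cayley_zpow (int N) w) x"]
        cauchy_schwarz[OF w(1) x] cauchy_schwarz[of "cayley_zpow (int N) w" x] w(1) x by (simp add: norm_u)
    ultimately show ?thesis unfolding split sum.distrib tele
      by (intro norm_triangle_mono) simp_all
  qed
  obtain K where K: "2 * (2 * hnorm H w * hnorm H x) / e < real K" using reals_Archimedean2 by blast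
  show "\<exists>n0. \<forall>N\<ge>n0. norm ((\<Sum>n<N. hinner H (cayley_zpow (int n) x) x) / of_nat N - 0) < e"
  proof (intro exI[of _ "Suc K"] allI impI)
    fix N assume N: "N \<ge> Suc K"
    have "d * hnorm H x \<le> e / 2" using e nx x by (simp add: d_def field_simps)
    then have 1: "real N * (d * hnorm H x) \<le> real N * (e / 2)" by (intro mult_left_mono) auto
    have "2 * hnorm H w * hnorm H x < real K * (e / 2)" using K e by (simp add: field_simps)
    also have "\<dots> \<le> real N * (e / 2)" using N e by (intro mult_right_mono) auto
    finally have "cmod (\<Sum>n<N. hinner H (cayley_zpow (int n) x) x) < real N * e" using bound[of N] 1 by linarith
    then show "norm ((\<Sum>n<N. hinner H (cayley_zpow (int n) x) x) / of_nat N - 0) < e"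
      using N by (simp add: norm_divide divide_less_eq mult.commute)
  qed
qed

text \<open>The moments \<open>\<langle>U\<^sup>n x, x\<rangle>\<close> belong to a measure on the circle. By comparison of Cesaro means it
  does not charge the point 1, so it can be moved to the line. The theorem of Herglotz is stated for
  probability measures; hence the passage to the unit vector \<open>y\<close>.\<close>

lemma moment_measure:
  assumes x: "x \<in> V"
  shows "\<exists>m. finite_measure m \<and> sets m = sets (borel :: real measure) \<and>
    (\<forall>a n. (LINT t|m. trig a n t) = Re (a * hinner H (cayley_zpow n x) x))"
proof (cases "hnorm H x = 0")
  case True
  then have "x = hzero H" using x by (simp add: hnorm_eq_0)
  then have "hinner H (cayley_zpow n x) x = 0" for n using x by simp
  moreover have "finite_measure (null_measure borel)" by (simp add: finite_measureI)
  ultimately show ?thesis by (intro exI[of _ "null_measure borel"]) simp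
next
  case False
  define r where "r = hnorm H x"
  have r: "r > 0" using False x by (simp add: r_def less_le)
  define y where "y = hscale H (of_real (1 / r)) x"
  have y: "y \<in> V" using x by (simp add: y_def)
  have yy: "hinner H (cayley_zpow n y) y = of_real (1 / r\<^sup>2) * hinner H (cayley_zpow n x) x" for n
    using x by (simp add: y_def cayley_zpow_scale power2_eq_square)
  define a where "a n = hinner H (cayley_zpow (int n) y) y" for n
  have a0: "a 0 = 1" using r x by (simp add: a_def yy[of 0, simplified] inner_self r_def)
  have "0 \<le> fejer a N t" for N t
    using fejer_nonneg[OF y, of N t] by (simp add: a_def[abs_def])
  then obtain M where M: "real_distribution M" "\<And>n. char M (real n) = a n"
    using herglotz[of a] a0 by blast
  interpret M: real_distribution M by fact
  have "complex_of_real (measure M {t. cis t = 1}) = 0"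
    by (rule LIMSEQ_unique[OF cesaro_atom[OF M(1)]]) (use cesaro_moments[OF y] in \<open>simp add: M(2) a_def\<close>)
  then have "measure M {t. cis t = 1} = 0" by simp
  moreover have set: "{t. cis t = 1} \<in> sets M"
  proof -
    have "closed {t. cis t = 1}" by (intro closed_Collect_eq continuous_intros)
    then show ?thesis by simp
  qed
  ultimately have "AE t in M. t \<notin> {t. cis t = 1}"
    using M.prob_eq_0 by simp
  then have ae: "AE t in M. cayley (circle_to_line t) = cis t"
    by eventually_elim (use cayley_circle_to_line in auto)
  define m where "m = density (distr M borel circle_to_line) (\<lambda>_. ennreal (r\<^sup>2))"
  have ctl: "circle_to_line \<in> borel_measurable M" by simp
  interpret D: prob_space "distr M borel circle_to_line" by (rule M.prob_space_distr[OF ctl])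
  have fin: "finite_measure m"
    by (rule finite_measureI) (simp add: m_def emeasure_density D.emeasure_space_1[simplified] ennreal_mult_eq_top_iff)
  have int: "(LINT t|m. trig b n t) = r\<^sup>2 * (LINT t|M. Re (b * cis (of_int n * t)))" for b n
  proof -
    have tm: "trig b n \<in> borel_measurable borel" by (rule bounded_borel_measurable) simp
    have "(LINT t|m. trig b n t) = (LINT t|distr M borel circle_to_line. r\<^sup>2 *\<^sub>R trig b n t)"
      unfolding m_def by (rule integral_density) (use tm in auto)
    also have "\<dots> = r\<^sup>2 * (LINT t|M. trig b n (circle_to_line t))"
      by (simp add: integral_distr[OF ctl tm])
    also have "(LINT t|M. trig b n (circle_to_line t)) = (LINT t|M. Re (b * cis (of_int n * t)))"
    proof (rule integral_cong_AE)
      show "(\<lambda>t. trig b n (circle_to_line t)) \<in> borel_measurable M"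
        using measurable_compose[OF ctl tm] .
      show "(\<lambda>t. Re (b * cis (of_int n * t))) \<in> borel_measurable M"
        unfolding cis_conv_exp by measurable
      show "AE t in M. trig b n (circle_to_line t) = Re (b * cis (of_int n * t))"
        using ae by eventually_elim (simp add: trig_def cis_power_int)
    qed
    finally show ?thesis .
  qed
  have bint: "integrable M (\<lambda>t. b * cis (of_int n * t))" for b n
    unfolding cis_conv_exp by (rule M.integrable_const_bound[where B = "cmod b"]) (auto simp: norm_mult)
  have "(LINT t|m. trig b n t) = Re (b * hinner H (cayley_zpow n x) x)" for b n
  proof (cases "n \<ge> 0")
    case True
    have "(LINT t|M. Re (b * cis (of_int n * t))) = Re (LINT t|M. b * cis (of_int n * t))"
      by (rule integral_Re[OF bint])
    also have "\<dots> = Re (b * char M (real (nat n)))" using True by (simp add: char_def cis_conv_exp)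
    also have "\<dots> = Re (b * hinner H (cayley_zpow n y) y)" using M(2)[of "nat n"] True by (simp add: a_def)
    finally show ?thesis using r by (simp add: int yy field_simps)
  next
    case False
    have "Re (b * cis (of_int n * t)) = Re (cnj b * cis (of_int (- n) * t))" for t by simp
    then have "(LINT t|M. Re (b * cis (of_int n * t))) = (LINT t|M. Re (cnj b * cis (of_int (- n) * t)))" by presburger
    also have "\<dots> = Re (LINT t|M. cnj b * cis (of_int (- n) * t))"
      by (rule integral_Re[OF bint])
    also have "\<dots> = Re (cnj b * char M (real (nat (- n))))" using False by (simp add: char_def cis_conv_exp)
    also have "\<dots> = Re (cnj b * hinner H (cayley_zpow (- n) y) y)" using M(2)[of "nat (- n)"] False by (simp add: a_def)
    also have "\<dots> = Re (b * hinner H (cayley_zpow n y) y)"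
      using cayley_zpow_adjoint[OF y y, of n] inner_sym[of y "cayley_zpow (- n) y"] y by simp
    finally show ?thesis using r by (simp add: int yy field_simps)
  qed
  then show ?thesis using fin by (intro exI[of _ m]) (simp add: m_def)
qed

end

section \<open>Existence of the spectral measure\<close>

context hilbert_resolvent
begin

definition scalar :: "'v \<Rightarrow> real measure" where
  "scalar x = (SOME m. finite_measure m \<and> sets m = sets (borel :: real measure) \<and>
    (\<forall>a n. (LINT t|m. trig a n t) = Re (a * hinner H (cayley_zpow n x) x)))"

lemma scalar:
  assumes "x \<in> V"
  shows "finite_measure (scalar x)" "sets (scalar x) = sets borel"
    "(LINT t|scalar x. trig a n t) = Re (a * hinner H (cayley_zpow n x) x)"
  using someI_ex[OF moment_measure[OF assms]] unfolding scalar_def[symmetric] by auto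

sublocale S: measure_family H scalar
  by (intro measure_family.intro measure_family_axioms.intro inner_space_axioms scalar)

lemma form_trig:
  assumes x: "x \<in> V" and z: "z \<in> V"
  shows "S.form (trig a n) x z = (a/2) * hinner H (cayley_zpow n x) z + (cnj a/2) * hinner H (cayley_zpow (- n) x) z"
proof -
  define A where "A x = hadd H (hscale H (a/2) (cayley_zpow n x)) (hscale H (cnj a/2) (cayley_zpow (- n) x))" for x
  have "complex_of_real (LINT t|scalar w. trig a n t) = hinner H (A w) w" if w: "w \<in> V" for w
  proof -
    have "hinner H (cayley_zpow (- n) w) w = cnj (hinner H (cayley_zpow n w) w)"
      using cayley_zpow_adjoint[OF w w, of n] inner_sym[of w "cayley_zpow (- n) w"] w by simp
    then have "hinner H (A w) w = (a * hinner H (cayley_zpow n w) w + cnj (a * hinner H (cayley_zpow n w) w)) / 2"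
      using w by (simp add: A_def field_simps)
    then show ?thesis using w by (simp add: scalar complex_eq_iff)
  qed
  then have "S.form (trig a n) x z = (1 / 4) * (\<Sum>k<4. \<i> ^ k *
      hinner H (A (hadd H x (hscale H (\<i> ^ k) z))) (hadd H x (hscale H (\<i> ^ k) z)))"
    unfolding S.form_def using x z by simp
  also have "\<dots> = hinner H (A x) z"
  proof (rule polarization[OF _ _ _ x z])
    show "A (hadd H x y) = hadd H (A x) (A y)" if "x \<in> V" "y \<in> V" for x y
      by (rule vec_eqI) (use that in \<open>simp_all add: A_def cayley_zpow_add algebra_simps\<close>)
    show "A (hscale H c x) = hscale H c (A x)" if "x \<in> V" for x c
      by (rule vec_eqI) (use that in \<open>simp_all add: A_def cayley_zpow_scale algebra_simps\<close>)
  qed (simp add: A_def)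
  finally show ?thesis using x z by (simp add: A_def)
qed

lemma cayley_zpow_cnj: "x \<in> V \<Longrightarrow> z \<in> V \<Longrightarrow> cnj (hinner H (cayley_zpow n x) z) = hinner H (cayley_zpow (- n) z) x"
  using cayley_zpow_adjoint[of z x "- n"] inner_sym[of z "cayley_zpow n x"] by simp

text \<open>The measures were chosen independently for each vector. Their polarized integrals nevertheless form
Hermitian forms, because those of the trigonometric polynomials are given by powers of the Cayley
transform, and the trigonometric polynomials generate the bounded Borel functions.\<close>

sublocale S: hilbert_spectral_family H scalar
proof (intro hilbert_spectral_family.intro spectral_family.intro spectral_family_axioms.intro
    S.measure_family_axioms hilbert_space_axioms)
  fix f assume "bounded_borel f"
  then show "S.hermitian_form f"
  proof (induction rule: bounded_borel_trig_induct)
    case (trig a n)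
    have "complex_of_real (LINT t|scalar x. trig a n t) = S.form (trig a n) x x" if x: "x \<in> V" for x
    proof -
      have "S.form (trig a n) x x = (a * hinner H (cayley_zpow n x) x + cnj (a * hinner H (cayley_zpow n x) x)) / 2"
        using cayley_zpow_cnj[OF x x, of n] x by (simp add: form_trig field_simps)
      also have "\<dots> = complex_of_real (Re (a * hinner H (cayley_zpow n x) x))" unfolding complex_add_cnj by simp
      finally show ?thesis using x by (simp only: scalar)
    qed
    then show ?case unfolding S.hermitian_form_def
      by (simp add: form_trig cayley_zpow_add cayley_zpow_scale cayley_zpow_cnj algebra_simps)
  qed (use S.hermitian_form_add S.hermitian_form_scale S.hermitian_form_lim in blast)+
next
  fix x z assume "x \<in> V" "z \<in> V"
  moreover have "trig 1 0 = (\<lambda>_. 1)" by (auto simp: trig_def)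
  ultimately show "S.form (\<lambda>_. 1) x z = hinner H x z" using form_trig[of x z 1 0] by simp
qed

text \<open>The function multiplies, the operator acts on the second argument. In \<open>form_spectral_projection\<close> this
allows the first argument to be kept fixed, and multiplicativity follows by induction over \<open>f\<close>.\<close>

lemma form_res:
  assumes f: "bounded_borel f" and x: "x \<in> V" and z: "z \<in> V"
  shows form_res0: "S.form (\<lambda>t. res0 t * f t) x z = S.form f x (C z)"
    and form_res1: "S.form (\<lambda>t. res1 t * f t) x z = S.form f x (S z)"
proof -
  have e: "- n - 1 = - (n + 1)" "- n + 1 = - (n - 1)" for n :: int by simp_all
  have flim: "(\<lambda>n. S.form (\<lambda>t. p t * F n t) x z) \<longlonglongrightarrow> S.form (\<lambda>t. p t * f t) x z"
    if p: "bounded_borel p" "\<And>t. \<bar>p t\<bar> \<le> 1"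
      and F: "\<And>n. bounded_borel (F n)" "bounded_borel f" "\<And>n t. \<bar>F n t\<bar> \<le> K" "\<And>t. (\<lambda>n. F n t) \<longlonglongrightarrow> f t"
    for p F K and f :: "real \<Rightarrow> real"
  proof (rule S.form_lim[of _ _ "1 * K"])
    show "\<bar>p t * F n t\<bar> \<le> 1 * K" for n t unfolding abs_mult using p F(3) by (intro mult_mono) auto
  qed (use p F x z in \<open>auto intro!: tendsto_intros\<close>)
  show "S.form (\<lambda>t. res0 t * f t) x z = S.form f x (C z)" using f
  proof (induction rule: bounded_borel_trig_induct)
    case (trig a n)
    have "S.form (\<lambda>t. res0 t * trig a n t) x z
       = S.form (\<lambda>t. 1/2 * trig a n t + ((-1/4) * trig a (n + 1) t + (-1/4) * trig a (n - 1) t)) x z"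
      by (rule arg_cong[where f = "\<lambda>f. S.form f x z"], rule ext) (unfold res0_trig, simp)
    also have "\<dots> = of_real (1/2) * S.form (trig a n) x z
        + (of_real (-1/4) * S.form (trig a (n + 1)) x z + of_real (-1/4) * S.form (trig a (n - 1)) x z)"
      by (simp only: S.form_add S.form_scale bounded_borel_add bounded_borel_mult bounded_borel_const trig_bounded_borel x z)
    also have "\<dots> = S.form (trig a n) x (C z)"
      unfolding form_trig[OF x z] form_trig[OF x C_mem[OF z]] C_cayley_zpow[OF x z, of n] C_cayley_zpow[OF x z, of "- n", unfolded e]
      by (simp add: algebra_simps)
    finally show ?case .
  next
    case (add f g) then show ?case using x z by (simp add: S.form_add distrib_left)
  next
    case (scale c f) then show ?case using S.form_scale[of x z c "\<lambda>t. res0 t * f t"] x z by (simp add: S.form_scale mult.left_commute)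
  next
    case (lim F f K)
    show ?case using S.form_lim[OF lim(1-4) x C_mem[OF z]] flim[OF bounded_borel_res(1) res_bounds(2) lim(1-4)]
      unfolding lim(5) by (intro LIMSEQ_unique)
  qed
  show "S.form (\<lambda>t. res1 t * f t) x z = S.form f x (S z)" using f
  proof (induction rule: bounded_borel_trig_induct)
    case (trig a n)
    have "S.form (\<lambda>t. res1 t * trig a n t) x z
       = S.form (\<lambda>t. 1/4 * trig (a * \<i>) (n + 1) t + 1/4 * trig (- (a * \<i>)) (n - 1) t) x z"
      by (rule arg_cong[where f = "\<lambda>f. S.form f x z"], rule ext) (unfold res1_trig, simp)
    also have "\<dots> = of_real (1/4) * S.form (trig (a * \<i>) (n + 1)) x z + of_real (1/4) * S.form (trig (- (a * \<i>)) (n - 1)) x z"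
      by (simp only: S.form_add S.form_scale bounded_borel_mult bounded_borel_const trig_bounded_borel x z)
    also have "\<dots> = S.form (trig a n) x (S z)"
      unfolding form_trig[OF x z] form_trig[OF x S_mem[OF z]] S_cayley_zpow[OF x z, of n] S_cayley_zpow[OF x z, of "- n", unfolded e]
      by (simp add: algebra_simps)
    finally show ?case .
  next
    case (add f g) then show ?case using x z by (simp add: S.form_add distrib_left)
  next
    case (scale c f) then show ?case using S.form_scale[of x z c "\<lambda>t. res1 t * f t"] x z by (simp add: S.form_scale mult.left_commute)
  next
    case (lim F f K)
    show ?case using S.form_lim[OF lim(1-4) x S_mem[OF z]] flim[OF bounded_borel_res(2) res_bounds(3) lim(1-4)]
      unfolding lim(5) by (intro LIMSEQ_unique)
  qed
qed

definition spectral_projection :: "real set \<Rightarrow> 'v \<Rightarrow> 'v" where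
  "spectral_projection = (\<lambda>B\<in>sets borel. S.calc (indicator B))"

lemma spectral_projection_mem [simp]: "B \<in> sets borel \<Longrightarrow> x \<in> V \<Longrightarrow> spectral_projection B x \<in> V"
  and spectral_projection_inner: "B \<in> sets borel \<Longrightarrow> x \<in> V \<Longrightarrow> z \<in> V \<Longrightarrow> hinner H (spectral_projection B x) z = S.form (indicator B) x z"
  by (simp_all add: spectral_projection_def)

lemma form_spectral_projection:
  assumes B: "B \<in> sets borel" and f: "bounded_borel f" and x: "x \<in> V" and z: "z \<in> V"
  shows "S.form f (spectral_projection B x) z = S.form (\<lambda>t. f t * indicator B t) x z"
proof -
  have "\<forall>z\<in>V. S.form f (spectral_projection B x) z = S.form (\<lambda>t. f t * indicator B t) x z" using f
  proof (induction rule: bounded_borel_resolvent_induct)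
    case one then show ?case using B x by (simp add: S.form_one spectral_projection_inner)
  next
    case (add f g) then show ?case using B x by (simp add: S.form_add distrib_right)
  next
    case (scale c f) then show ?case using B x by (simp add: S.form_scale mult.assoc)
  next
    case (lim F f K)
    show ?case
    proof
      fix z assume z: "z \<in> V"
      have "(\<lambda>n. S.form (\<lambda>t. F n t * indicator B t) x z) \<longlonglongrightarrow> S.form (\<lambda>t. f t * indicator B t) x z"
      proof (rule S.form_lim[of _ _ K])
        show "\<bar>F n t * indicator B t\<bar> \<le> K" for n t
          using lim(3)[of n t] order_trans[OF abs_ge_zero lim(3)] by (cases "t \<in> B") auto
      qed (use lim B x z in \<open>auto intro!: tendsto_intros\<close>)
      moreover have "(\<lambda>n. S.form (F n) (spectral_projection B x) z) \<longlonglongrightarrow> S.form f (spectral_projection B x) z"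
        by (rule S.form_lim[OF lim(1-4)]) (use B x z in auto)
      moreover have "S.form (F n) (spectral_projection B x) z = S.form (\<lambda>t. F n t * indicator B t) x z" for n
        using lim(5) z by blast
      ultimately show "S.form f (spectral_projection B x) z = S.form (\<lambda>t. f t * indicator B t) x z"
        by (simp add: LIMSEQ_unique)
    qed
  next
    case (res0 f) then show ?case using B x by (simp add: form_res0 mult.assoc)
  next
    case (res1 f) then show ?case using B x by (simp add: form_res1 mult.assoc)
  qed
  then show ?thesis using z by blast
qed

lemma pvm_spectral_projection: "projection_valued_measure H spectral_projection"
proof -
  have Int: "spectral_projection (A \<inter> B) x = spectral_projection A (spectral_projection B x)" if A: "A \<in> sets borel" and B: "B \<in> sets borel" and x: "x \<in> V" for A B x
  proof (rule vec_eqI)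
    fix z assume z: "z \<in> V"
    have "hinner H (spectral_projection A (spectral_projection B x)) z = S.form (\<lambda>t. indicator A t * indicator B t) x z"
      using A B x z by (simp add: spectral_projection_inner form_spectral_projection)
    also have "(\<lambda>t. indicat_real A t * indicator B t) = indicator (A \<inter> B)" by (auto simp: indicator_def)
    finally show "hinner H (spectral_projection (A \<inter> B) x) z = hinner H (spectral_projection A (spectral_projection B x)) z"
      using A B x z by (simp add: spectral_projection_inner)
  qed (use A B x in auto)
  have sym: "hinner H (spectral_projection B x) y = hinner H x (spectral_projection B y)" if "B \<in> sets borel" "x \<in> V" "y \<in> V" for B x y
    using that inner_sym[of x "spectral_projection B y"] S.form_cnj[of "indicator B" y x] by (simp add: spectral_projection_inner)
  have proj: "projection H (spectral_projection B)" if B: "B \<in> sets borel" for B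
    unfolding projection_def
  proof (intro conjI ballI)
    show "spectral_projection B \<in> bounded_operators H" using S.calc_bounded[of "indicator B"] B by (simp add: spectral_projection_def)
    show "spectral_projection B (spectral_projection B x) = spectral_projection B x" if "x \<in> V" for x using Int[OF B B that] by simp
    show "hinner H (spectral_projection B x) y = hinner H x (spectral_projection B y)" if "x \<in> V" "y \<in> V" for x y using sym B that by blast
  qed
  have one: "spectral_projection UNIV x = x" if x: "x \<in> V" for x
    by (rule vec_eqI) (use x in \<open>simp_all add: spectral_projection_inner S.form_one\<close>)
  have sums: "(\<lambda>n. hinner H (spectral_projection (A n) x) y) sums hinner H (spectral_projection (\<Union>n. A n) x) y"
    if A: "range A \<subseteq> sets borel" "disjoint_family A" and x: "x \<in> V" and y: "y \<in> V" for A :: "nat \<Rightarrow> real set" and x y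
  proof -
    have m: "(\<lambda>n. LINT t|scalar w. indicat_real (A n) t) sums (LINT t|scalar w. indicat_real (\<Union>n. A n) t)" if w: "w \<in> V" for w
    proof -
      interpret finite_measure "scalar w" by (rule scalar(1)[OF w])
      have "range A \<subseteq> sets (scalar w)" using A(1) scalar(2)[OF w] by simp
      from finite_measure_UNION[OF this A(2)] show ?thesis using w by simp
    qed
    have "(\<lambda>n. S.form (indicator (A n)) x y) sums S.form (indicator (\<Union>n. A n)) x y"
      unfolding S.form_def by (intro sums_mult sums_sum sums_of_real m) (use x y in auto)
    moreover have "A n \<in> sets borel" for n using A(1) by auto
    moreover have "(\<Union>n. A n) \<in> sets borel" using A(1) by auto
    ultimately show ?thesis using x y by (simp add: spectral_projection_inner)
  qed
  have ext: "spectral_projection \<in> sets borel \<rightarrow>\<^sub>E Collect (projection H)"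
    by (rule PiE_I) (use proj in \<open>auto simp: spectral_projection_def\<close>)
  show ?thesis unfolding projection_valued_measure_def
    by (intro conjI ballI allI impI ext one Int sums)
qed

text \<open>By \<open>form_res\<close> the operators \<open>res0(E)\<close> and \<open>res1(E)\<close> are \<open>C\<close> and \<open>S\<close>. Then \<open>(x, y) \<in> \<integral> t dE\<close> and
\<open>(x, y) \<in> T\<close> both say that \<open>C y = S x\<close>.\<close>

theorem spectral_theorem:
  "pvm H (spectral_measure H T)" "spectral_integral H (spectral_measure H T) (\<lambda>t. t) = T"
proof -
  have E: "pvm H spectral_projection" by unfold_locales (rule pvm_spectral_projection)
  interpret E: pvm H spectral_projection by (rule E)
  have eq: "\<forall>x\<in>V. \<forall>z\<in>V. E.form f x z = S.form f x z" if "bounded_borel f" for f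
    using that
  proof (induction rule: bounded_borel_induct)
    case (ind B) then show ?case by (simp add: E.form_indicator spectral_projection_inner)
  next
    case (add f g) then show ?case by (simp add: E.form_add S.form_add)
  next
    case (scale c f) then show ?case by (simp add: E.form_scale S.form_scale)
  next
    case (lim F f K)
    show ?case
    proof (intro ballI)
      fix h z assume hz: "h \<in> V" "z \<in> V"
      have "(\<lambda>n. E.form (F n) h z) \<longlonglongrightarrow> S.form f h z"
        using S.form_lim[OF lim(1-4) hz] lim(5) hz by simp
      then show "E.form f h z = S.form f h z" using E.form_lim[OF lim(1-4) hz] LIMSEQ_unique by blast
    qed
  qed
  have "(x, y) \<in> spectral_integral H spectral_projection (\<lambda>t. t) \<longleftrightarrow> (x, y) \<in> T" for x y
  proof -
    have "E.form res0 w z = hinner H (C w) z" "E.form res1 w z = hinner H (S w) z" if "w \<in> V" "z \<in> V" for w z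
      using eq that form_res[OF bounded_borel_const[of 1] that] by (simp_all add: S.form_one C_sym S_sym)
    then have "(x, y) \<in> spectral_integral H spectral_projection (\<lambda>t. t) \<longleftrightarrow>
        x \<in> V \<and> y \<in> V \<and> (\<forall>z\<in>V. hinner H (C y) z = hinner H (S x) z)"
      using E.spectral_integral_iff[of "\<lambda>t. t" x y] by auto
    also have "\<dots> \<longleftrightarrow> x \<in> V \<and> y \<in> V \<and> C y = S x"
      using vec_eqI[of "C y" "S x"] by auto
    finally show ?thesis by (simp add: T_iff)
  qed
  then have T: "spectral_integral H spectral_projection (\<lambda>t. t) = T" by auto
  show "pvm H (spectral_measure H T)" "spectral_integral H (spectral_measure H T) (\<lambda>t. t) = T"
    unfolding spectral_measure_eqI[OF E T] by (fact E T)+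
qed

end

section \<open>The direct integral as an inner product space\<close>

lemma hilbert_space_imp_inner_space: "hilbert_space H \<Longrightarrow> inner_space H"
proof -
  assume "hilbert_space H"
  then interpret hilbert_space H .
  show ?thesis by unfold_locales
qed

context measurable_field
begin

abbreviation L2 where "L2 \<equiv> square_integrable_fields \<omega> H S"
abbreviation cls where "cls \<equiv> field_class \<omega> H S"
abbreviation D where "D \<equiv> direct_integral \<omega> H S"

lemma fibre_inner: "\<zeta> \<in> space \<omega> \<Longrightarrow> inner_space (H \<zeta>)"
  using fibre hilbert_space_imp_inner_space by blast

lemma S_mem [simp]: "x \<in> S \<Longrightarrow> \<zeta> \<in> space \<omega> \<Longrightarrow> x \<zeta> \<in> hcarrier (H \<zeta>)"
  using vector_fields by blast

text \<open>Maximality with the arguments of the inner product exchanged; all closure properties of the measurable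
fields come from it.\<close>

lemma S_I:
  assumes "\<And>\<zeta>. \<zeta> \<in> space \<omega> \<Longrightarrow> v \<zeta> \<in> hcarrier (H \<zeta>)"
    and "\<And>x. x \<in> S \<Longrightarrow> (\<lambda>\<zeta>. hinner (H \<zeta>) (v \<zeta>) (x \<zeta>)) \<in> borel_measurable \<omega>"
  shows "v \<in> S"
proof (rule maximal)
  show "v \<in> (\<Pi> \<zeta>\<in>space \<omega>. hcarrier (H \<zeta>))" using assms(1) by blast
  fix x assume x: "x \<in> S"
  have "(\<lambda>\<zeta>. cnj (hinner (H \<zeta>) (v \<zeta>) (x \<zeta>))) \<in> borel_measurable \<omega>"
    using borel_measurable_continuous_on[OF continuous_on_cnj[OF continuous_on_id] assms(2)[OF x]] by simp
  moreover have "hinner (H \<zeta>) (x \<zeta>) (v \<zeta>) = cnj (hinner (H \<zeta>) (v \<zeta>) (x \<zeta>))" if "\<zeta> \<in> space \<omega>" for \<zeta>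
    by (rule inner_space.inner_sym[OF fibre_inner[OF that]]) (use assms(1)[OF that] x that in auto)
  ultimately show "(\<lambda>\<zeta>. hinner (H \<zeta>) (x \<zeta>) (v \<zeta>)) \<in> borel_measurable \<omega>"
    by (simp cong: measurable_cong)
qed

lemma S_add: assumes "x \<in> S" "y \<in> S" shows "(\<lambda>\<zeta>. hadd (H \<zeta>) (x \<zeta>) (y \<zeta>)) \<in> S"
proof (rule S_I)
  fix z assume z: "z \<in> S"
  have "(\<lambda>\<zeta>. hinner (H \<zeta>) (x \<zeta>) (z \<zeta>) + hinner (H \<zeta>) (y \<zeta>) (z \<zeta>)) \<in> borel_measurable \<omega>"
    using assms z by (intro borel_measurable_add inner_measurable)
  moreover have "hinner (H \<zeta>) (hadd (H \<zeta>) (x \<zeta>) (y \<zeta>)) (z \<zeta>) = hinner (H \<zeta>) (x \<zeta>) (z \<zeta>) + hinner (H \<zeta>) (y \<zeta>) (z \<zeta>)"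
    if "\<zeta> \<in> space \<omega>" for \<zeta> using inner_space.inner_addl[OF fibre_inner[OF that]] assms z that by simp
  ultimately show "(\<lambda>\<zeta>. hinner (H \<zeta>) (hadd (H \<zeta>) (x \<zeta>) (y \<zeta>)) (z \<zeta>)) \<in> borel_measurable \<omega>"
    by (simp cong: measurable_cong)
qed (use assms inner_space.add_mem[OF fibre_inner] in auto)

lemma S_scale:
  assumes "x \<in> S" "c \<in> borel_measurable \<omega>" shows "(\<lambda>\<zeta>. hscale (H \<zeta>) (c \<zeta>) (x \<zeta>)) \<in> S"
proof (rule S_I)
  fix z assume z: "z \<in> S"
  have "(\<lambda>\<zeta>. c \<zeta> * hinner (H \<zeta>) (x \<zeta>) (z \<zeta>)) \<in> borel_measurable \<omega>"
    using assms z by (intro borel_measurable_times inner_measurable)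
  moreover have "hinner (H \<zeta>) (hscale (H \<zeta>) (c \<zeta>) (x \<zeta>)) (z \<zeta>) = c \<zeta> * hinner (H \<zeta>) (x \<zeta>) (z \<zeta>)"
    if "\<zeta> \<in> space \<omega>" for \<zeta> using inner_space.inner_scalel[OF fibre_inner[OF that]] assms z that by simp
  ultimately show "(\<lambda>\<zeta>. hinner (H \<zeta>) (hscale (H \<zeta>) (c \<zeta>) (x \<zeta>)) (z \<zeta>)) \<in> borel_measurable \<omega>"
    by (simp cong: measurable_cong)
qed (use assms inner_space.scale_mem[OF fibre_inner] in auto)

lemma S_zero: "(\<lambda>\<zeta>. hzero (H \<zeta>)) \<in> S"
proof (rule S_I)
  fix z assume z: "z \<in> S"
  have "hinner (H \<zeta>) (hzero (H \<zeta>)) (z \<zeta>) = 0" if "\<zeta> \<in> space \<omega>" for \<zeta>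
    using inner_space.inner_zerol[OF fibre_inner[OF that]] z that by simp
  then show "(\<lambda>\<zeta>. hinner (H \<zeta>) (hzero (H \<zeta>)) (z \<zeta>)) \<in> borel_measurable \<omega>"
    by (simp cong: measurable_cong)
qed (use inner_space.zero_mem[OF fibre_inner] in auto)

lemma S_if:
  assumes "x \<in> S" "y \<in> S" "N \<in> sets \<omega>" shows "(\<lambda>\<zeta>. if \<zeta> \<in> N then x \<zeta> else y \<zeta>) \<in> S"
proof (rule S_I)
  fix z assume z: "z \<in> S"
  have "(\<lambda>\<zeta>. if \<zeta> \<in> N then hinner (H \<zeta>) (x \<zeta>) (z \<zeta>) else hinner (H \<zeta>) (y \<zeta>) (z \<zeta>)) \<in> borel_measurable \<omega>"
    using assms z by (intro measurable_If_set inner_measurable) auto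
  then show "(\<lambda>\<zeta>. hinner (H \<zeta>) (if \<zeta> \<in> N then x \<zeta> else y \<zeta>) (z \<zeta>)) \<in> borel_measurable \<omega>"
    by (simp add: if_distrib[where f = "\<lambda>v. hinner (H _) v _"])
qed (use assms in auto)

lemma norm_measurable: "x \<in> S \<Longrightarrow> (\<lambda>\<zeta>. hnorm (H \<zeta>) (x \<zeta>)) \<in> borel_measurable \<omega>"
  unfolding hnorm_def using inner_measurable[of x x] by measurable

lemma L2_S: "x \<in> L2 \<Longrightarrow> x \<in> S"
  and L2_integrable: "x \<in> L2 \<Longrightarrow> integrable \<omega> (\<lambda>\<zeta>. (hnorm (H \<zeta>) (x \<zeta>))\<^sup>2)"
  by (auto simp: square_integrable_fields_def)

lemma L2_bound:
  assumes x: "x \<in> S" and g: "integrable \<omega> g" and le: "AE \<zeta> in \<omega>. (hnorm (H \<zeta>) (x \<zeta>))\<^sup>2 \<le> g \<zeta>"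
  shows "x \<in> L2"
proof -
  have "(\<lambda>\<zeta>. (hnorm (H \<zeta>) (x \<zeta>))\<^sup>2) \<in> borel_measurable \<omega>" using norm_measurable[OF x] by measurable
  then have "integrable \<omega> (\<lambda>\<zeta>. (hnorm (H \<zeta>) (x \<zeta>))\<^sup>2)"
    by (rule Bochner_Integration.integrable_bound[OF g]) (use le in eventually_elim, auto)
  then show ?thesis using x by (simp add: square_integrable_fields_def)
qed

lemma L2_bound_field:
  assumes x: "x \<in> S" and y: "y \<in> L2"
    and le: "\<And>\<zeta>. \<zeta> \<in> space \<omega> \<Longrightarrow> hnorm (H \<zeta>) (x \<zeta>) \<le> K * hnorm (H \<zeta>) (y \<zeta>)"
  shows "x \<in> L2"
proof (rule L2_bound[OF x])
  show "integrable \<omega> (\<lambda>\<zeta>. K\<^sup>2 * (hnorm (H \<zeta>) (y \<zeta>))\<^sup>2)" using L2_integrable[OF y] by simp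
  show "AE \<zeta> in \<omega>. (hnorm (H \<zeta>) (x \<zeta>))\<^sup>2 \<le> K\<^sup>2 * (hnorm (H \<zeta>) (y \<zeta>))\<^sup>2"
  proof (rule AE_I2)
    fix \<zeta> assume \<zeta>: "\<zeta> \<in> space \<omega>"
    have "0 \<le> hnorm (H \<zeta>) (x \<zeta>)" using inner_space.hnorm_nonneg[OF fibre_inner[OF \<zeta>]] x \<zeta> by simp
    from power_mono[OF le[OF \<zeta>] this, of 2]
    show "(hnorm (H \<zeta>) (x \<zeta>))\<^sup>2 \<le> K\<^sup>2 * (hnorm (H \<zeta>) (y \<zeta>))\<^sup>2" by (simp add: power_mult_distrib)
  qed
qed

lemma L2_zero: "(\<lambda>\<zeta>. hzero (H \<zeta>)) \<in> L2"
proof (rule L2_bound[OF S_zero])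
  show "AE \<zeta> in \<omega>. (hnorm (H \<zeta>) (hzero (H \<zeta>)))\<^sup>2 \<le> 0"
    by (rule AE_I2) (simp add: inner_space.hnorm_zero[OF fibre_inner])
qed simp

lemma L2_add: assumes x: "x \<in> L2" and y: "y \<in> L2" shows "(\<lambda>\<zeta>. hadd (H \<zeta>) (x \<zeta>) (y \<zeta>)) \<in> L2"
proof (rule L2_bound[OF S_add])
  show "integrable \<omega> (\<lambda>\<zeta>. 2 * (hnorm (H \<zeta>) (x \<zeta>))\<^sup>2 + 2 * (hnorm (H \<zeta>) (y \<zeta>))\<^sup>2)"
    using L2_integrable[OF x] L2_integrable[OF y] by simp
  show "AE \<zeta> in \<omega>. (hnorm (H \<zeta>) (hadd (H \<zeta>) (x \<zeta>) (y \<zeta>)))\<^sup>2 \<le> 2 * (hnorm (H \<zeta>) (x \<zeta>))\<^sup>2 + 2 * (hnorm (H \<zeta>) (y \<zeta>))\<^sup>2"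
  proof (rule AE_I2)
    fix \<zeta> assume \<zeta>: "\<zeta> \<in> space \<omega>"
    interpret F: inner_space "H \<zeta>" by (rule fibre_inner[OF \<zeta>])
    show "(hnorm (H \<zeta>) (hadd (H \<zeta>) (x \<zeta>) (y \<zeta>)))\<^sup>2 \<le> 2 * (hnorm (H \<zeta>) (x \<zeta>))\<^sup>2 + 2 * (hnorm (H \<zeta>) (y \<zeta>))\<^sup>2"
      using F.parallelogram[of "x \<zeta>" "y \<zeta>"] x y \<zeta> L2_S by (smt (verit) S_mem zero_le_power2)
  qed
qed (use L2_S x y in auto)

lemma L2_scale: "x \<in> L2 \<Longrightarrow> (\<lambda>\<zeta>. hscale (H \<zeta>) c (x \<zeta>)) \<in> L2"
  by (rule L2_bound_field[where K = "cmod c" and y = x])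
    (auto intro: S_scale L2_S simp: inner_space.hnorm_scale[OF fibre_inner] L2_S)

lemma L2_if: "x \<in> L2 \<Longrightarrow> N \<in> sets \<omega> \<Longrightarrow> (\<lambda>\<zeta>. if \<zeta> \<in> N then hzero (H \<zeta>) else x \<zeta>) \<in> L2"
  by (rule L2_bound_field[where K = 1 and y = x])
    (auto intro: S_if S_zero L2_S simp: inner_space.hnorm_zero[OF fibre_inner] inner_space.hnorm_nonneg[OF fibre_inner] L2_S)

lemma inner_integrable [simp]:
  assumes x: "x \<in> L2" and y: "y \<in> L2" shows "integrable \<omega> (\<lambda>\<zeta>. hinner (H \<zeta>) (x \<zeta>) (y \<zeta>))"
proof (rule Bochner_Integration.integrable_bound)
  show "integrable \<omega> (\<lambda>\<zeta>. (hnorm (H \<zeta>) (x \<zeta>))\<^sup>2 + (hnorm (H \<zeta>) (y \<zeta>))\<^sup>2)"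
    using L2_integrable[OF x] L2_integrable[OF y] by simp
  show "(\<lambda>\<zeta>. hinner (H \<zeta>) (x \<zeta>) (y \<zeta>)) \<in> borel_measurable \<omega>"
    using x y L2_S inner_measurable by blast
  show "AE \<zeta> in \<omega>. cmod (hinner (H \<zeta>) (x \<zeta>) (y \<zeta>)) \<le> norm ((hnorm (H \<zeta>) (x \<zeta>))\<^sup>2 + (hnorm (H \<zeta>) (y \<zeta>))\<^sup>2)"
  proof (rule AE_I2)
    fix \<zeta> assume \<zeta>: "\<zeta> \<in> space \<omega>"
    interpret F: inner_space "H \<zeta>" by (rule fibre_inner[OF \<zeta>])
    have "cmod (hinner (H \<zeta>) (x \<zeta>) (y \<zeta>)) \<le> hnorm (H \<zeta>) (x \<zeta>) * hnorm (H \<zeta>) (y \<zeta>)"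
      using F.cauchy_schwarz x y \<zeta> L2_S by simp
    also have "\<dots> \<le> (hnorm (H \<zeta>) (x \<zeta>))\<^sup>2 + (hnorm (H \<zeta>) (y \<zeta>))\<^sup>2"
    proof -
      have "0 \<le> hnorm (H \<zeta>) (x \<zeta>) * hnorm (H \<zeta>) (y \<zeta>)" using x y \<zeta> L2_S by simp
      then show ?thesis
        using sum_squares_bound[of "hnorm (H \<zeta>) (x \<zeta>)" "hnorm (H \<zeta>) (y \<zeta>)"] by linarith
    qed
    finally show "cmod (hinner (H \<zeta>) (x \<zeta>) (y \<zeta>)) \<le> norm ((hnorm (H \<zeta>) (x \<zeta>))\<^sup>2 + (hnorm (H \<zeta>) (y \<zeta>))\<^sup>2)" by simp
  qed
qed

lemma cls_eqI: "AE \<zeta> in \<omega>. x \<zeta> = y \<zeta> \<Longrightarrow> cls x = cls y"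
  unfolding field_class_def by (intro Collect_cong conj_cong refl) (auto elim: AE_mp)

lemma cls_eq_iff: "x \<in> L2 \<Longrightarrow> cls x = cls y \<longleftrightarrow> (AE \<zeta> in \<omega>. x \<zeta> = y \<zeta>)"
  using cls_eqI[of x y] unfolding field_class_def by (auto simp: set_eq_iff)

text \<open>The operations of the direct integral are defined on chosen representatives. From here on they are only
used through the lemmas about \<open>cls x\<close> for an arbitrary \<open>x \<in> L2\<close>.\<close>

lemma field_rep:
  assumes "x \<in> L2" shows "field_rep (cls x) \<in> L2" "AE \<zeta> in \<omega>. field_rep (cls x) \<zeta> = x \<zeta>"
proof -
  have "x \<in> cls x" using assms by (simp add: field_class_def)
  then have "field_rep (cls x) \<in> cls x" unfolding field_rep_def by (rule someI[where P = "\<lambda>z. z \<in> cls x"])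
  then show "field_rep (cls x) \<in> L2" "AE \<zeta> in \<omega>. field_rep (cls x) \<zeta> = x \<zeta>"
    by (auto simp: field_class_def)
qed

lemma D_carrier: "hcarrier D = cls ` L2" and D_zero: "hzero D = cls (\<lambda>\<zeta>. hzero (H \<zeta>))"
  by (simp_all add: direct_integral_def)

lemma D_carrierE: assumes "X \<in> hcarrier D" obtains x where "x \<in> L2" "X = cls x"
  using assms by (auto simp: D_carrier)

lemma cls_mem [simp]: "x \<in> L2 \<Longrightarrow> cls x \<in> hcarrier D"
  by (simp add: D_carrier)

lemma D_add: "x \<in> L2 \<Longrightarrow> y \<in> L2 \<Longrightarrow> hadd D (cls x) (cls y) = cls (\<lambda>\<zeta>. hadd (H \<zeta>) (x \<zeta>) (y \<zeta>))"
  unfolding direct_integral_def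
  using field_rep(2)[of x] field_rep(2)[of y] by (auto intro!: cls_eqI)

lemma D_scale: "x \<in> L2 \<Longrightarrow> hscale D c (cls x) = cls (\<lambda>\<zeta>. hscale (H \<zeta>) c (x \<zeta>))"
  unfolding direct_integral_def
  using field_rep(2)[of x] by (auto intro!: cls_eqI)

lemma D_inner: 
  assumes "x \<in> L2" "y \<in> L2"
  shows "hinner D (cls x) (cls y) = (LINT \<zeta>|\<omega>. hinner (H \<zeta>) (x \<zeta>) (y \<zeta>))"
proof -
  have "hinner D (cls x) (cls y) = (LINT \<zeta>|\<omega>. hinner (H \<zeta>) (field_rep (cls x) \<zeta>) (field_rep (cls y) \<zeta>))"
    by (simp add: direct_integral_def)
  also have "\<dots> = (LINT \<zeta>|\<omega>. hinner (H \<zeta>) (x \<zeta>) (y \<zeta>))"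
  proof (rule integral_cong_AE)
    show "AE \<zeta> in \<omega>. hinner (H \<zeta>) (field_rep (cls x) \<zeta>) (field_rep (cls y) \<zeta>) = hinner (H \<zeta>) (x \<zeta>) (y \<zeta>)"
      using field_rep(2)[OF assms(1)] field_rep(2)[OF assms(2)] by eventually_elim simp
  qed (use assms field_rep(1) in \<open>auto intro!: inner_measurable L2_S\<close>)
  finally show ?thesis .
qed

theorem inner_space_direct_integral: "inner_space D"
proof
  show "hzero D \<in> hcarrier D" by (simp add: D_zero L2_zero)
  fix x y z assume x: "x \<in> hcarrier D"
  then obtain a where a: "a \<in> L2" "x = cls a" by (rule D_carrierE)
  note FS = L2_S[THEN S_mem]
  note sp = AE_space[of \<omega>]
  show "hscale D c x \<in> hcarrier D" for c using a by (simp add: D_scale L2_scale)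
  show "hadd D x (hzero D) = x"
    unfolding a(2) D_zero D_add[OF a(1) L2_zero]
    by (rule cls_eqI) (use sp in eventually_elim, simp add: inner_space.vec_zero[OF fibre_inner] FS[OF a(1)])
  show "hadd D x (hscale D (- 1) x) = hzero D"
    unfolding a(2) D_zero D_scale[OF a(1)] D_add[OF a(1) L2_scale[OF a(1)]]
    by (rule cls_eqI) (use sp in eventually_elim, simp add: inner_space.vec_inverse[OF fibre_inner] FS[OF a(1)])
  have aa: "hinner D x x = complex_of_real (LINT \<zeta>|\<omega>. (hnorm (H \<zeta>) (a \<zeta>))\<^sup>2)"
  proof -
    have "hinner D x x = (LINT \<zeta>|\<omega>. complex_of_real ((hnorm (H \<zeta>) (a \<zeta>))\<^sup>2))"
      unfolding a(2) D_inner[OF a(1) a(1)]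
      by (rule Bochner_Integration.integral_cong[OF refl]) (simp add: inner_space.inner_self[OF fibre_inner] FS[OF a(1)])
    then show ?thesis by (simp del: of_real_power)
  qed
  show "0 \<le> Re (hinner D x x)" unfolding aa by simp
  show "x = hzero D" if "hinner D x x = 0"
  proof -
    have "(LINT \<zeta>|\<omega>. (hnorm (H \<zeta>) (a \<zeta>))\<^sup>2) = 0" using that unfolding aa of_real_eq_0_iff .
    then have "AE \<zeta> in \<omega>. (hnorm (H \<zeta>) (a \<zeta>))\<^sup>2 = 0"
      using integral_nonneg_eq_0_iff_AE[OF L2_integrable[OF a(1)]] by simp
    then have "AE \<zeta> in \<omega>. a \<zeta> = hzero (H \<zeta>)" using sp
      by eventually_elim (simp add: inner_space.hnorm_eq_0[OF fibre_inner] FS[OF a(1)])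
    then show ?thesis unfolding a(2) D_zero by (rule cls_eqI)
  qed
  assume y: "y \<in> hcarrier D"
  then obtain b where b: "b \<in> L2" "y = cls b" by (rule D_carrierE)
  show "hadd D x y \<in> hcarrier D" using a b by (simp add: D_add L2_add)
  show "hadd D x y = hadd D y x"
    unfolding a(2) b(2) D_add[OF a(1) b(1)] D_add[OF b(1) a(1)]
    by (rule cls_eqI) (use sp in eventually_elim, rule inner_space.vec_commute[OF fibre_inner], auto simp: FS[OF a(1)] FS[OF b(1)])
  show "hinner D x y = cnj (hinner D y x)"
    unfolding a(2) b(2) D_inner[OF a(1) b(1)] D_inner[OF b(1) a(1)]
      integral_bounded_linear[OF bounded_linear_cnj inner_integrable[OF b(1) a(1)], symmetric]
    by (rule Bochner_Integration.integral_cong[OF refl]) (rule inner_space.inner_sym[OF fibre_inner], auto simp: FS[OF a(1)] FS[OF b(1)])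
  show "hinner D (hscale D c x) y = c * hinner D x y" for c
  proof -
    have "hinner D (hscale D c x) y = (LINT \<zeta>|\<omega>. c * hinner (H \<zeta>) (a \<zeta>) (b \<zeta>))"
      unfolding a(2) b(2) D_scale[OF a(1)] D_inner[OF L2_scale[OF a(1)] b(1)]
      by (rule Bochner_Integration.integral_cong[OF refl]) (rule inner_space.inner_scalel[OF fibre_inner], auto simp: FS[OF a(1)] FS[OF b(1)])
    then show ?thesis by (simp add: a(2) b(2) D_inner[OF a(1) b(1)])
  qed
  assume z: "z \<in> hcarrier D"
  then obtain c where c: "c \<in> L2" "z = cls c" by (rule D_carrierE)
  show "hadd D (hadd D x y) z = hadd D x (hadd D y z)"
    unfolding a(2) b(2) c(2) D_add[OF a(1) b(1)] D_add[OF b(1) c(1)]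
      D_add[OF L2_add[OF a(1) b(1)] c(1)] D_add[OF a(1) L2_add[OF b(1) c(1)]]
    by (rule cls_eqI) (use sp in eventually_elim, rule inner_space.vec_assoc[OF fibre_inner], auto simp: FS[OF a(1)] FS[OF b(1)] FS[OF c(1)])
  show "hinner D (hadd D x y) z = hinner D x z + hinner D y z"
  proof -
    have "hinner D (hadd D x y) z = (LINT \<zeta>|\<omega>. hinner (H \<zeta>) (a \<zeta>) (c \<zeta>) + hinner (H \<zeta>) (b \<zeta>) (c \<zeta>))"
      unfolding a(2) b(2) c(2) D_add[OF a(1) b(1)] D_inner[OF L2_add[OF a(1) b(1)] c(1)]
      by (rule Bochner_Integration.integral_cong[OF refl]) (rule inner_space.inner_addl[OF fibre_inner], auto simp: FS[OF a(1)] FS[OF b(1)] FS[OF c(1)])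
    then show ?thesis using a b c by (simp add: D_inner)
  qed
qed

lemma bounded_integral_cls:
  "x \<in> L2 \<Longrightarrow> bounded_integral_operator \<omega> H S A (cls x) = cls (\<lambda>\<zeta>. A \<zeta> (x \<zeta>))"
  unfolding bounded_integral_operator_def using field_rep(2)[of x] by (auto intro!: cls_eqI)

lemma measurable_bounded_fieldD:
  assumes "measurable_bounded_field \<omega> H S A"
  shows "x \<in> S \<Longrightarrow> (\<lambda>\<zeta>. A \<zeta> (x \<zeta>)) \<in> S" "\<zeta> \<in> space \<omega> \<Longrightarrow> A \<zeta> \<in> bounded_operators (H \<zeta>)"
  using assms by (auto simp: measurable_bounded_field_def)

lemma measurable_bounded_field_cong:
  assumes "\<And>\<zeta>. \<zeta> \<in> space \<omega> \<Longrightarrow> A \<zeta> = B \<zeta>" "measurable_bounded_field \<omega> H S A"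
  shows "measurable_bounded_field \<omega> H S B"
  unfolding measurable_bounded_field_def
proof (intro conjI ballI)
  show "B \<zeta> \<in> bounded_operators (H \<zeta>)" if "\<zeta> \<in> space \<omega>" for \<zeta>
    using measurable_bounded_fieldD(2)[OF assms(2) that] assms(1)[OF that] by simp
  fix x assume x: "x \<in> S"
  have m: "(\<lambda>\<zeta>. A \<zeta> (x \<zeta>)) \<in> S" by (rule measurable_bounded_fieldD(1)[OF assms(2) x])
  show "(\<lambda>\<zeta>. B \<zeta> (x \<zeta>)) \<in> S"
  proof (rule S_I)
    show "B \<zeta> (x \<zeta>) \<in> hcarrier (H \<zeta>)" if "\<zeta> \<in> space \<omega>" for \<zeta> using S_mem[OF m that] assms(1)[OF that] by simp
    show "(\<lambda>\<zeta>. hinner (H \<zeta>) (B \<zeta> (x \<zeta>)) (y \<zeta>)) \<in> borel_measurable \<omega>" if "y \<in> S" for y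
      using inner_measurable[OF m that] assms(1) by (simp cong: measurable_cong)
  qed
qed

end

section \<open>Direct integrals of projection-valued measures\<close>

context pvm
begin

lemmas sesq_add = form_add[folded sesq_integral_eq_form]
  and sesq_scale = form_scale[folded sesq_integral_eq_form]
  and sesq_lim = form_lim[folded sesq_integral_eq_form]
  and sesq_indicator = form_indicator[folded sesq_integral_eq_form]
  and sesq_bound = form_bound[folded sesq_integral_eq_form]
  and sesq_one = form_one[folded sesq_integral_eq_form]

text \<open>The partial sum is the form of the indicator of a finite union, so that the bound is uniform in \<open>n\<close>. It
is the majorant under which countable additivity can be integrated over \<open>\<zeta>\<close>.\<close>

lemma E_partial_sum_bound:
  fixes A :: "nat \<Rightarrow> real set"
  assumes A: "range A \<subseteq> sets borel" "disjoint_family A" and x: "x \<in> V" and y: "y \<in> V"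
  shows "cmod (\<Sum>i<n. hinner H (E (A i) x) y) \<le> 2 * hnorm H x * hnorm H y"
proof -
  have Ab: "A i \<in> sets borel" for i using A(1) by auto
  have eq: "(\<Sum>i<n. indicat_real (A i) t) = indicator (\<Union>i<n. A i) t" for n :: nat and t
    using A(2) by (subst indicator_UN_disjoint) (auto simp: disjoint_family_on_def)
  have bb: "bounded_borel (\<lambda>t. \<Sum>i<n. indicat_real (A i) t)" for n :: nat
    unfolding eq using Ab by (intro bounded_borel_indicator) auto
  have "form (\<lambda>t. \<Sum>i<n. indicat_real (A i) t) x y = (\<Sum>i<n. hinner H (E (A i) x) y)"
  proof (induction n)
    case 0
    show ?case using form_scale[OF x y, of 0 "\<lambda>_. 1"] by simp
  next
    case (Suc n)
    show ?case using form_add[OF bb[of n] bounded_borel_indicator[OF Ab] x y, of n] Suc form_indicator[OF Ab x y, of n] by simp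
  qed
  moreover have "\<bar>\<Sum>i<n. indicat_real (A i) t\<bar> \<le> 1" for t unfolding eq by (simp add: indicator_def)
  ultimately show ?thesis using form_bound[OF bb, of n 1 x y] x y by simp
qed

end

locale pvm_field = measurable_field \<omega> H S for \<omega> :: "'z measure" and H :: "'z \<Rightarrow> 'h hspace" and S +
  fixes E :: "'z \<Rightarrow> real set \<Rightarrow> 'h \<Rightarrow> 'h"
  assumes fibre_pvm: "\<And>\<zeta>. \<zeta> \<in> space \<omega> \<Longrightarrow> pvm (H \<zeta>) (E \<zeta>)"
    and E_measurable: "\<And>B. B \<in> sets borel \<Longrightarrow> measurable_bounded_field \<omega> H S (\<lambda>\<zeta>. E \<zeta> B)"
begin

lemma fibre_hilbert_pvm: "\<zeta> \<in> space \<omega> \<Longrightarrow> hilbert_pvm (H \<zeta>) (E \<zeta>)"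
  using fibre fibre_pvm by (simp add: hilbert_pvm_def)

abbreviation \<phi> where "\<phi> f \<zeta> x z \<equiv> sesq_integral (H \<zeta>) (E \<zeta>) f x z"

definition integral_pvm :: "real set \<Rightarrow> ('z \<Rightarrow> 'h) set \<Rightarrow> ('z \<Rightarrow> 'h) set" where
  "integral_pvm = (\<lambda>B\<in>sets borel. bounded_integral_operator \<omega> H S (\<lambda>\<zeta>. E \<zeta> B))"

lemma E_L2:
  assumes B: "B \<in> sets borel" and x: "x \<in> L2" shows "(\<lambda>\<zeta>. E \<zeta> B (x \<zeta>)) \<in> L2"
proof (rule L2_bound_field[OF _ x, of _ 1])
  show "(\<lambda>\<zeta>. E \<zeta> B (x \<zeta>)) \<in> S" using measurable_bounded_fieldD(1)[OF E_measurable[OF B]] L2_S[OF x] by blast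
  show "hnorm (H \<zeta>) (E \<zeta> B (x \<zeta>)) \<le> 1 * hnorm (H \<zeta>) (x \<zeta>)" if "\<zeta> \<in> space \<omega>" for \<zeta>
    using pvm.E_norm[OF fibre_pvm[OF that] B] S_mem[OF L2_S[OF x] that] by simp
qed

lemma integral_pvm_cls: "B \<in> sets borel \<Longrightarrow> x \<in> L2 \<Longrightarrow> integral_pvm B (cls x) = cls (\<lambda>\<zeta>. E \<zeta> B (x \<zeta>))"
  by (simp add: integral_pvm_def bounded_integral_cls)

lemma pvm_integral_pvm: "pvm D integral_pvm"
proof -
  interpret D: inner_space D by (rule inner_space_direct_integral)
  note sp = AE_space[of \<omega>]
  note FS = L2_S[THEN S_mem]
  note F = fibre_pvm
  have Int: "integral_pvm (A \<inter> B) X = integral_pvm A (integral_pvm B X)" if A: "A \<in> sets borel" and B: "B \<in> sets borel" and "X \<in> hcarrier D" for A B X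
  proof -
    obtain x where x: "x \<in> L2" "X = cls x" using \<open>X \<in> hcarrier D\<close> by (rule D_carrierE)
    show ?thesis unfolding x(2) using A B x(1)
      by (simp add: integral_pvm_cls E_L2) (rule cls_eqI, use sp in eventually_elim, rule pvm.E_Int[OF F], auto simp: FS)
  qed
  have sym: "hinner D (integral_pvm B X) Y = hinner D X (integral_pvm B Y)" if B: "B \<in> sets borel" and XY: "X \<in> hcarrier D" "Y \<in> hcarrier D" for B X Y
  proof -
    obtain x where x: "x \<in> L2" "X = cls x" using XY(1) by (rule D_carrierE)
    obtain y where y: "y \<in> L2" "Y = cls y" using XY(2) by (rule D_carrierE)
    show ?thesis unfolding x(2) y(2) using B x(1) y(1)
      by (simp add: integral_pvm_cls D_inner E_L2)
        (rule Bochner_Integration.integral_cong[OF refl], rule pvm.E_sym[OF F], auto simp: FS)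
  qed
  have mem: "integral_pvm B X \<in> hcarrier D" if "B \<in> sets borel" "X \<in> hcarrier D" for B X
    using that by (auto simp: integral_pvm_cls E_L2 elim!: D_carrierE)
  have idem: "integral_pvm B (integral_pvm B X) = integral_pvm B X" if "B \<in> sets borel" "X \<in> hcarrier D" for B X
    using Int[of B B X] that by simp
  have proj: "projection D (integral_pvm B)" if B: "B \<in> sets borel" for B
    unfolding projection_def bounded_operators_def
  proof (intro CollectI conjI ballI allI exI[of _ 1])
    show "integral_pvm B \<in> hcarrier D \<rightarrow>\<^sub>E hcarrier D"
      by (rule PiE_I) (use mem B in \<open>auto simp: integral_pvm_def bounded_integral_operator_def\<close>)
    fix X assume X: "X \<in> hcarrier D"
    obtain x where x: "x \<in> L2" "X = cls x" using X by (rule D_carrierE)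
    show "integral_pvm B (integral_pvm B X) = integral_pvm B X" by (rule idem[OF B X])
    show "hnorm D (integral_pvm B X) \<le> 1 * hnorm D X"
      using D.symmetric_idempotent_norm[of "integral_pvm B" X] mem[OF B X] X idem[OF B X] sym[OF B mem[OF B X] X] by simp
    show "integral_pvm B (hscale D c X) = hscale D c (integral_pvm B X)" for c
      unfolding x(2) using B x(1)
      by (simp add: integral_pvm_cls E_L2 D_scale L2_scale) (rule cls_eqI, use sp in eventually_elim, rule pvm.E_scale[OF F], auto simp: FS)
    fix Y assume Y: "Y \<in> hcarrier D"
    obtain y where y: "y \<in> L2" "Y = cls y" using Y by (rule D_carrierE)
    show "integral_pvm B (hadd D X Y) = hadd D (integral_pvm B X) (integral_pvm B Y)"
      unfolding x(2) y(2) using B x(1) y(1)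
      by (simp add: integral_pvm_cls E_L2 D_add L2_add) (rule cls_eqI, use sp in eventually_elim, rule pvm.E_add[OF F], auto simp: FS)
    show "hinner D (integral_pvm B X) Y = hinner D X (integral_pvm B Y)" by (rule sym[OF B X Y])
  qed
  have one: "integral_pvm UNIV X = X" if X: "X \<in> hcarrier D" for X
  proof -
    obtain x where x: "x \<in> L2" "X = cls x" using X by (rule D_carrierE)
    show ?thesis unfolding x(2) using x(1)
      by (simp add: integral_pvm_cls) (rule cls_eqI, use sp in eventually_elim, rule pvm.E_UNIV[OF F], auto simp: FS)
  qed
  have sums: "(\<lambda>n. hinner D (integral_pvm (A n) X) Y) sums hinner D (integral_pvm (\<Union>n. A n) X) Y"
    if A: "range A \<subseteq> sets borel" "disjoint_family A" and XY: "X \<in> hcarrier D" "Y \<in> hcarrier D" for A :: "nat \<Rightarrow> real set" and X Y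
  proof -
    obtain x where x: "x \<in> L2" "X = cls x" using XY(1) by (rule D_carrierE)
    obtain y where y: "y \<in> L2" "Y = cls y" using XY(2) by (rule D_carrierE)
    have Ab: "A i \<in> sets borel" for i using A(1) by auto
    have Ub: "(\<Union>n. A n) \<in> sets borel" using A(1) by auto
    have int: "integrable \<omega> (\<lambda>\<zeta>. hinner (H \<zeta>) (E \<zeta> B (x \<zeta>)) (y \<zeta>))" if "B \<in> sets borel" for B
      using E_L2[OF that x(1)] y(1) by simp
    have "(\<lambda>n. LINT \<zeta>|\<omega>. (\<Sum>i<n. hinner (H \<zeta>) (E \<zeta> (A i) (x \<zeta>)) (y \<zeta>)))
        \<longlonglongrightarrow> (LINT \<zeta>|\<omega>. hinner (H \<zeta>) (E \<zeta> (\<Union>n. A n) (x \<zeta>)) (y \<zeta>))"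
    proof (rule integral_dominated_convergence[where w = "\<lambda>\<zeta>. (hnorm (H \<zeta>) (x \<zeta>))\<^sup>2 + (hnorm (H \<zeta>) (y \<zeta>))\<^sup>2"])
      show "(\<lambda>\<zeta>. hinner (H \<zeta>) (E \<zeta> (\<Union>n. A n) (x \<zeta>)) (y \<zeta>)) \<in> borel_measurable \<omega>" using int[OF Ub] by auto
      show "(\<lambda>\<zeta>. \<Sum>i<n. hinner (H \<zeta>) (E \<zeta> (A i) (x \<zeta>)) (y \<zeta>)) \<in> borel_measurable \<omega>" for n
        using int[OF Ab] by auto
      show "integrable \<omega> (\<lambda>\<zeta>. (hnorm (H \<zeta>) (x \<zeta>))\<^sup>2 + (hnorm (H \<zeta>) (y \<zeta>))\<^sup>2)"
        using L2_integrable x y by simp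
      show "AE \<zeta> in \<omega>. (\<lambda>n. \<Sum>i<n. hinner (H \<zeta>) (E \<zeta> (A i) (x \<zeta>)) (y \<zeta>))
          \<longlonglongrightarrow> hinner (H \<zeta>) (E \<zeta> (\<Union>n. A n) (x \<zeta>)) (y \<zeta>)"
        using sp
      proof eventually_elim
        case (elim \<zeta>)
        show ?case using pvm.E_sums[OF F[OF elim] A FS[OF x(1) elim] FS[OF y(1) elim]] by (simp add: sums_def)
      qed
      show "AE \<zeta> in \<omega>. norm (\<Sum>i<n. hinner (H \<zeta>) (E \<zeta> (A i) (x \<zeta>)) (y \<zeta>))
          \<le> (hnorm (H \<zeta>) (x \<zeta>))\<^sup>2 + (hnorm (H \<zeta>) (y \<zeta>))\<^sup>2" for n
        using sp
      proof eventually_elim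
        case (elim \<zeta>)
        show ?case
          using pvm.E_partial_sum_bound[OF F[OF elim] A FS[OF x(1) elim] FS[OF y(1) elim], of n]
            sum_squares_bound[of "hnorm (H \<zeta>) (x \<zeta>)" "hnorm (H \<zeta>) (y \<zeta>)"] by linarith
      qed
    qed
    moreover have "(LINT \<zeta>|\<omega>. (\<Sum>i<n. hinner (H \<zeta>) (E \<zeta> (A i) (x \<zeta>)) (y \<zeta>))) = (\<Sum>i<n. hinner D (integral_pvm (A i) X) Y)" for n
      using int[OF Ab] x y by (simp add: integral_pvm_cls[OF Ab] D_inner E_L2[OF Ab])
    ultimately show ?thesis using x y by (simp add: sums_def integral_pvm_cls[OF Ub] D_inner E_L2[OF Ub])
  qed
  have ext: "integral_pvm \<in> sets borel \<rightarrow>\<^sub>E Collect (projection D)"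
    by (rule PiE_I) (use proj in \<open>auto simp: integral_pvm_def\<close>)
  have "projection_valued_measure D integral_pvm"
    unfolding projection_valued_measure_def
    by (intro conjI ballI allI impI ext one Int sums)
  then show ?thesis by unfold_locales
qed

lemma \<phi>_measurable:
  assumes f: "bounded_borel f" and x: "x \<in> S" and z: "z \<in> S"
  shows "(\<lambda>\<zeta>. \<phi> f \<zeta> (x \<zeta>) (z \<zeta>)) \<in> borel_measurable \<omega>"
  using f
proof (induction rule: bounded_borel_induct)
  case (ind B)
  have "(\<lambda>\<zeta>. hinner (H \<zeta>) (E \<zeta> B (x \<zeta>)) (z \<zeta>)) \<in> borel_measurable \<omega>"
    by (rule inner_measurable[OF measurable_bounded_fieldD(1)[OF E_measurable[OF ind] x] z])
  then show ?case
    by (simp add: pvm.sesq_indicator[OF fibre_pvm ind] x z cong: measurable_cong)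
next
  case (add f g)
  then show ?case
    by (simp add: pvm.sesq_add[OF fibre_pvm add(1,2)] x z cong: measurable_cong)
next
  case (scale c f)
  then show ?case
    by (simp add: pvm.sesq_scale[OF fibre_pvm] x z cong: measurable_cong)
next
  case (lim F f K)
  show ?case
    by (rule borel_measurable_LIMSEQ_metric[OF lim(5)])
      (rule pvm.sesq_lim[OF fibre_pvm lim(1-4)], auto simp: x z)
qed

lemma \<phi>_bound:
  assumes f: "bounded_borel f" and K: "\<And>t. \<bar>f t\<bar> \<le> K" and x: "x \<in> L2" and z: "z \<in> L2" and \<zeta>: "\<zeta> \<in> space \<omega>"
  shows "cmod (\<phi> f \<zeta> (x \<zeta>) (z \<zeta>)) \<le> K * ((hnorm (H \<zeta>) (x \<zeta>))\<^sup>2 + (hnorm (H \<zeta>) (z \<zeta>))\<^sup>2)"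
proof -
  have "0 \<le> K" using K[of 0] by linarith
  then have "K * (2 * hnorm (H \<zeta>) (x \<zeta>) * hnorm (H \<zeta>) (z \<zeta>)) \<le> K * ((hnorm (H \<zeta>) (x \<zeta>))\<^sup>2 + (hnorm (H \<zeta>) (z \<zeta>))\<^sup>2)"
    by (intro mult_left_mono sum_squares_bound)
  moreover have "cmod (\<phi> f \<zeta> (x \<zeta>) (z \<zeta>)) \<le> 2 * K * hnorm (H \<zeta>) (x \<zeta>) * hnorm (H \<zeta>) (z \<zeta>)"
    by (rule pvm.sesq_bound[OF fibre_pvm[OF \<zeta>] f K]) (use L2_S x z \<zeta> in auto)
  ultimately show ?thesis by (simp add: mult_ac)
qed

lemma \<phi>_integrable:
  assumes f: "bounded_borel f" and x: "x \<in> L2" and z: "z \<in> L2"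
  shows "integrable \<omega> (\<lambda>\<zeta>. \<phi> f \<zeta> (x \<zeta>) (z \<zeta>))"
proof -
  obtain K where K: "K > 0" "\<And>t. \<bar>f t\<bar> \<le> K" using bounded_borelE[OF f] by blast
  show ?thesis
  proof (rule Bochner_Integration.integrable_bound)
    show "integrable \<omega> (\<lambda>\<zeta>. K * ((hnorm (H \<zeta>) (x \<zeta>))\<^sup>2 + (hnorm (H \<zeta>) (z \<zeta>))\<^sup>2))"
      using L2_integrable x z by simp
    show "(\<lambda>\<zeta>. \<phi> f \<zeta> (x \<zeta>) (z \<zeta>)) \<in> borel_measurable \<omega>"
      by (rule \<phi>_measurable[OF f L2_S[OF x] L2_S[OF z]])
    show "AE \<zeta> in \<omega>. cmod (\<phi> f \<zeta> (x \<zeta>) (z \<zeta>)) \<le> norm (K * ((hnorm (H \<zeta>) (x \<zeta>))\<^sup>2 + (hnorm (H \<zeta>) (z \<zeta>))\<^sup>2))"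
      by (rule AE_I2, rule order_trans[OF \<phi>_bound[OF f K(2) x z]]) auto
  qed
qed

text \<open>The bounded calculus commutes with the direct integral: this holds for indicators by definition and
passes to limits by dominated convergence.\<close>

theorem sesq_integral_integral_pvm:
  assumes f: "bounded_borel f" and x: "x \<in> L2" and z: "z \<in> L2"
  shows "sesq_integral D integral_pvm f (cls x) (cls z) = (LINT \<zeta>|\<omega>. \<phi> f \<zeta> (x \<zeta>) (z \<zeta>))"
proof -
  interpret P: pvm D integral_pvm by (rule pvm_integral_pvm)
  have XZ: "cls x \<in> hcarrier D" "cls z \<in> hcarrier D" using x z by simp_all
  have FS: "x \<zeta> \<in> hcarrier (H \<zeta>)" "z \<zeta> \<in> hcarrier (H \<zeta>)" if "\<zeta> \<in> space \<omega>" for \<zeta> using x z L2_S that by auto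
  show ?thesis using f
  proof (induction rule: bounded_borel_induct)
    case (ind B)
    have "(LINT \<zeta>|\<omega>. \<phi> (indicator B) \<zeta> (x \<zeta>) (z \<zeta>)) = (LINT \<zeta>|\<omega>. hinner (H \<zeta>) (E \<zeta> B (x \<zeta>)) (z \<zeta>))"
      by (rule Bochner_Integration.integral_cong[OF refl]) (simp add: pvm.sesq_indicator[OF fibre_pvm ind] FS)
    then show ?case using x z ind by (simp add: P.sesq_indicator integral_pvm_cls D_inner E_L2)
  next
    case (add f g)
    have "(LINT \<zeta>|\<omega>. \<phi> (\<lambda>t. f t + g t) \<zeta> (x \<zeta>) (z \<zeta>)) = (LINT \<zeta>|\<omega>. \<phi> f \<zeta> (x \<zeta>) (z \<zeta>) + \<phi> g \<zeta> (x \<zeta>) (z \<zeta>))"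
      by (rule Bochner_Integration.integral_cong[OF refl]) (simp add: pvm.sesq_add[OF fibre_pvm add(1,2)] FS)
    then show ?case using add x z by (simp add: P.sesq_add \<phi>_integrable)
  next
    case (scale c f)
    have "(LINT \<zeta>|\<omega>. \<phi> (\<lambda>t. c * f t) \<zeta> (x \<zeta>) (z \<zeta>)) = (LINT \<zeta>|\<omega>. of_real c * \<phi> f \<zeta> (x \<zeta>) (z \<zeta>))"
      by (rule Bochner_Integration.integral_cong[OF refl]) (simp add: pvm.sesq_scale[OF fibre_pvm] FS)
    then show ?case using scale x z by (simp add: P.sesq_scale)
  next
    case (lim F f K)
    have "(\<lambda>n. LINT \<zeta>|\<omega>. \<phi> (F n) \<zeta> (x \<zeta>) (z \<zeta>)) \<longlonglongrightarrow> (LINT \<zeta>|\<omega>. \<phi> f \<zeta> (x \<zeta>) (z \<zeta>))"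
    proof (rule integral_dominated_convergence[where w = "\<lambda>\<zeta>. K * ((hnorm (H \<zeta>) (x \<zeta>))\<^sup>2 + (hnorm (H \<zeta>) (z \<zeta>))\<^sup>2)"])
      show "integrable \<omega> (\<lambda>\<zeta>. K * ((hnorm (H \<zeta>) (x \<zeta>))\<^sup>2 + (hnorm (H \<zeta>) (z \<zeta>))\<^sup>2))"
        using L2_integrable x z by simp
      show "AE \<zeta> in \<omega>. (\<lambda>n. \<phi> (F n) \<zeta> (x \<zeta>) (z \<zeta>)) \<longlonglongrightarrow> \<phi> f \<zeta> (x \<zeta>) (z \<zeta>)"
        by (rule AE_I2, rule pvm.sesq_lim[OF fibre_pvm lim(1-4)]) (simp_all add: FS)
      show "AE \<zeta> in \<omega>. norm (\<phi> (F n) \<zeta> (x \<zeta>) (z \<zeta>)) \<le> K * ((hnorm (H \<zeta>) (x \<zeta>))\<^sup>2 + (hnorm (H \<zeta>) (z \<zeta>))\<^sup>2)" for n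
        by (rule AE_I2, rule \<phi>_bound[OF lim(1) lim(3) x z])
    qed (use \<phi>_measurable lim(1,2) L2_S x z in auto)
    then have "(\<lambda>n. sesq_integral D integral_pvm (F n) (cls x) (cls z)) \<longlonglongrightarrow> (LINT \<zeta>|\<omega>. \<phi> f \<zeta> (x \<zeta>) (z \<zeta>))"
      unfolding lim(5) .
    then show ?case using P.sesq_lim[OF lim(1-4) XZ] LIMSEQ_unique by blast
  qed
qed

abbreviation fibre_calc :: "(real \<Rightarrow> real) \<Rightarrow> 'z \<Rightarrow> 'h \<Rightarrow> 'h" where
  "fibre_calc f \<zeta> \<equiv> hilbert_spectral_family.calc (H \<zeta>) (scalar_measure (H \<zeta>) (E \<zeta>)) f"

lemma fibre_calc_facts:
  assumes f: "bounded_borel f" and \<zeta>: "\<zeta> \<in> space \<omega>"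
  shows fibre_calc_bounded: "fibre_calc f \<zeta> \<in> bounded_operators (H \<zeta>)"
    and fibre_calc_mem: "x \<in> hcarrier (H \<zeta>) \<Longrightarrow> fibre_calc f \<zeta> x \<in> hcarrier (H \<zeta>)"
    and fibre_calc_inner: "x \<in> hcarrier (H \<zeta>) \<Longrightarrow> z \<in> hcarrier (H \<zeta>) \<Longrightarrow>
        hinner (H \<zeta>) (fibre_calc f \<zeta> x) z = \<phi> f \<zeta> x z"
    and fibre_calc_norm: "(\<And>t. \<bar>f t\<bar> \<le> K) \<Longrightarrow> x \<in> hcarrier (H \<zeta>) \<Longrightarrow>
        hnorm (H \<zeta>) (fibre_calc f \<zeta> x) \<le> 2 * K * hnorm (H \<zeta>) x"
proof -
  interpret P: hilbert_pvm "H \<zeta>" "E \<zeta>" by (rule fibre_hilbert_pvm[OF \<zeta>])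
  show "fibre_calc f \<zeta> \<in> bounded_operators (H \<zeta>)" by (rule P.calc_bounded[OF f])
  show "x \<in> hcarrier (H \<zeta>) \<Longrightarrow> fibre_calc f \<zeta> x \<in> hcarrier (H \<zeta>)" by (rule P.calc_mem[OF f])
  show "x \<in> hcarrier (H \<zeta>) \<Longrightarrow> z \<in> hcarrier (H \<zeta>) \<Longrightarrow> hinner (H \<zeta>) (fibre_calc f \<zeta> x) z = \<phi> f \<zeta> x z"
    unfolding P.sesq_integral_eq_form by (rule P.calc_inner[OF f])
  show "(\<And>t. \<bar>f t\<bar> \<le> K) \<Longrightarrow> x \<in> hcarrier (H \<zeta>) \<Longrightarrow> hnorm (H \<zeta>) (fibre_calc f \<zeta> x) \<le> 2 * K * hnorm (H \<zeta>) x"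
    by (rule P.calc_norm[OF f])
qed

lemma fibre_calc_S:
  assumes f: "bounded_borel f" and x: "x \<in> S" shows "(\<lambda>\<zeta>. fibre_calc f \<zeta> (x \<zeta>)) \<in> S"
proof (rule S_I)
  show "fibre_calc f \<zeta> (x \<zeta>) \<in> hcarrier (H \<zeta>)" if "\<zeta> \<in> space \<omega>" for \<zeta>
    using fibre_calc_mem[OF f that] x that by simp
  show "(\<lambda>\<zeta>. hinner (H \<zeta>) (fibre_calc f \<zeta> (x \<zeta>)) (z \<zeta>)) \<in> borel_measurable \<omega>" if "z \<in> S" for z
    using \<phi>_measurable[OF f x that] x that by (simp add: fibre_calc_inner[OF f] cong: measurable_cong)
qed

lemma fibre_calc_L2:
  assumes f: "bounded_borel f" and x: "x \<in> L2" shows "(\<lambda>\<zeta>. fibre_calc f \<zeta> (x \<zeta>)) \<in> L2"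
proof -
  obtain K where K: "\<And>t. \<bar>f t\<bar> \<le> K" using bounded_borelE[OF f] by blast
  show ?thesis
    by (rule L2_bound_field[OF fibre_calc_S[OF f L2_S[OF x]] x, of "2 * K"])
      (rule fibre_calc_norm[OF f _ K], auto simp: L2_S[OF x])
qed

lemma fibre_calc_measurable: "bounded_borel f \<Longrightarrow> measurable_bounded_field \<omega> H S (fibre_calc f)"
  unfolding measurable_bounded_field_def using fibre_calc_S fibre_calc_bounded by blast

lemma hopnorm_E_le: "B \<in> sets borel \<Longrightarrow> \<zeta> \<in> space \<omega> \<Longrightarrow> hopnorm (H \<zeta>) (E \<zeta> B) \<le> 1"
proof -
  assume B: "B \<in> sets borel" and \<zeta>: "\<zeta> \<in> space \<omega>"
  interpret P: pvm "H \<zeta>" "E \<zeta>" by (rule fibre_pvm[OF \<zeta>])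
  show ?thesis unfolding hopnorm_def
  proof (rule cSUP_least)
    show "{x \<in> hcarrier (H \<zeta>). hnorm (H \<zeta>) x \<le> 1} \<noteq> {}"
      using P.zero_mem P.hnorm_zero by (metis (mono_tags, lifting) empty_Collect_eq zero_le_one)
    show "hnorm (H \<zeta>) (E \<zeta> B x) \<le> 1" if "x \<in> {x \<in> hcarrier (H \<zeta>). hnorm (H \<zeta>) x \<le> 1}" for x
      using P.E_norm[OF B, of x] that by auto
  qed
qed

theorem bounded_integral_integral_pvm:
  assumes B: "B \<in> sets borel"
  shows "is_bounded_integral \<omega> H S (integral_pvm B) (\<lambda>\<zeta>. E \<zeta> B)"
  unfolding is_bounded_integral_def
  by (intro exI[of _ "\<lambda>\<zeta>. E \<zeta> B"] conjI exI[of _ 1] E_measurable[OF B] AE_I2 hopnorm_E_le[OF B] refl)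
    (simp_all add: integral_pvm_def B)

text \<open>The entries of the graph projection are \<open>res0(f)\<close>, \<open>res1(f)\<close> and \<open>f res1(f)\<close> of the fibre measure, and
bounded functions of a measurable field of projection-valued measures are measurable fields.\<close>

theorem measurable_closed_field_spectral_integral:
  assumes f: "f \<in> borel_measurable borel"
  shows "measurable_closed_field \<omega> H S (\<lambda>\<zeta>. spectral_integral (H \<zeta>) (E \<zeta>) f)"
proof -
  let ?G = "\<lambda>\<zeta>. spectral_integral (H \<zeta>) (E \<zeta>) f"
  let ?u = "\<lambda>t. res0 (f t)" and ?v = "\<lambda>t. res1 (f t)" and ?w = "\<lambda>t. f t * res1 (f t)"
  have ent: "(\<lambda>x\<in>hcarrier (H \<zeta>). fst (graph_projection (H \<zeta>) (?G \<zeta>) (x, hzero (H \<zeta>)))) = fibre_calc ?u \<zeta>"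
    "(\<lambda>x\<in>hcarrier (H \<zeta>). fst (graph_projection (H \<zeta>) (?G \<zeta>) (hzero (H \<zeta>), x))) = fibre_calc ?v \<zeta>"
    "(\<lambda>x\<in>hcarrier (H \<zeta>). snd (graph_projection (H \<zeta>) (?G \<zeta>) (x, hzero (H \<zeta>)))) = fibre_calc ?v \<zeta>"
    "(\<lambda>x\<in>hcarrier (H \<zeta>). snd (graph_projection (H \<zeta>) (?G \<zeta>) (hzero (H \<zeta>), x))) = fibre_calc ?w \<zeta>"
    if \<zeta>: "\<zeta> \<in> space \<omega>" for \<zeta>
  proof -
    interpret P: hilbert_pvm "H \<zeta>" "E \<zeta>" by (rule fibre_hilbert_pvm[OF \<zeta>])
    have z0: "P.form g (hzero (H \<zeta>)) z = 0" if "bounded_borel g" "z \<in> hcarrier (H \<zeta>)" for g z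
      using P.form_addl[OF that(1), of "hzero (H \<zeta>)" "hzero (H \<zeta>)" z] P.vec_zero[of "hzero (H \<zeta>)"] that by simp
    have c0: "P.calc g (hzero (H \<zeta>)) = hzero (H \<zeta>)" if "bounded_borel g" for g
      by (rule P.vec_eqI) (use that in \<open>simp_all add: z0\<close>)
    have zl: "hadd (H \<zeta>) (hzero (H \<zeta>)) x = x" "hadd (H \<zeta>) x (hzero (H \<zeta>)) = x" if "x \<in> hcarrier (H \<zeta>)" for x
      using P.vec_zero[OF that] P.vec_commute[OF that P.zero_mem] by simp_all
    have off: "P.calc g x = undefined" if "x \<notin> hcarrier (H \<zeta>)" for g x using that by (simp add: P.calc_def)
    show "(\<lambda>x\<in>hcarrier (H \<zeta>). fst (graph_projection (H \<zeta>) (?G \<zeta>) (x, hzero (H \<zeta>)))) = fibre_calc ?u \<zeta>"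
      "(\<lambda>x\<in>hcarrier (H \<zeta>). fst (graph_projection (H \<zeta>) (?G \<zeta>) (hzero (H \<zeta>), x))) = fibre_calc ?v \<zeta>"
      "(\<lambda>x\<in>hcarrier (H \<zeta>). snd (graph_projection (H \<zeta>) (?G \<zeta>) (x, hzero (H \<zeta>)))) = fibre_calc ?v \<zeta>"
      "(\<lambda>x\<in>hcarrier (H \<zeta>). snd (graph_projection (H \<zeta>) (?G \<zeta>) (hzero (H \<zeta>), x))) = fibre_calc ?w \<zeta>"
      using f by (auto simp: fun_eq_iff P.graph_projection_spectral_integral[OF f] c0 zl off)
  qed
  show ?thesis unfolding measurable_closed_field_def
  proof (intro conjI ballI)
    show "closed_operator (H \<zeta>) (?G \<zeta>)" if "\<zeta> \<in> space \<omega>" for \<zeta>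
      by (rule pvm.spectral_integral_closed[OF fibre_pvm[OF that] f fibre[OF that]])
  qed (rule measurable_bounded_field_cong[OF ent(1)[symmetric] fibre_calc_measurable]
      measurable_bounded_field_cong[OF ent(2)[symmetric] fibre_calc_measurable]
      measurable_bounded_field_cong[OF ent(3)[symmetric] fibre_calc_measurable]
      measurable_bounded_field_cong[OF ent(4)[symmetric] fibre_calc_measurable], assumption, simp add: f)+
qed

text \<open>Membership in \<open>\<integral> f dE\<close> is, both in the fibres and in the direct integral, the equation
\<open>res0(f)(E) y = res1(f)(E) x\<close> between bounded functions. If it holds in the direct integral, the field
\<open>d\<close> of differences of the two sides is square integrable and has norm 0, so the equation holds in almost
every fibre; on the remaining null set the representatives are replaced by zero.\<close>

theorem spectral_integral_integral_pvm:
  assumes f: "f \<in> borel_measurable borel"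
  shows "spectral_integral D integral_pvm f = closed_integral_operator \<omega> H S (\<lambda>\<zeta>. spectral_integral (H \<zeta>) (E \<zeta>) f)"
proof -
  interpret P: pvm D integral_pvm by (rule pvm_integral_pvm)
  let ?G = "\<lambda>\<zeta>. spectral_integral (H \<zeta>) (E \<zeta>) f"
  let ?u = "\<lambda>t. res0 (f t)" and ?v = "\<lambda>t. res1 (f t)"
  have bb: "bounded_borel ?u" "bounded_borel ?v" using f by simp_all
  have G: "(x, y) \<in> ?G \<zeta> \<longleftrightarrow> x \<in> hcarrier (H \<zeta>) \<and> y \<in> hcarrier (H \<zeta>) \<and> (\<forall>z\<in>hcarrier (H \<zeta>). \<phi> ?u \<zeta> y z = \<phi> ?v \<zeta> x z)"
    if "\<zeta> \<in> space \<omega>" for \<zeta> x y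
  proof -
    interpret F: pvm "H \<zeta>" "E \<zeta>" by (rule fibre_pvm[OF that])
    show ?thesis using F.spectral_integral_iff[OF f, of x y] by (simp add: F.sesq_integral_eq_form)
  qed
  have DG: "(X, Y) \<in> spectral_integral D integral_pvm f \<longleftrightarrow> X \<in> hcarrier D \<and> Y \<in> hcarrier D \<and>
      (\<forall>Z\<in>hcarrier D. sesq_integral D integral_pvm ?u Y Z = sesq_integral D integral_pvm ?v X Z)" for X Y
    using P.spectral_integral_iff[OF f, of X Y] by (simp add: P.sesq_integral_eq_form)
  show ?thesis
  proof (rule set_eqI, clarify, rule iffI)
    fix X Y assume "(X, Y) \<in> closed_integral_operator \<omega> H S ?G"
    then obtain x y where xy: "x \<in> L2" "y \<in> L2" "X = cls x" "Y = cls y" "\<And>\<zeta>. \<zeta> \<in> space \<omega> \<Longrightarrow> (x \<zeta>, y \<zeta>) \<in> ?G \<zeta>"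
      by (auto simp: closed_integral_operator_def)
    have "sesq_integral D integral_pvm ?u Y Z = sesq_integral D integral_pvm ?v X Z" if Z: "Z \<in> hcarrier D" for Z
    proof -
      obtain z where z: "z \<in> L2" "Z = cls z" using Z by (rule D_carrierE)
      show ?thesis unfolding xy(3,4) z(2) sesq_integral_integral_pvm[OF bb(1) xy(2) z(1)] sesq_integral_integral_pvm[OF bb(2) xy(1) z(1)]
        by (rule Bochner_Integration.integral_cong[OF refl]) (use xy(5) G S_mem[OF L2_S[OF z(1)]] in blast)
    qed
    then show "(X, Y) \<in> spectral_integral D integral_pvm f" unfolding DG using xy by simp
  next
    fix X Y assume "(X, Y) \<in> spectral_integral D integral_pvm f"
    then have XY: "X \<in> hcarrier D" "Y \<in> hcarrier D"
      "\<And>Z. Z \<in> hcarrier D \<Longrightarrow> sesq_integral D integral_pvm ?u Y Z = sesq_integral D integral_pvm ?v X Z" unfolding DG by auto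
    obtain x where x: "x \<in> L2" "X = cls x" using XY(1) by (rule D_carrierE)
    obtain y where y: "y \<in> L2" "Y = cls y" using XY(2) by (rule D_carrierE)
    define d where "d \<zeta> = hdiff (H \<zeta>) (fibre_calc ?u \<zeta> (y \<zeta>)) (fibre_calc ?v \<zeta> (x \<zeta>))" for \<zeta>
    have d: "d \<in> L2" unfolding d_def[abs_def]
      by (intro L2_add L2_scale fibre_calc_L2 bb x y)
    have FS: "x \<zeta> \<in> hcarrier (H \<zeta>)" "y \<zeta> \<in> hcarrier (H \<zeta>)" "d \<zeta> \<in> hcarrier (H \<zeta>)" if "\<zeta> \<in> space \<omega>" for \<zeta>
      using x y d L2_S that by auto
    have dz: "hinner (H \<zeta>) (d \<zeta>) z = \<phi> ?u \<zeta> (y \<zeta>) z - \<phi> ?v \<zeta> (x \<zeta>) z"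
      if "\<zeta> \<in> space \<omega>" "z \<in> hcarrier (H \<zeta>)" for \<zeta> z
    proof -
      interpret F: inner_space "H \<zeta>" by (rule fibre_inner[OF that(1)])
      show ?thesis unfolding d_def using that FS fibre_calc_mem[OF bb(1) that(1)] fibre_calc_mem[OF bb(2) that(1)]
        by (simp add: fibre_calc_inner[OF bb(1)] fibre_calc_inner[OF bb(2)])
    qed
    have "hinner D (cls d) (cls d) = (LINT \<zeta>|\<omega>. \<phi> ?u \<zeta> (y \<zeta>) (d \<zeta>) - \<phi> ?v \<zeta> (x \<zeta>) (d \<zeta>))"
      unfolding D_inner[OF d d] by (rule Bochner_Integration.integral_cong[OF refl]) (rule dz, auto simp: FS)
    also have "\<dots> = sesq_integral D integral_pvm ?u Y (cls d) - sesq_integral D integral_pvm ?v X (cls d)"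
      using x y d by (simp add: sesq_integral_integral_pvm bb \<phi>_integrable)
    also have "\<dots> = 0" using XY(3)[of "cls d"] d by simp
    finally have "cls d = hzero D" using P.inner_def0 d by simp
    then have "AE \<zeta> in \<omega>. d \<zeta> = hzero (H \<zeta>)" using cls_eq_iff[OF d] by (simp add: D_zero)
    then have "AE \<zeta> in \<omega>. (x \<zeta>, y \<zeta>) \<in> ?G \<zeta>" using AE_space
    proof eventually_elim
      case (elim \<zeta>)
      interpret F: inner_space "H \<zeta>" by (rule fibre_inner[OF elim(2)])
      have "\<phi> ?u \<zeta> (y \<zeta>) z = \<phi> ?v \<zeta> (x \<zeta>) z" if "z \<in> hcarrier (H \<zeta>)" for z
        using dz[OF elim(2) that] elim(1) that by simp
      then show ?case using G[OF elim(2)] FS[OF elim(2)] by simp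
    qed
    then obtain N where N: "N \<in> null_sets \<omega>" "{\<zeta> \<in> space \<omega>. (x \<zeta>, y \<zeta>) \<notin> ?G \<zeta>} \<subseteq> N"
      by (auto simp: eventually_ae_filter)
    let ?x = "\<lambda>\<zeta>. if \<zeta> \<in> N then hzero (H \<zeta>) else x \<zeta>" and ?y = "\<lambda>\<zeta>. if \<zeta> \<in> N then hzero (H \<zeta>) else y \<zeta>"
    have ae: "AE \<zeta> in \<omega>. \<zeta> \<notin> N" using N(1) by (rule AE_not_in)
    have "cls ?x = X" "cls ?y = Y" unfolding x(2) y(2)
      by (rule cls_eqI, use ae in eventually_elim, simp)+
    moreover have "?x \<in> L2" "?y \<in> L2" using L2_if x y N(1) by auto
    moreover have "(?x \<zeta>, ?y \<zeta>) \<in> ?G \<zeta>" if \<zeta>: "\<zeta> \<in> space \<omega>" for \<zeta>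
    proof (cases "\<zeta> \<in> N")
      case True
      interpret F: pvm "H \<zeta>" "E \<zeta>" by (rule fibre_pvm[OF \<zeta>])
      have "(hzero (H \<zeta>), hzero (H \<zeta>)) \<in> ?G \<zeta>"
        using F.spectral_integral_linear[OF f] by (simp add: linear_operator_def hsubspace_def)
      then show ?thesis using True by simp
    next
      case False then show ?thesis using N(2) \<zeta> by auto
    qed
    ultimately show "(X, Y) \<in> closed_integral_operator \<omega> H S ?G"
      unfolding closed_integral_operator_def by blast
  qed
qed

end

section \<open>Self-adjointness read off from the graph projection\<close>

lemma (in inner_space) bounded_operator_facts:
  assumes A: "A \<in> bounded_operators H"
  shows "x \<in> V \<Longrightarrow> A x \<in> V"
    and "x \<in> V \<Longrightarrow> y \<in> V \<Longrightarrow> A (hadd H x y) = hadd H (A x) (A y)"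
    and "x \<in> V \<Longrightarrow> A (hscale H c x) = hscale H c (A x)"
  using A unfolding bounded_operators_def by (auto dest: PiE_mem)

lemma (in inner_space) bounded_operator_tendsto:
  assumes A: "A \<in> bounded_operators H" and s: "\<And>n. s n \<in> V" and x: "x \<in> V"
    and lim: "(\<lambda>n. hdist H (s n) x) \<longlonglongrightarrow> 0"
  shows "(\<lambda>n. hdist H (A (s n)) (A x)) \<longlonglongrightarrow> 0"
proof -
  note bo = bounded_operator_facts[OF A]
  obtain K where K: "\<And>x. x \<in> V \<Longrightarrow> hnorm H (A x) \<le> K * hnorm H x"
    using A unfolding bounded_operators_def by blast
  have le: "hdist H (A (s n)) (A x) \<le> hdist H (s n) x * K" for n
    using K[of "hdiff H (s n) x"] s[of n] x by (simp add: hdist_eq bo mult.commute)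
  show ?thesis
    by (rule tendsto_sandwich[OF _ _ tendsto_const tendsto_mult_left_zero[OF lim, of K]])
      (simp_all add: le)
qed

lemma (in inner_space) diff_tendsto:
  assumes s: "\<And>n. s n \<in> V" "x \<in> V" "(\<lambda>n. hdist H (s n) x) \<longlonglongrightarrow> 0"
    and t: "\<And>n. t n \<in> V" "y \<in> V" "(\<lambda>n. hdist H (t n) y) \<longlonglongrightarrow> 0"
  shows "(\<lambda>n. hdist H (hdiff H (s n) (t n)) (hdiff H x y)) \<longlonglongrightarrow> 0"
proof -
  have le: "hdist H (hdiff H (s n) (t n)) (hdiff H x y) \<le> hdist H (s n) x + hdist H (t n) y" for n
  proof -
    have "hdiff H (hdiff H (s n) (t n)) (hdiff H x y) = hadd H (hdiff H (s n) x) (hscale H (- 1) (hdiff H (t n) y))"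
      by (rule vec_eqI) (use s t in \<open>simp_all add: algebra_simps\<close>)
    then show ?thesis
      using s t hnorm_triangle[of "hdiff H (s n) x" "hscale H (- 1) (hdiff H (t n) y)"]
      by (simp add: hdist_eq hnorm_scale[of "hdiff H (t n) y"])
  qed
  show ?thesis
    by (rule tendsto_sandwich[OF _ _ tendsto_const tendsto_add_zero[OF s(3) t(3)]])
      (simp_all add: le)
qed

lemma hsum_tendsto:
  assumes H: "inner_space H" and mem: "\<And>n. a n \<in> hcarrier H" "\<And>n. b n \<in> hcarrier H" "x \<in> hcarrier H" "y \<in> hcarrier H"
    and lim: "(\<lambda>n. hdist H (a n) x) \<longlonglongrightarrow> 0" "(\<lambda>n. hdist H (b n) y) \<longlonglongrightarrow> 0"
  shows "(\<lambda>n. hdist (hsum H H) (a n, b n) (x, y)) \<longlonglongrightarrow> 0"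
proof -
  interpret S: inner_space "hsum H H" by (rule inner_space_hsum[OF H H])
  have "(hdist (hsum H H) (a n, b n) (x, y))\<^sup>2 = (hdist H (a n) x)\<^sup>2 + (hdist H (b n) y)\<^sup>2" for n
    using hsum_dist_sq[OF H H, of "(a n, b n)" "(x, y)"] mem by simp
  then have "hdist (hsum H H) (a n, b n) (x, y) = sqrt ((hdist H (a n) x)\<^sup>2 + (hdist H (b n) y)\<^sup>2)" for n
    by (metis S.M.nonneg real_sqrt_unique)
  moreover have "(\<lambda>n. sqrt ((hdist H (a n) x)\<^sup>2 + (hdist H (b n) y)\<^sup>2)) \<longlonglongrightarrow> sqrt (0\<^sup>2 + 0\<^sup>2)"
    by (intro tendsto_intros lim)
  ultimately show ?thesis by simp
qed

lemma (in hilbert_space) graph_projection: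
  assumes T: "closed_operator H T" and q: "q \<in> V \<times> V"
  shows "graph_projection H T q \<in> T"
    and "g \<in> T \<Longrightarrow> hinner (hsum H H) q g = hinner (hsum H H) (graph_projection H T q) g"
    and "hnorm (hsum H H) (graph_projection H T q) \<le> hnorm (hsum H H) q"
proof -
  interpret HH: hilbert_space "hsum H H" by (rule hilbert_space_hsum) unfold_locales
  have sub: "hsubspace (hsum H H) T" and cl: "closedin (htopology (hsum H H)) T"
    using T by (auto simp: closed_operator_def linear_operator_def)
  have qH: "q \<in> hcarrier (hsum H H)" using q by simp
  obtain p where p: "p \<in> T" "\<And>g. g \<in> T \<Longrightarrow> hinner (hsum H H) q g = hinner (hsum H H) p g"
    using HH.projection_exists[OF sub cl qH] by blast
  have "hproj (hsum H H) T q = p" by (rule HH.hproj_eqI[OF sub p])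
  then have gp: "graph_projection H T q = p" by (simp add: graph_projection_def)
  show "graph_projection H T q \<in> T"
    and "g \<in> T \<Longrightarrow> hinner (hsum H H) q g = hinner (hsum H H) (graph_projection H T q) g"
    using p unfolding gp by auto
  have pH: "p \<in> hcarrier (hsum H H)" using p(1) HH.hsub_mem[OF sub] by blast
  show "hnorm (hsum H H) (graph_projection H T q) \<le> hnorm (hsum H H) q"
  proof (cases "hnorm (hsum H H) p = 0")
    case True then show ?thesis using HH.hnorm_nonneg[OF qH] by (simp add: gp)
  next
    case False
    have "complex_of_real ((hnorm (hsum H H) p)\<^sup>2) = hinner (hsum H H) q p"
      using p(2)[OF p(1)] HH.inner_self[OF pH] by (simp only:)
    then have "cmod (hinner (hsum H H) q p) = (hnorm (hsum H H) p)\<^sup>2" by (metis abs_power2 norm_of_real)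
    then have "(hnorm (hsum H H) p)\<^sup>2 \<le> hnorm (hsum H H) q * hnorm (hsum H H) p"
      using HH.cauchy_schwarz[OF qH pH] by simp
    then show ?thesis using False HH.hnorm_nonneg[OF pH] by (simp add: gp power2_eq_square less_le)
  qed
qed

locale graph_entries = hilbert_space H for H :: "'v hspace" +
  fixes T :: "'v operator" and P11 P12 P21 P22 :: "'v \<Rightarrow> 'v"
  assumes closed: "closed_operator H T"
    and P11_def: "P11 = (\<lambda>x\<in>hcarrier H. fst (graph_projection H T (x, hzero H)))"
    and P12_def: "P12 = (\<lambda>x\<in>hcarrier H. fst (graph_projection H T (hzero H, x)))"
    and P21_def: "P21 = (\<lambda>x\<in>hcarrier H. snd (graph_projection H T (x, hzero H)))"
    and P22_def: "P22 = (\<lambda>x\<in>hcarrier H. snd (graph_projection H T (hzero H, x)))"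
    and bounded: "P11 \<in> bounded_operators H" "P12 \<in> bounded_operators H"
      "P21 \<in> bounded_operators H" "P22 \<in> bounded_operators H"
begin

lemma T_linear: "linear_operator H T"
  using closed by (simp add: closed_operator_def)

lemmas T_carrier = linear_operator_mem[OF T_linear]
  and T_addI = linear_operator_add[OF T_linear]
  and T_scaleI = linear_operator_scale[OF T_linear]

lemmas P11 = bounded_operator_facts[OF bounded(1)]
  and P12 = bounded_operator_facts[OF bounded(2)]
  and P21 = bounded_operator_facts[OF bounded(3)]
  and P22 = bounded_operator_facts[OF bounded(4)]

lemma column1: "x \<in> V \<Longrightarrow> (P11 x, P21 x) \<in> T"
  and column2: "x \<in> V \<Longrightarrow> (P12 x, P22 x) \<in> T"
  using graph_projection(1)[OF closed, of "(x, hzero H)"] graph_projection(1)[OF closed, of "(hzero H, x)"]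
  by (simp_all add: P11_def P12_def P21_def P22_def)

lemma orthogonal1: "x \<in> V \<Longrightarrow> (y, u) \<in> T \<Longrightarrow> hinner H x y = hinner H (P11 x) y + hinner H (P21 x) u"
  and orthogonal2: "x \<in> V \<Longrightarrow> (y, u) \<in> T \<Longrightarrow> hinner H x u = hinner H (P12 x) y + hinner H (P22 x) u"
  using graph_projection(2)[OF closed, of "(x, hzero H)" "(y, u)"] graph_projection(2)[OF closed, of "(hzero H, x)" "(y, u)"]
    T_carrier[of y u]
  by (simp_all add: P11_def P12_def P21_def P22_def)

lemma entries_norm:
  assumes x: "x \<in> V"
  shows "hnorm H (P11 x) \<le> hnorm H x" "hnorm H (P12 x) \<le> hnorm H x" "hnorm H (P21 x) \<le> hnorm H x" "hnorm H (P22 x) \<le> hnorm H x"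
proof -
  have le: "hnorm H a \<le> hnorm (hsum H H) (a, b)" "hnorm H b \<le> hnorm (hsum H H) (a, b)" if "a \<in> V" "b \<in> V" for a b
    using that inner_pos by (simp_all add: hnorm_def)
  have eq: "hnorm (hsum H H) (x, hzero H) = hnorm H x" "hnorm (hsum H H) (hzero H, x) = hnorm H x"
    by (simp_all add: hnorm_def x)
  have 1: "hnorm (hsum H H) (P11 x, P21 x) \<le> hnorm H x"
    using graph_projection(3)[OF closed, of "(x, hzero H)"] x by (simp add: P11_def P21_def eq)
  have 2: "hnorm (hsum H H) (P12 x, P22 x) \<le> hnorm H x"
    using graph_projection(3)[OF closed, of "(hzero H, x)"] x by (simp add: P12_def P22_def eq)
  show "hnorm H (P11 x) \<le> hnorm H x" "hnorm H (P21 x) \<le> hnorm H x"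
    using le[OF P11(1)[OF x] P21(1)[OF x]] 1 by linarith+
  show "hnorm H (P12 x) \<le> hnorm H x" "hnorm H (P22 x) \<le> hnorm H x"
    using le[OF P12(1)[OF x] P22(1)[OF x]] 2 by linarith+
qed

text \<open>The first relation says that \<open>(P21 h, h - P11 h)\<close>, which always lies in the graph of the adjoint, lies in
\<open>T\<close>; the other two that the columns of the projection, which always lie in \<open>T\<close>, lie in the graph of the
adjoint. Together, for all \<open>h\<close>, they express self-adjointness. For a single \<open>h\<close> they are a closed linear
condition and involve nothing but the bounded entries and \<open>T\<close>; hence vectors with dense linear span suffice
to test them.\<close>

definition adjoint_relations :: "'v \<Rightarrow> bool" where
  "adjoint_relations h \<longleftrightarrow> h \<in> V \<and> (P21 h, hdiff H h (P11 h)) \<in> T \<and>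
    (\<forall>y u. (y, u) \<in> T \<longrightarrow> hinner H (P11 h) u = hinner H (P21 h) y \<and> hinner H (P12 h) u = hinner H (P22 h) y)"

lemma adjoint_relations_scale: assumes "adjoint_relations h" shows "adjoint_relations (hscale H c h)"
proof -
  have h: "h \<in> V" using assms by (simp add: adjoint_relations_def)
  have "(hscale H c (P21 h), hscale H c (hdiff H h (P11 h))) \<in> T" using assms by (simp add: adjoint_relations_def T_scaleI)
  moreover have "hscale H c (hdiff H h (P11 h)) = hdiff H (hscale H c h) (hscale H c (P11 h))"
    by (rule vec_eqI) (use h P11(1)[OF h] in \<open>simp_all add: algebra_simps\<close>)
  ultimately show ?thesis
    using assms T_carrier h P11(1) P12(1) P21(1) P22(1) by (auto simp: adjoint_relations_def P11(3) P12(3) P21(3) P22(3))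
qed

lemma adjoint_relations_add: assumes "adjoint_relations h" "adjoint_relations k" shows "adjoint_relations (hadd H h k)"
proof -
  have h: "h \<in> V" "k \<in> V" using assms by (auto simp: adjoint_relations_def)
  have "(hadd H (P21 h) (P21 k), hadd H (hdiff H h (P11 h)) (hdiff H k (P11 k))) \<in> T"
    using assms by (simp add: adjoint_relations_def T_addI)
  moreover have "hadd H (hdiff H h (P11 h)) (hdiff H k (P11 k)) = hdiff H (hadd H h k) (hadd H (P11 h) (P11 k))"
    by (rule vec_eqI) (use h P11(1) in \<open>simp_all add: algebra_simps\<close>)
  ultimately show ?thesis
    using assms T_carrier h P11(1) P12(1) P21(1) P22(1) by (auto simp: adjoint_relations_def P11(2) P12(2) P21(2) P22(2))
qed

lemma adjoint_relations_limit:
  assumes s: "\<And>n. adjoint_relations (s n)" and h: "h \<in> V" and lim: "(\<lambda>n. hdist H (s n) h) \<longlonglongrightarrow> 0"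
  shows "adjoint_relations h"
proof -
  have sV: "s n \<in> V" for n using s by (simp add: adjoint_relations_def)
  note bt = bounded_operator_tendsto[OF _ sV h lim]
  have l1: "(\<lambda>n. hdist H (P21 (s n)) (P21 h)) \<longlonglongrightarrow> 0" by (rule bt[OF bounded(3)])
  have l2: "(\<lambda>n. hdist H (hdiff H (s n) (P11 (s n))) (hdiff H h (P11 h))) \<longlonglongrightarrow> 0"
    by (rule diff_tendsto[OF sV h lim _ _ bt[OF bounded(1)]]) (simp_all add: P11(1) sV h)
  have "(\<lambda>n. hdist (hsum H H) (P21 (s n), hdiff H (s n) (P11 (s n))) (P21 h, hdiff H h (P11 h))) \<longlonglongrightarrow> 0"
    by (rule hsum_tendsto[OF inner_space_axioms _ _ _ _ l1 l2]) (simp_all add: P11(1) P21(1) sV h)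
  moreover have "(P21 (s n), hdiff H (s n) (P11 (s n))) \<in> T" for n using s by (simp add: adjoint_relations_def)
  ultimately have 1: "(P21 h, hdiff H h (P11 h)) \<in> T"
  proof -
    interpret HH: hilbert_space "hsum H H" by (rule hilbert_space_hsum) unfold_locales
    assume lim: "(\<lambda>n. hdist (hsum H H) (P21 (s n), hdiff H (s n) (P11 (s n))) (P21 h, hdiff H h (P11 h))) \<longlonglongrightarrow> 0"
      and m: "\<And>n. (P21 (s n), hdiff H (s n) (P11 (s n))) \<in> T"
    have cl: "closedin (htopology (hsum H H)) T" using closed by (simp add: closed_operator_def)
    have "range (\<lambda>n. (P21 (s n), hdiff H (s n) (P11 (s n)))) \<subseteq> T" using m by auto
    moreover have "(P21 h, hdiff H h (P11 h)) \<in> hcarrier (hsum H H)" by (simp add: h P11(1) P21(1))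
    ultimately show ?thesis
      using cl[unfolded HH.closedin_iff_seq, THEN conjunct2, rule_format,
          of "\<lambda>n. (P21 (s n), hdiff H (s n) (P11 (s n)))" "(P21 h, hdiff H h (P11 h))"] lim by blast
  qed
  have "hinner H (P11 h) u = hinner H (P21 h) y \<and> hinner H (P12 h) u = hinner H (P22 h) y" if yu: "(y, u) \<in> T" for y u
  proof
    have V: "y \<in> V" "u \<in> V" using T_carrier yu by auto
    have t: "(\<lambda>n. hinner H (A (s n)) z) \<longlonglongrightarrow> hinner H (A h) z" if "A \<in> bounded_operators H" "z \<in> V" for A z
      by (rule inner_tendsto[OF _ _ that(2) bt[OF that(1)]]) (simp_all add: bounded_operator_facts[OF that(1)] sV h)
    have "hinner H (P11 (s n)) u = hinner H (P21 (s n)) y" "hinner H (P12 (s n)) u = hinner H (P22 (s n)) y" for n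
      using s[of n] yu by (auto simp: adjoint_relations_def)
    then show "hinner H (P11 h) u = hinner H (P21 h) y" "hinner H (P12 h) u = hinner H (P22 h) y"
      using t[OF bounded(1) V(2)] t[OF bounded(3) V(1)] t[OF bounded(2) V(2)] t[OF bounded(4) V(1)]
      by (auto intro: LIMSEQ_unique)
  qed
  then show ?thesis using 1 h by (simp add: adjoint_relations_def)
qed

lemma adjoint_relations_all:
  assumes dense: "hdense H (hsubspace H hull A)" and A: "\<And>x. x \<in> A \<Longrightarrow> adjoint_relations x" and h: "h \<in> V"
  shows "adjoint_relations h"
proof -
  have 0: "adjoint_relations (hzero H)"
  proof -
    have zz: "hscale H 0 (hzero H) = hzero H" by (rule vec_eqI) simp_all
    have P0: "B (hzero H) = hzero H" if B: "B \<in> bounded_operators H" for B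
    proof (rule vec_eqI)
      show m: "B (hzero H) \<in> V" by (rule bounded_operator_facts(1)[OF B zero_mem])
      have e: "B (hzero H) = hscale H 0 (B (hzero H))"
        using bounded_operator_facts(3)[OF B zero_mem, of 0] zz by simp
      show "hinner H (B (hzero H)) z = hinner H (hzero H) z" if "z \<in> V" for z
        by (subst e) (simp add: m that)
    qed simp
    have "(hzero H, hzero H) \<in> T" by (rule linear_operator_zero[OF T_linear])
    moreover have "hdiff H (hzero H) (hzero H) = hzero H" by (rule vec_inverse) simp
    ultimately show ?thesis using T_carrier by (auto simp: adjoint_relations_def P0 bounded)
  qed
  have "hsubspace H (Collect adjoint_relations)"
    unfolding hsubspace_def using 0 adjoint_relations_add adjoint_relations_scale by (auto simp: adjoint_relations_def)
  then have sub: "hsubspace H hull A \<subseteq> Collect adjoint_relations" using A by (intro hull_minimal) auto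
  have "\<exists>y. adjoint_relations y \<and> hdist H h y < inverse (real (Suc n))" for n
    using dense[unfolded hdense_iff, rule_format, OF h, of "inverse (real (Suc n))"] sub by auto
  then obtain s where s: "\<And>n. adjoint_relations (s n)" "\<And>n. hdist H h (s n) < inverse (real (Suc n))" by metis
  have "(\<lambda>n. hdist H (s n) h) \<longlonglongrightarrow> 0"
    by (rule tendsto_sandwich[OF _ _ tendsto_const LIMSEQ_inverse_real_of_nat])
      (use s(2) in \<open>auto simp: M.commute[of _ h] intro!: always_eventually less_imp_le\<close>)
  then show ?thesis by (rule adjoint_relations_limit[OF s(1) h])
qed

text \<open>Every element of \<open>T\<close> is its own projection, hence a sum of columns, and these satisfy the symmetry
relation. So \<open>T\<close> is symmetric, and \<open>C = P11\<close>, \<open>S = P21\<close>.\<close>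

lemma resolvent_operator_if_adjoint_relations:
  assumes rel: "\<And>h. h \<in> V \<Longrightarrow> adjoint_relations h"
  shows "resolvent_operator H T P11 P21"
proof unfold_locales
  show "linear_operator H T" by (rule T_linear)
  show "(P11 h, P21 h) \<in> T" if "h \<in> V" for h by (rule column1[OF that])
  show "(P21 h, hdiff H h (P11 h)) \<in> T" if "h \<in> V" for h using rel[OF that] by (simp add: adjoint_relations_def)
  fix x u y w assume xu: "(x, u) \<in> T" and yw: "(y, w) \<in> T"
  have V: "x \<in> V" "u \<in> V" "y \<in> V" "w \<in> V" using T_carrier xu yw by auto
  define a where "a = hadd H (P11 x) (P12 u)"
  define b where "b = hadd H (P21 x) (P22 u)"
  have ab: "(a, b) \<in> T" unfolding a_def b_def by (intro T_addI column1 column2 V)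
  have abV: "a \<in> V" "b \<in> V" using ab T_carrier by auto
  have d: "(hdiff H x a, hdiff H u b) \<in> T" by (intro T_addI T_scaleI xu ab)
  define d1 where "d1 = hdiff H x a"
  define d2 where "d2 = hdiff H u b"
  have dV: "d1 \<in> V" "d2 \<in> V" using V abV by (simp_all add: d1_def d2_def)
  have "hinner H x d1 + hinner H u d2 = hinner H a d1 + hinner H b d2"
    using orthogonal1[OF V(1) d] orthogonal2[OF V(2) d] V dV P11(1) P12(1) P21(1) P22(1)
    unfolding d1_def[symmetric] d2_def[symmetric] by (simp add: a_def b_def)
  moreover have e: "hinner H d1 d1 = hinner H x d1 - hinner H a d1" "hinner H d2 d2 = hinner H u d2 - hinner H b d2"
    using V abV dV by (simp_all add: d1_def d2_def)
  ultimately have "hinner H d1 d1 + hinner H d2 d2 = 0" unfolding e by (simp add: algebra_simps)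
  then have "complex_of_real ((hnorm H (hdiff H x a))\<^sup>2 + (hnorm H (hdiff H u b))\<^sup>2) = 0"
    unfolding d1_def[symmetric] d2_def[symmetric] using dV by (simp add: inner_self)
  then have "(hnorm H (hdiff H x a))\<^sup>2 + (hnorm H (hdiff H u b))\<^sup>2 = 0" using of_real_eq_0_iff by blast
  then have "hnorm H (hdiff H x a) = 0" "hnorm H (hdiff H u b) = 0" by (simp_all add: sum_power2_eq_zero_iff)
  then have "x = a" "u = b" using vec_eqI_diff V abV by (simp_all add: hnorm_eq_0)
  moreover have "hinner H a w = hinner H b y"
    using rel[OF V(1)] rel[OF V(2)] yw V P11(1) P12(1) P21(1) P22(1) by (simp add: adjoint_relations_def a_def b_def)
  ultimately show "hinner H u y = hinner H x w" by simp
qed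

end

section \<open>Decomposable self-adjoint operators\<close>

lemma (in measurable_field) closed_integral_operatorE:
  assumes "(X, Y) \<in> closed_integral_operator \<omega> H S T"
  obtains x y where "x \<in> L2" "y \<in> L2" "X = cls x" "Y = cls y" "\<And>\<zeta>. \<zeta> \<in> space \<omega> \<Longrightarrow> (x \<zeta>, y \<zeta>) \<in> T \<zeta>"
  using assms by (auto simp: closed_integral_operator_def)

lemma (in measurable_field) closed_integral_operatorI:
  assumes "x \<in> L2" "y \<in> L2" "\<And>\<zeta>. \<zeta> \<in> space \<omega> \<Longrightarrow> (x \<zeta>, y \<zeta>) \<in> T \<zeta>"
  shows "(cls x, cls y) \<in> closed_integral_operator \<omega> H S T"
  using assms by (auto simp: closed_integral_operator_def)

text \<open>The definition of the direct integral of closed operators asks for \<open>(x(\<zeta>), y(\<zeta>)) \<in> T(\<zeta>)\<close> at every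
\<open>\<zeta>\<close>; fields that vanish on the null set satisfy this there.\<close>

lemma (in measurable_field) closed_integral_operator_mono_null:
  assumes N: "N \<in> null_sets \<omega>" and T: "\<And>\<zeta>. \<zeta> \<in> space \<omega> \<Longrightarrow> \<zeta> \<notin> N \<Longrightarrow> T \<zeta> \<subseteq> T' \<zeta>"
    and zero: "\<And>\<zeta>. \<zeta> \<in> space \<omega> \<Longrightarrow> \<zeta> \<in> N \<Longrightarrow> (hzero (H \<zeta>), hzero (H \<zeta>)) \<in> T' \<zeta>"
  shows "closed_integral_operator \<omega> H S T \<subseteq> closed_integral_operator \<omega> H S T'"
proof clarify
  fix X Y assume "(X, Y) \<in> closed_integral_operator \<omega> H S T"
  then obtain x y where xy: "x \<in> L2" "y \<in> L2" "X = cls x" "Y = cls y" "\<And>\<zeta>. \<zeta> \<in> space \<omega> \<Longrightarrow> (x \<zeta>, y \<zeta>) \<in> T \<zeta>"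
    by (rule closed_integral_operatorE) blast
  let ?x = "\<lambda>\<zeta>. if \<zeta> \<in> N then hzero (H \<zeta>) else x \<zeta>" and ?y = "\<lambda>\<zeta>. if \<zeta> \<in> N then hzero (H \<zeta>) else y \<zeta>"
  have ae: "AE \<zeta> in \<omega>. \<zeta> \<notin> N" using N by (rule AE_not_in)
  have "cls ?x = X" "cls ?y = Y" unfolding xy(3,4)
    by (rule cls_eqI, use ae in eventually_elim, simp)+
  moreover have "(cls ?x, cls ?y) \<in> closed_integral_operator \<omega> H S T'"
  proof (rule closed_integral_operatorI)
    show "?x \<in> L2" "?y \<in> L2" using L2_if xy(1,2) N by auto
    show "(?x \<zeta>, ?y \<zeta>) \<in> T' \<zeta>" if \<zeta>: "\<zeta> \<in> space \<omega>" for \<zeta>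
      using T[OF \<zeta>] zero[OF \<zeta>] xy(5)[OF \<zeta>] by (cases "\<zeta> \<in> N") auto
  qed
  ultimately show "(X, Y) \<in> closed_integral_operator \<omega> H S T'" by simp
qed

locale closed_field = measurable_field \<omega> H S for \<omega> :: "'z measure" and H :: "'z \<Rightarrow> 'h hspace" and S +
  fixes T :: "'z \<Rightarrow> 'h operator"
  assumes T_field: "measurable_closed_field \<omega> H S T"
begin

definition Q11 where "Q11 \<zeta> = (\<lambda>x\<in>hcarrier (H \<zeta>). fst (graph_projection (H \<zeta>) (T \<zeta>) (x, hzero (H \<zeta>))))"
definition Q12 where "Q12 \<zeta> = (\<lambda>x\<in>hcarrier (H \<zeta>). fst (graph_projection (H \<zeta>) (T \<zeta>) (hzero (H \<zeta>), x)))"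
definition Q21 where "Q21 \<zeta> = (\<lambda>x\<in>hcarrier (H \<zeta>). snd (graph_projection (H \<zeta>) (T \<zeta>) (x, hzero (H \<zeta>))))"
definition Q22 where "Q22 \<zeta> = (\<lambda>x\<in>hcarrier (H \<zeta>). snd (graph_projection (H \<zeta>) (T \<zeta>) (hzero (H \<zeta>), x)))"

lemma Q_field: "measurable_bounded_field \<omega> H S Q11" "measurable_bounded_field \<omega> H S Q12"
    "measurable_bounded_field \<omega> H S Q21" "measurable_bounded_field \<omega> H S Q22"
  using T_field unfolding measurable_closed_field_def Q11_def[abs_def] Q12_def[abs_def] Q21_def[abs_def] Q22_def[abs_def]
  by auto

lemma entries: "\<zeta> \<in> space \<omega> \<Longrightarrow> graph_entries (H \<zeta>) (T \<zeta>) (Q11 \<zeta>) (Q12 \<zeta>) (Q21 \<zeta>) (Q22 \<zeta>)"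
  using fibre T_field Q_field[THEN measurable_bounded_fieldD(2)]
  unfolding graph_entries_def graph_entries_axioms_def measurable_closed_field_def Q11_def Q12_def Q21_def Q22_def
  by auto

lemma Q_L2: assumes x: "x \<in> L2"
  shows "(\<lambda>\<zeta>. Q11 \<zeta> (x \<zeta>)) \<in> L2" "(\<lambda>\<zeta>. Q12 \<zeta> (x \<zeta>)) \<in> L2" "(\<lambda>\<zeta>. Q21 \<zeta> (x \<zeta>)) \<in> L2" "(\<lambda>\<zeta>. Q22 \<zeta> (x \<zeta>)) \<in> L2"
  by (rule L2_bound_field[OF measurable_bounded_fieldD(1)[OF Q_field(1) L2_S[OF x]] x, of 1]
      L2_bound_field[OF measurable_bounded_fieldD(1)[OF Q_field(2) L2_S[OF x]] x, of 1]
      L2_bound_field[OF measurable_bounded_fieldD(1)[OF Q_field(3) L2_S[OF x]] x, of 1]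
      L2_bound_field[OF measurable_bounded_fieldD(1)[OF Q_field(4) L2_S[OF x]] x, of 1],
      simp add: graph_entries.entries_norm[OF entries] L2_S[OF x])+

context
  assumes sa: "self_adjoint D (closed_integral_operator \<omega> H S T)"
begin

text \<open>Vector fields with values in the graphs of the adjoints define an element of the adjoint of the direct
integral, which is the direct integral itself.\<close>

lemma AE_in_T:
  assumes a: "a \<in> L2" and w: "w \<in> L2"
    and adj: "\<And>\<zeta> y u. \<zeta> \<in> space \<omega> \<Longrightarrow> (y, u) \<in> T \<zeta> \<Longrightarrow> hinner (H \<zeta>) u (a \<zeta>) = hinner (H \<zeta>) y (w \<zeta>)"
  shows "AE \<zeta> in \<omega>. (a \<zeta>, w \<zeta>) \<in> T \<zeta>"
proof -
  have "hinner D U (cls a) = hinner D Y (cls w)" if "(Y, U) \<in> closed_integral_operator \<omega> H S T" for Y U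
    using that
  proof (rule closed_integral_operatorE)
    fix y u assume "y \<in> L2" "u \<in> L2" "Y = cls y" "U = cls u" "\<And>\<zeta>. \<zeta> \<in> space \<omega> \<Longrightarrow> (y \<zeta>, u \<zeta>) \<in> T \<zeta>"
    then show ?thesis
      using a w by (simp add: D_inner) (rule Bochner_Integration.integral_cong[OF refl], rule adj, auto)
  qed
  then have "(cls a, cls w) \<in> hadjoint D (closed_integral_operator \<omega> H S T)"
    using a w by (auto simp: hadjoint_def)
  then have "(cls a, cls w) \<in> closed_integral_operator \<omega> H S T" using sa by (simp add: self_adjoint_def)
  then obtain x y where xy: "x \<in> L2" "y \<in> L2" "cls a = cls x" "cls w = cls y" "\<And>\<zeta>. \<zeta> \<in> space \<omega> \<Longrightarrow> (x \<zeta>, y \<zeta>) \<in> T \<zeta>"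
    by (rule closed_integral_operatorE) blast
  have "AE \<zeta> in \<omega>. a \<zeta> = x \<zeta>" "AE \<zeta> in \<omega>. w \<zeta> = y \<zeta>" using xy(3,4) cls_eq_iff a w by auto
  then show ?thesis using AE_space by eventually_elim (simp add: xy(5))
qed

text \<open>The claim concerns all elements \<open>(y, u)\<close> of \<open>T(\<zeta>)\<close> at once, which form no countable family. It says
that \<open>(- h, g)\<close> is orthogonal to \<open>T(\<zeta>)\<close>, that is, that its projection \<open>(r, s)\<close> onto \<open>T(\<zeta>)\<close> vanishes.
Now \<open>(r, s)\<close> is a measurable field, and symmetry of the direct integral, applied to \<open>(g, h)\<close> and
\<open>(r, s)\<close>, shows \<open>\<integral> (\<parallel>r\<parallel>\<^sup>2 + \<parallel>s\<parallel>\<^sup>2) d\<omega> = 0\<close>.\<close>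

lemma AE_symmetric:
  assumes g: "g \<in> L2" and h: "h \<in> L2" and gh: "\<And>\<zeta>. \<zeta> \<in> space \<omega> \<Longrightarrow> (g \<zeta>, h \<zeta>) \<in> T \<zeta>"
  shows "AE \<zeta> in \<omega>. \<forall>y u. (y, u) \<in> T \<zeta> \<longrightarrow> hinner (H \<zeta>) (g \<zeta>) u = hinner (H \<zeta>) (h \<zeta>) y"
proof -
  define r where "r \<zeta> = hdiff (H \<zeta>) (Q12 \<zeta> (g \<zeta>)) (Q11 \<zeta> (h \<zeta>))" for \<zeta>
  define s where "s \<zeta> = hdiff (H \<zeta>) (Q22 \<zeta> (g \<zeta>)) (Q21 \<zeta> (h \<zeta>))" for \<zeta>
  have rs: "r \<in> L2" "s \<in> L2" unfolding r_def[abs_def] s_def[abs_def]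
    by (intro L2_add L2_scale Q_L2 g h)+
  have mem: "g \<zeta> \<in> hcarrier (H \<zeta>)" "h \<zeta> \<in> hcarrier (H \<zeta>)" "r \<zeta> \<in> hcarrier (H \<zeta>)" "s \<zeta> \<in> hcarrier (H \<zeta>)"
    if "\<zeta> \<in> space \<omega>" for \<zeta> using g h rs L2_S that by auto
  have rsT: "(r \<zeta>, s \<zeta>) \<in> T \<zeta>" if \<zeta>: "\<zeta> \<in> space \<omega>" for \<zeta>
  proof -
    interpret G: graph_entries "H \<zeta>" "T \<zeta>" "Q11 \<zeta>" "Q12 \<zeta>" "Q21 \<zeta>" "Q22 \<zeta>" by (rule entries[OF \<zeta>])
    show ?thesis unfolding r_def s_def by (intro G.T_addI G.T_scaleI G.column1 G.column2 mem \<zeta>)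
  qed
  have key: "hinner (H \<zeta>) (g \<zeta>) u - hinner (H \<zeta>) (h \<zeta>) y = hinner (H \<zeta>) (r \<zeta>) y + hinner (H \<zeta>) (s \<zeta>) u"
    if \<zeta>: "\<zeta> \<in> space \<omega>" and yu: "(y, u) \<in> T \<zeta>" for \<zeta> y u
  proof -
    interpret G: graph_entries "H \<zeta>" "T \<zeta>" "Q11 \<zeta>" "Q12 \<zeta>" "Q21 \<zeta>" "Q22 \<zeta>" by (rule entries[OF \<zeta>])
    show ?thesis
      using G.orthogonal1[OF mem(2)[OF \<zeta>] yu] G.orthogonal2[OF mem(1)[OF \<zeta>] yu] G.T_carrier[OF yu] mem[OF \<zeta>]
        G.P11(1) G.P12(1) G.P21(1) G.P22(1) by (simp add: r_def s_def)
  qed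
  have "(cls g, cls h) \<in> hadjoint D (closed_integral_operator \<omega> H S T)"
    using closed_integral_operatorI[OF g h gh] sa by (simp add: self_adjoint_def)
  moreover have "(cls r, cls s) \<in> closed_integral_operator \<omega> H S T"
    by (rule closed_integral_operatorI[OF rs rsT])
  ultimately have "hinner D (cls s) (cls g) = hinner D (cls r) (cls h)"
    by (auto simp: hadjoint_def)
  then have "hinner D (cls g) (cls s) = hinner D (cls h) (cls r)"
    using inner_space.inner_sym[OF inner_space_direct_integral] g h rs by (metis cls_mem)
  then have "hinner D (cls r) (cls r) + hinner D (cls s) (cls s) = 0"
  proof -
    assume eq: "hinner D (cls g) (cls s) = hinner D (cls h) (cls r)"
    have "hinner D (cls r) (cls r) + hinner D (cls s) (cls s)
      = (LINT \<zeta>|\<omega>. hinner (H \<zeta>) (r \<zeta>) (r \<zeta>) + hinner (H \<zeta>) (s \<zeta>) (s \<zeta>))"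
      using rs by (simp add: D_inner)
    also have "\<dots> = (LINT \<zeta>|\<omega>. hinner (H \<zeta>) (g \<zeta>) (s \<zeta>) - hinner (H \<zeta>) (h \<zeta>) (r \<zeta>))"
      by (rule Bochner_Integration.integral_cong[OF refl]) (rule key[symmetric], auto simp: rsT)
    also have "\<dots> = hinner D (cls g) (cls s) - hinner D (cls h) (cls r)"
      using g h rs by (simp add: D_inner)
    finally show ?thesis using eq by simp
  qed
  moreover interpret DI: inner_space D by (rule inner_space_direct_integral)
  have R: "cls r \<in> hcarrier D" "cls s \<in> hcarrier D" using rs by simp_all
  ultimately have "complex_of_real ((hnorm D (cls r))\<^sup>2 + (hnorm D (cls s))\<^sup>2) = 0"
    by (simp add: DI.inner_self)
  then have "(hnorm D (cls r))\<^sup>2 + (hnorm D (cls s))\<^sup>2 = 0" using of_real_eq_0_iff by blast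
  then have "hnorm D (cls r) = 0" "hnorm D (cls s) = 0" by (simp_all add: sum_power2_eq_zero_iff)
  then have "cls r = cls (\<lambda>\<zeta>. hzero (H \<zeta>))" "cls s = cls (\<lambda>\<zeta>. hzero (H \<zeta>))"
    using DI.hnorm_eq_0 R by (simp_all add: D_zero)
  then have "AE \<zeta> in \<omega>. r \<zeta> = hzero (H \<zeta>)" "AE \<zeta> in \<omega>. s \<zeta> = hzero (H \<zeta>)" using cls_eq_iff rs by auto
  then show ?thesis using AE_space
  proof eventually_elim
    case (elim \<zeta>)
    interpret G: graph_entries "H \<zeta>" "T \<zeta>" "Q11 \<zeta>" "Q12 \<zeta>" "Q21 \<zeta>" "Q22 \<zeta>" by (rule entries[OF elim(3)])
    show ?case using key[OF elim(3)] elim(1,2) G.T_carrier by fastforce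
  qed
qed

lemma AE_adjoint_relations:
  assumes x: "x \<in> L2"
  shows "AE \<zeta> in \<omega>. graph_entries.adjoint_relations (H \<zeta>) (T \<zeta>) (Q11 \<zeta>) (Q12 \<zeta>) (Q21 \<zeta>) (Q22 \<zeta>) (x \<zeta>)"
proof -
  note FS = S_mem[OF L2_S[OF x]]
  have "AE \<zeta> in \<omega>. (Q21 \<zeta> (x \<zeta>), hdiff (H \<zeta>) (x \<zeta>) (Q11 \<zeta> (x \<zeta>))) \<in> T \<zeta>"
  proof (rule AE_in_T[OF Q_L2(3)[OF x] L2_add[OF x L2_scale[OF Q_L2(1)[OF x]]]])
    fix \<zeta> y u assume \<zeta>: "\<zeta> \<in> space \<omega>" and yu: "(y, u) \<in> T \<zeta>"
    interpret G: graph_entries "H \<zeta>" "T \<zeta>" "Q11 \<zeta>" "Q12 \<zeta>" "Q21 \<zeta>" "Q22 \<zeta>" by (rule entries[OF \<zeta>])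
    have V: "y \<in> G.V" "u \<in> G.V" "x \<zeta> \<in> G.V" "Q11 \<zeta> (x \<zeta>) \<in> G.V" "Q21 \<zeta> (x \<zeta>) \<in> G.V"
      using G.T_carrier[OF yu] FS[OF \<zeta>] G.P11(1) G.P21(1) by auto
    have "hinner (H \<zeta>) (hdiff (H \<zeta>) (x \<zeta>) (Q11 \<zeta> (x \<zeta>))) y = hinner (H \<zeta>) (Q21 \<zeta> (x \<zeta>)) u"
      using G.orthogonal1[OF V(3) yu] V by simp
    then show "hinner (H \<zeta>) u (Q21 \<zeta> (x \<zeta>)) = hinner (H \<zeta>) y (hdiff (H \<zeta>) (x \<zeta>) (Q11 \<zeta> (x \<zeta>)))"
      using G.inner_sym[of u "Q21 \<zeta> (x \<zeta>)"] G.inner_sym[of y "hdiff (H \<zeta>) (x \<zeta>) (Q11 \<zeta> (x \<zeta>))"] V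
      by (simp del: G.inner_addl G.inner_addr)
  qed
  moreover have "AE \<zeta> in \<omega>. \<forall>y u. (y, u) \<in> T \<zeta> \<longrightarrow> hinner (H \<zeta>) (Q11 \<zeta> (x \<zeta>)) u = hinner (H \<zeta>) (Q21 \<zeta> (x \<zeta>)) y"
    by (rule AE_symmetric[OF Q_L2(1)[OF x] Q_L2(3)[OF x]]) (rule graph_entries.column1[OF entries], auto simp: FS)
  moreover have "AE \<zeta> in \<omega>. \<forall>y u. (y, u) \<in> T \<zeta> \<longrightarrow> hinner (H \<zeta>) (Q12 \<zeta> (x \<zeta>)) u = hinner (H \<zeta>) (Q22 \<zeta> (x \<zeta>)) y"
    by (rule AE_symmetric[OF Q_L2(2)[OF x] Q_L2(4)[OF x]]) (rule graph_entries.column2[OF entries], auto simp: FS)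
  ultimately show ?thesis using AE_space
    by eventually_elim (simp add: graph_entries.adjoint_relations_def[OF entries] FS)
qed

text \<open>Almost every \<open>T(\<zeta>)\<close> is self-adjoint. The adjoint relations hold almost everywhere for each member of a
fundamental sequence, hence outside one null set for all members, and there for all vectors.\<close>

theorem AE_resolvent_operator:
  assumes "sigma_finite_measure \<omega>"
  shows "AE \<zeta> in \<omega>. resolvent_operator (H \<zeta>) (T \<zeta>) (Q11 \<zeta>) (Q21 \<zeta>)"
proof -
  obtain x :: "nat \<Rightarrow> 'z \<Rightarrow> 'h" where x: "\<And>n. x n \<in> S"
    "\<And>\<zeta>. \<zeta> \<in> space \<omega> \<Longrightarrow> hdense (H \<zeta>) (hsubspace (H \<zeta>) hull range (\<lambda>n. x n \<zeta>))"
    using fundamental_sequence by auto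
  obtain g where g: "g \<in> borel_measurable \<omega>" "\<And>\<zeta>. g \<zeta> > (0::real)" "integrable \<omega> g"
    using sigma_finite_measure.obtain_positive_integrable_function[OF assms] by metis
  \<comment> \<open>The members of the fundamental sequence need not be square integrable. Scaled by the nonzero factor
    \<open>c n\<close> they have norm at most \<open>sqrt g\<close> with \<open>g\<close> integrable.\<close>
  define c where "c n \<zeta> = sqrt (g \<zeta>) / (1 + hnorm (H \<zeta>) (x n \<zeta>))" for n \<zeta>
  define y where "y n \<zeta> = hscale (H \<zeta>) (complex_of_real (c n \<zeta>)) (x n \<zeta>)" for n \<zeta>
  have nn: "0 \<le> hnorm (H \<zeta>) (x n \<zeta>)" if "\<zeta> \<in> space \<omega>" for n \<zeta>
    using inner_space.hnorm_nonneg[OF fibre_inner[OF that]] x(1) that by simp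
  have y: "y n \<in> L2" for n
  proof (rule L2_bound[OF _ g(3)])
    have "(\<lambda>\<zeta>. complex_of_real (c n \<zeta>)) \<in> borel_measurable \<omega>"
      unfolding c_def using g(1) norm_measurable[OF x(1)] by measurable
    then show "y n \<in> S" unfolding y_def[abs_def] by (rule S_scale[OF x(1)])
    show "AE \<zeta> in \<omega>. (hnorm (H \<zeta>) (y n \<zeta>))\<^sup>2 \<le> g \<zeta>"
    proof (rule AE_I2)
      fix \<zeta> assume \<zeta>: "\<zeta> \<in> space \<omega>"
      interpret F: inner_space "H \<zeta>" by (rule fibre_inner[OF \<zeta>])
      have "0 \<le> c n \<zeta>" using nn[OF \<zeta>, of n] g(2)[of \<zeta>] by (simp add: c_def)
      then have "hnorm (H \<zeta>) (y n \<zeta>) = c n \<zeta> * hnorm (H \<zeta>) (x n \<zeta>)"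
        using x(1) \<zeta> by (simp add: y_def F.hnorm_scale)
      also have "\<dots> = sqrt (g \<zeta>) * (hnorm (H \<zeta>) (x n \<zeta>) / (1 + hnorm (H \<zeta>) (x n \<zeta>)))"
        by (simp add: c_def)
      also have "\<dots> \<le> sqrt (g \<zeta>) * 1" using nn[OF \<zeta>, of n] g(2)[of \<zeta>] by (intro mult_left_mono) auto
      finally have "hnorm (H \<zeta>) (y n \<zeta>) \<le> sqrt (g \<zeta>)" by simp
      then have "(hnorm (H \<zeta>) (y n \<zeta>))\<^sup>2 \<le> (sqrt (g \<zeta>))\<^sup>2"
        using x(1) \<zeta> by (intro power_mono) (auto simp: y_def)
      then show "(hnorm (H \<zeta>) (y n \<zeta>))\<^sup>2 \<le> g \<zeta>" using g(2)[of \<zeta>] by simp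
    qed
  qed
  have "AE \<zeta> in \<omega>. \<forall>n. graph_entries.adjoint_relations (H \<zeta>) (T \<zeta>) (Q11 \<zeta>) (Q12 \<zeta>) (Q21 \<zeta>) (Q22 \<zeta>) (y n \<zeta>)"
    unfolding AE_all_countable using AE_adjoint_relations[OF y] by blast
  then show ?thesis using AE_space
  proof eventually_elim
    case (elim \<zeta>)
    interpret G: graph_entries "H \<zeta>" "T \<zeta>" "Q11 \<zeta>" "Q12 \<zeta>" "Q21 \<zeta>" "Q22 \<zeta>" by (rule entries[OF elim(2)])
    have "G.adjoint_relations (x n \<zeta>)" for n
    proof -
      have c0: "c n \<zeta> \<noteq> 0" using g(2)[of \<zeta>] nn[OF elim(2), of n] by (simp add: c_def)
      have xV: "x n \<zeta> \<in> G.V" using x(1) elim(2) by simp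
      have "hscale (H \<zeta>) (complex_of_real (1 / c n \<zeta>)) (y n \<zeta>) = x n \<zeta>"
        by (rule G.vec_eqI) (use xV c0 in \<open>simp_all add: y_def\<close>)
      then show ?thesis using G.adjoint_relations_scale[of "y n \<zeta>" "complex_of_real (1 / c n \<zeta>)"] elim(1) by metis
    qed
    then show ?case
      using G.adjoint_relations_all[OF x(2)[OF elim(2)]] by (intro G.resolvent_operator_if_adjoint_relations) blast
  qed
qed

end

end

lemma (in resolvent_operator) CS_norm:
  assumes h: "h \<in> V" shows "hnorm H (C h) \<le> hnorm H h" "hnorm H (S h) \<le> hnorm H h"
proof -
  have "hinner H (C h) h = complex_of_real ((hnorm H (C h))\<^sup>2 + (hnorm H (S h))\<^sup>2)"
    using C_inner[OF h h] h by (simp add: inner_self)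
  then have "cmod (hinner H (C h) h) = (hnorm H (C h))\<^sup>2 + (hnorm H (S h))\<^sup>2"
    by (simp only: norm_of_real) simp
  then have le: "(hnorm H (C h))\<^sup>2 + (hnorm H (S h))\<^sup>2 \<le> hnorm H (C h) * hnorm H h"
    using cauchy_schwarz[of "C h" h] h by simp
  show C: "hnorm H (C h) \<le> hnorm H h"
  proof (rule ccontr)
    assume "\<not> ?thesis"
    then have "hnorm H h < hnorm H (C h)" "0 < hnorm H (C h)" using hnorm_nonneg[OF h] by linarith+
    then have "hnorm H (C h) * hnorm H h < (hnorm H (C h))\<^sup>2" by (simp add: power2_eq_square)
    then show False using le zero_le_power2[of "hnorm H (S h)"] by linarith
  qed
  have "(hnorm H (S h))\<^sup>2 \<le> hnorm H (C h) * hnorm H h" using le zero_le_power2[of "hnorm H (C h)"] by linarith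
  also have "\<dots> \<le> (hnorm H h)\<^sup>2" using C h by (simp add: power2_eq_square mult_right_mono)
  finally have "(hnorm H (S h))\<^sup>2 \<le> (hnorm H h)\<^sup>2" .
  then show "hnorm H (S h) \<le> hnorm H h" by (rule power2_le_imp_le[OF _ hnorm_nonneg[OF h]])
qed

lemma (in inner_space) resolvent_operator_zero:
  "resolvent_operator H {(x, hzero H) | x. x \<in> V} (\<lambda>h. h) (\<lambda>_. hzero H)"
proof unfold_locales
  have z: "hadd H (hzero H) (hzero H) = hzero H" "hscale H c (hzero H) = hzero H" for c
    by (simp add: vec_zero, rule vec_eqI) simp_all
  show "linear_operator H {(x, hzero H) | x. x \<in> V}"
    unfolding linear_operator_def hsubspace_def by (auto simp: z intro!: single_valuedI)
qed (auto simp: vec_inverse)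

context measurable_field
begin

text \<open>For operators that are self-adjoint at every point, the whole statement comes from one measurability
  property: \<open>\<zeta> \<mapsto> \<langle>f(E\<^sub>\<zeta>) x(\<zeta>), z(\<zeta>)\<rangle>\<close> is measurable for bounded Borel \<open>f\<close>, because multiplying \<open>f\<close> by
  \<open>res0\<close> or \<open>res1\<close> amounts to replacing the field \<open>x\<close> by the measurable field \<open>C x\<close> or \<open>S x\<close>. So the
  spectral measures of the fibres have a direct integral; the integral of \<open>t\<close> against it is the given
  operator, and uniqueness identifies it as the spectral measure.\<close>

lemma spectral_decomposition_of_resolvent_field:
  assumes sa: "self_adjoint D (closed_integral_operator \<omega> H S T)"
    and res: "\<And>\<zeta>. \<zeta> \<in> space \<omega> \<Longrightarrow> resolvent_operator (H \<zeta>) (T \<zeta>) (C \<zeta>) (S' \<zeta>)"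
    and C: "\<And>x. x \<in> S \<Longrightarrow> (\<lambda>\<zeta>. C \<zeta> (x \<zeta>)) \<in> S" and S': "\<And>x. x \<in> S \<Longrightarrow> (\<lambda>\<zeta>. S' \<zeta> (x \<zeta>)) \<in> S"
  shows "B \<in> sets borel \<Longrightarrow> is_bounded_integral \<omega> H S
      (spectral_measure D (closed_integral_operator \<omega> H S T) B) (\<lambda>\<zeta>. spectral_measure (H \<zeta>) (T \<zeta>) B)"
    and "f \<in> borel_measurable borel \<Longrightarrow>
      measurable_closed_field \<omega> H S (\<lambda>\<zeta>. borel_calculus (H \<zeta>) (T \<zeta>) f) \<and>
      borel_calculus D (closed_integral_operator \<omega> H S T) f =
        closed_integral_operator \<omega> H S (\<lambda>\<zeta>. borel_calculus (H \<zeta>) (T \<zeta>) f)"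
proof -
  let ?T = "closed_integral_operator \<omega> H S T"
  define E where "E \<zeta> = spectral_measure (H \<zeta>) (T \<zeta>)" for \<zeta>
  have E: "pvm (H \<zeta>) (E \<zeta>)" "spectral_integral (H \<zeta>) (E \<zeta>) (\<lambda>t. t) = T \<zeta>" if \<zeta>: "\<zeta> \<in> space \<omega>" for \<zeta>
  proof -
    interpret hilbert_resolvent "H \<zeta>" "T \<zeta>" "C \<zeta>" "S' \<zeta>"
      by (intro hilbert_resolvent.intro res fibre \<zeta>)
    show "pvm (H \<zeta>) (E \<zeta>)" "spectral_integral (H \<zeta>) (E \<zeta>) (\<lambda>t. t) = T \<zeta>"
      using spectral_theorem by (simp_all add: E_def)
  qed
  have meas: "\<forall>x\<in>S. \<forall>z\<in>S. (\<lambda>\<zeta>. sesq_integral (H \<zeta>) (E \<zeta>) f (x \<zeta>) (z \<zeta>)) \<in> borel_measurable \<omega>"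
    if "bounded_borel f" for f
    using that
  proof (induction rule: bounded_borel_resolvent_induct)
    case one
    show ?case using inner_measurable by (simp add: pvm.sesq_one[OF E(1)] cong: measurable_cong)
  next
    case (add f g)
    then show ?case by (auto simp: pvm.sesq_add[OF E(1) add(1,2)] cong: measurable_cong intro!: borel_measurable_add)
  next
    case (scale c f)
    then show ?case by (auto simp: pvm.sesq_scale[OF E(1)] cong: measurable_cong intro!: borel_measurable_times)
  next
    case (lim F f K)
    show ?case
    proof (intro ballI)
      fix x z assume xz: "x \<in> S" "z \<in> S"
      show "(\<lambda>\<zeta>. sesq_integral (H \<zeta>) (E \<zeta>) f (x \<zeta>) (z \<zeta>)) \<in> borel_measurable \<omega>"
        by (rule borel_measurable_LIMSEQ_metric[of "\<lambda>n \<zeta>. sesq_integral (H \<zeta>) (E \<zeta>) (F n) (x \<zeta>) (z \<zeta>)"])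
          (use lim(5) xz pvm.sesq_lim[OF E(1) lim(1-4)] in auto)
    qed
  next
    case (res0 f)
    show ?case
    proof (intro ballI)
      fix x z assume xz: "x \<in> S" "z \<in> S"
      have "(\<lambda>\<zeta>. sesq_integral (H \<zeta>) (E \<zeta>) f (C \<zeta> (x \<zeta>)) (z \<zeta>)) \<in> borel_measurable \<omega>"
        using bspec[OF bspec[OF res0(2) C[OF xz(1)]] xz(2)] .
      then show "(\<lambda>\<zeta>. sesq_integral (H \<zeta>) (E \<zeta>) (\<lambda>t. res0 t * f t) (x \<zeta>) (z \<zeta>)) \<in> borel_measurable \<omega>"
        using xz by (simp add: resolvent_operator.form_resolvent(1)[OF res E res0(1)] cong: measurable_cong)
    qed
  next
    case (res1 f)
    show ?case
    proof (intro ballI)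
      fix x z assume xz: "x \<in> S" "z \<in> S"
      have "(\<lambda>\<zeta>. sesq_integral (H \<zeta>) (E \<zeta>) f (S' \<zeta> (x \<zeta>)) (z \<zeta>)) \<in> borel_measurable \<omega>"
        using bspec[OF bspec[OF res1(2) S'[OF xz(1)]] xz(2)] .
      then show "(\<lambda>\<zeta>. sesq_integral (H \<zeta>) (E \<zeta>) (\<lambda>t. res1 t * f t) (x \<zeta>) (z \<zeta>)) \<in> borel_measurable \<omega>"
        using xz by (simp add: resolvent_operator.form_resolvent(2)[OF res E res1(1)] cong: measurable_cong)
    qed
  qed
  interpret P: pvm_field \<omega> H S E
  proof (intro pvm_field.intro pvm_field_axioms.intro measurable_field_axioms)
    show "pvm (H \<zeta>) (E \<zeta>)" if "\<zeta> \<in> space \<omega>" for \<zeta> by (rule E(1)[OF that])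
    fix B :: "real set" assume B: "B \<in> sets borel"
    show "measurable_bounded_field \<omega> H S (\<lambda>\<zeta>. E \<zeta> B)"
      unfolding measurable_bounded_field_def
    proof (intro conjI ballI)
      show "E \<zeta> B \<in> bounded_operators (H \<zeta>)" if "\<zeta> \<in> space \<omega>" for \<zeta>
        using pvm.E_projection[OF E(1)[OF that] B] by (simp add: projection_def)
      fix x assume x: "x \<in> S"
      show "(\<lambda>\<zeta>. E \<zeta> B (x \<zeta>)) \<in> S"
      proof (rule S_I)
        show "E \<zeta> B (x \<zeta>) \<in> hcarrier (H \<zeta>)" if "\<zeta> \<in> space \<omega>" for \<zeta>
          using pvm.E_mem[OF E(1)[OF that] B] x that by simp
        show "(\<lambda>\<zeta>. hinner (H \<zeta>) (E \<zeta> B (x \<zeta>)) (z \<zeta>)) \<in> borel_measurable \<omega>" if "z \<in> S" for z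
          using meas[OF bounded_borel_indicator[OF B], rule_format, OF x that] x that
          by (simp add: pvm.sesq_indicator[OF E(1) B] cong: measurable_cong)
      qed
    qed
  qed
  have same: "closed_integral_operator \<omega> H S (\<lambda>\<zeta>. spectral_integral (H \<zeta>) (E \<zeta>) (\<lambda>t. t)) = ?T"
    using E(2) by (auto simp: closed_integral_operator_def)
  have integral_pvm_T: "spectral_integral D P.integral_pvm (\<lambda>t. t) = ?T"
    using P.spectral_integral_integral_pvm[of "\<lambda>t. t"] same by simp
  have "\<exists>A B. (A, B) \<in> ?T \<and> (B, hdiff D X A) \<in> ?T" if X: "X \<in> hcarrier D" for X
  proof -
    obtain x where x: "x \<in> L2" "X = cls x" using X by (rule D_carrierE)
    note FS = S_mem[OF L2_S[OF x(1)]]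
    let ?a = "\<lambda>\<zeta>. C \<zeta> (x \<zeta>)" and ?b = "\<lambda>\<zeta>. S' \<zeta> (x \<zeta>)"
    have ab: "?a \<in> L2" "?b \<in> L2"
      by (rule L2_bound_field[OF C[OF L2_S[OF x(1)]] x(1), of 1] L2_bound_field[OF S'[OF L2_S[OF x(1)]] x(1), of 1],
          simp add: resolvent_operator.CS_norm[OF res] FS)+
    have "(cls ?a, cls ?b) \<in> ?T"
      by (rule closed_integral_operatorI[OF ab]) (rule resolvent_operator.CS[OF res], auto simp: FS)
    moreover have "(cls ?b, cls (\<lambda>\<zeta>. hdiff (H \<zeta>) (x \<zeta>) (?a \<zeta>))) \<in> ?T"
      by (rule closed_integral_operatorI[OF ab(2) L2_add[OF x(1) L2_scale[OF ab(1)]]])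
        (rule resolvent_operator.SC[OF res], auto simp: FS)
    moreover have "hdiff D X (cls ?a) = cls (\<lambda>\<zeta>. hdiff (H \<zeta>) (x \<zeta>) (?a \<zeta>))"
      unfolding x(2) D_scale[OF ab(1)] by (rule D_add[OF x(1) L2_scale[OF ab(1)]])
    ultimately show ?thesis by metis
  qed
  then obtain CD SD where CSD: "\<And>X. X \<in> hcarrier D \<Longrightarrow> (CD X, SD X) \<in> ?T"
    "\<And>X. X \<in> hcarrier D \<Longrightarrow> (SD X, hdiff D X (CD X)) \<in> ?T" by metis
  have "resolvent_operator D ?T CD SD"
  proof (intro resolvent_operator.intro resolvent_operator_axioms.intro inner_space_direct_integral CSD)
    show "linear_operator D ?T" using sa by (simp add: self_adjoint_def)
    fix x u y w assume xu: "(x, u) \<in> ?T" and yw: "(y, w) \<in> ?T"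
    have "(y, w) \<in> hadjoint D ?T" using yw sa by (simp add: self_adjoint_def)
    then show "hinner D u y = hinner D x w" using xu by (auto simp: hadjoint_def)
  qed
  then have spec: "spectral_measure D ?T = P.integral_pvm"
    by (rule resolvent_operator.spectral_measure_eqI[OF _ P.pvm_integral_pvm integral_pvm_T])
  show "B \<in> sets borel \<Longrightarrow> is_bounded_integral \<omega> H S (spectral_measure D ?T B) (\<lambda>\<zeta>. spectral_measure (H \<zeta>) (T \<zeta>) B)"
    using P.bounded_integral_integral_pvm[of B] by (simp add: spec E_def)
  show "f \<in> borel_measurable borel \<Longrightarrow>
      measurable_closed_field \<omega> H S (\<lambda>\<zeta>. borel_calculus (H \<zeta>) (T \<zeta>) f) \<and>
      borel_calculus D ?T f = closed_integral_operator \<omega> H S (\<lambda>\<zeta>. borel_calculus (H \<zeta>) (T \<zeta>) f)"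
    using P.measurable_closed_field_spectral_integral[of f] P.spectral_integral_integral_pvm[of f]
    by (simp add: borel_calculus_def spec E_def)
qed

end

theorem proposition4p2:
  fixes \<omega> :: "'z::polish_space measure"
    and H :: "'z \<Rightarrow> 'h hspace"
    and S :: "('z \<Rightarrow> 'h) set"
    and T :: "('z \<Rightarrow> 'h) set operator"
    and T\<^sub>\<zeta> :: "'z \<Rightarrow> 'h operator"
  assumes "sets \<omega> = sets borel"
    and "sigma_finite_measure \<omega>"
    and "measurable_field \<omega> H S"
    and "closed_operator (direct_integral \<omega> H S) T"
    and "self_adjoint (direct_integral \<omega> H S) T"
    and "is_closed_integral \<omega> H S T T\<^sub>\<zeta>"
  shows "(\<forall>B\<in>sets borel. is_bounded_integral \<omega> H S
            (spectral_measure (direct_integral \<omega> H S) T B)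
            (\<lambda>\<zeta>. spectral_measure (H \<zeta>) (T\<^sub>\<zeta> \<zeta>) B)) \<and>
         (\<forall>f\<in>borel_measurable borel. is_closed_integral \<omega> H S
            (borel_calculus (direct_integral \<omega> H S) T f)
            (\<lambda>\<zeta>. borel_calculus (H \<zeta>) (T\<^sub>\<zeta> \<zeta>) f))"
proof -
  obtain T1 where T1: "measurable_closed_field \<omega> H S T1" "AE \<zeta> in \<omega>. T1 \<zeta> = T\<^sub>\<zeta> \<zeta>"
    "T = closed_integral_operator \<omega> H S T1"
    using assms(6) unfolding is_closed_integral_def by blast
  interpret closed_field \<omega> H S T1
    by (intro closed_field.intro closed_field_axioms.intro assms(3) T1(1))
  have sa1: "self_adjoint (direct_integral \<omega> H S) (closed_integral_operator \<omega> H S T1)"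
    using assms(5) T1(3) by simp
  obtain N where N: "N \<in> null_sets \<omega>"
    "{\<zeta> \<in> space \<omega>. \<not> resolvent_operator (H \<zeta>) (T1 \<zeta>) (Q11 \<zeta>) (Q21 \<zeta>)} \<subseteq> N"
    using AE_resolvent_operator[OF sa1 assms(2)] by (auto simp: eventually_ae_filter)
  \<comment> \<open>On the exceptional null set the operators are replaced by the zero operator, which is self-adjoint
    and has \<open>C = 1\<close>, \<open>S = 0\<close>.\<close>
  define T2 where "T2 \<zeta> = (if \<zeta> \<in> N then {(x, hzero (H \<zeta>)) | x. x \<in> hcarrier (H \<zeta>)} else T1 \<zeta>)" for \<zeta>
  define C where "C \<zeta> = (if \<zeta> \<in> N then (\<lambda>h. h) else Q11 \<zeta>)" for \<zeta>
  define S' where "S' \<zeta> = (if \<zeta> \<in> N then (\<lambda>_. hzero (H \<zeta>)) else Q21 \<zeta>)" for \<zeta>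
  have res: "resolvent_operator (H \<zeta>) (T2 \<zeta>) (C \<zeta>) (S' \<zeta>)" if "\<zeta> \<in> space \<omega>" for \<zeta>
    using N(2) that inner_space.resolvent_operator_zero[OF fibre_inner[OF that]]
    by (auto simp: T2_def C_def S'_def)
  have zero: "(hzero (H \<zeta>), hzero (H \<zeta>)) \<in> T2 \<zeta>" "(hzero (H \<zeta>), hzero (H \<zeta>)) \<in> T1 \<zeta>" if "\<zeta> \<in> space \<omega>" for \<zeta>
    using resolvent_operator.linear[OF res[OF that]] graph_entries.T_linear[OF entries[OF that]]
    by (simp_all add: linear_operator_def hsubspace_def)
  have T_eq: "T = closed_integral_operator \<omega> H S T2"
    unfolding T1(3)
  proof (rule equalityI)
    show "closed_integral_operator \<omega> H S T1 \<subseteq> closed_integral_operator \<omega> H S T2"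
      by (rule closed_integral_operator_mono_null[OF N(1) _ zero(1)]) (simp_all add: T2_def)
    show "closed_integral_operator \<omega> H S T2 \<subseteq> closed_integral_operator \<omega> H S T1"
      by (rule closed_integral_operator_mono_null[OF N(1) _ zero(2)]) (simp_all add: T2_def)
  qed
  have sa2: "self_adjoint (direct_integral \<omega> H S) (closed_integral_operator \<omega> H S T2)"
    using assms(5) T_eq by simp
  have CS: "(\<lambda>\<zeta>. C \<zeta> (x \<zeta>)) \<in> S" "(\<lambda>\<zeta>. S' \<zeta> (x \<zeta>)) \<in> S" if x: "x \<in> S" for x
  proof -
    have "(\<lambda>\<zeta>. if \<zeta> \<in> N then x \<zeta> else Q11 \<zeta> (x \<zeta>)) \<in> S" "(\<lambda>\<zeta>. if \<zeta> \<in> N then hzero (H \<zeta>) else Q21 \<zeta> (x \<zeta>)) \<in> S"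
      using N(1) x S_zero measurable_bounded_fieldD(1)[OF Q_field(1) x] measurable_bounded_fieldD(1)[OF Q_field(3) x]
      by (auto intro!: S_if)
    moreover have "(\<lambda>\<zeta>. C \<zeta> (x \<zeta>)) = (\<lambda>\<zeta>. if \<zeta> \<in> N then x \<zeta> else Q11 \<zeta> (x \<zeta>))"
      "(\<lambda>\<zeta>. S' \<zeta> (x \<zeta>)) = (\<lambda>\<zeta>. if \<zeta> \<in> N then hzero (H \<zeta>) else Q21 \<zeta> (x \<zeta>))"
      by (auto simp: C_def S'_def)
    ultimately show "(\<lambda>\<zeta>. C \<zeta> (x \<zeta>)) \<in> S" "(\<lambda>\<zeta>. S' \<zeta> (x \<zeta>)) \<in> S" by simp_all
  qed
  note dec = spectral_decomposition_of_resolvent_field[OF sa2 res CS, folded T_eq]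
  have ae: "AE \<zeta> in \<omega>. T2 \<zeta> = T\<^sub>\<zeta> \<zeta>"
    using T1(2) AE_not_in[OF N(1)] by eventually_elim (simp add: T2_def)
  have "is_bounded_integral \<omega> H S (spectral_measure (direct_integral \<omega> H S) T B) (\<lambda>\<zeta>. spectral_measure (H \<zeta>) (T\<^sub>\<zeta> \<zeta>) B)"
    if B: "B \<in> sets borel" for B
  proof -
    obtain A where A: "measurable_bounded_field \<omega> H S A" "\<exists>C. AE \<zeta> in \<omega>. hopnorm (H \<zeta>) (A \<zeta>) \<le> C"
      "AE \<zeta> in \<omega>. A \<zeta> = spectral_measure (H \<zeta>) (T2 \<zeta>) B"
      "spectral_measure (direct_integral \<omega> H S) T B = bounded_integral_operator \<omega> H S A"
      using dec(1)[OF _ _ _ B] unfolding is_bounded_integral_def by auto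
    have "AE \<zeta> in \<omega>. A \<zeta> = spectral_measure (H \<zeta>) (T\<^sub>\<zeta> \<zeta>) B"
      using A(3) ae by eventually_elim simp
    then show ?thesis unfolding is_bounded_integral_def using A by blast
  qed
  moreover have "is_closed_integral \<omega> H S (borel_calculus (direct_integral \<omega> H S) T f) (\<lambda>\<zeta>. borel_calculus (H \<zeta>) (T\<^sub>\<zeta> \<zeta>) f)"
    if f: "f \<in> borel_measurable borel" for f
  proof -
    have "AE \<zeta> in \<omega>. borel_calculus (H \<zeta>) (T2 \<zeta>) f = borel_calculus (H \<zeta>) (T\<^sub>\<zeta> \<zeta>) f"
      using ae by eventually_elim simp
    then show ?thesis unfolding is_closed_integral_def using dec(2)[OF _ _ _ f] by blast
  qed
  ultimately show ?thesis by blast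
qed

end
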